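(* Let $\mathcal T$ be a simplicial triangulation of a bounded polyhedral domain $\Omega\subset\mathbb R^n$, let $r\ge1$ and $0\le k\le n$. Then $$\mathcal P_r\Lambda^k(\mathcal T)=\bigoplus_{\substack{f\in\Delta(\mathcal T)\\ \dim f\ge k}}E_f\big[\mathring{\mathcal P}_r\Lambda^k(f)\big],$$ where $E_f:\mathring{\mathcal P}_r\Lambda^k(f)\to\mathcal P_r\Lambda^k(\mathcal T)$ is the global extension operator determined by the extension operators $E^{k,r}_{f,g}$, that is, $(E_f\mu)|_T=E^{k,r}_{f,T}\mu$ if $T\in\mathcal T$ contains $f$ and $(E_f\mu)|_T=0$ for the other $T\in\mathcal T$.
   Context: A simplicial triangulation $\mathcal T$ of $\Omega$ is a finite set of closed $n$-simplices whose union is the closure of $\Omega$ and such that the intersection of any two is either empty or a common subsimplex of each. $\Delta(T)$ is the set of all nonempty faces of $T$ of all dimensions (including $T$), $\Delta(\mathcal T)=\bigcup_{T\in\mathcal T}\Delta(T)$. The vertices of $\mathcal T$ are numbered, $x_0,\dots,x_N$, and $\mathcal I(f)$ is the set of indices of the vertices of the simplex $f$. For $i\in\mathcal I(f)$, $\lambda_i^f$ is the barycentric coordinate: the affine function on $f$ with $\lambda_i^f(x_j)=\delta_{ij}$, $j\in\mathcal I(f)$. For simplices $f\subseteq g$, $\operatorname{tr}_{g,f}$ is the pullback of differential forms under the inclusion $f\hookrightarrow g$. For a simplex $f$, $\mathcal P_r\Lambda^k(f)$ is the space of differential $k$-forms on $f$ with coefficients polynomials of degree at most $r$, and $\mathring{\mathcal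 P}_r\Lambda^k(f)$ is the subspace of forms whose trace on $\partial f$ (on every proper face of $f$) vanishes. $\mathcal P_r\Lambda^k(\mathcal T)$ is the space of $\omega\in L^2\Lambda^k(\Omega)$ with $\omega|_T\in\mathcal P_r\Lambda^k(T)$ for all $T\in\mathcal T$ and such that for each $f\in\Delta(\mathcal T)$ with $k\le\dim f\le n-1$, $\operatorname{tr}_f\omega$ is single-valued, i.e. $\operatorname{tr}_{T,f}(\omega|_T)$ is the same for all $T\in\mathcal T$ containing $f$. For $f\subseteq g$ in $\Delta(\mathcal T)$, a multi-index $\alpha=(\alpha_i)_{i\in\mathcal I(f)}$ of nonnegative integers with $|\alpha|=r$, and an increasing map $\sigma:\{1,\dots,k\}\to\mathcal I(f)$, put $d\lambda^f_\sigma=d\lambda^f_{\sigma(1)}\wedge\cdots\wedge d\lambda^f_{\sigma(k)}$, $$\psi_i^{\alpha,f,g}=d\lambda_i^g-\frac{\alpha_i}{|\alpha|}\sum_{j\in\mathcal I(f)}d\lambda_j^g\quad(i\in\mathcal I(f)),\qquad \psi_\sigma^{\alpha,f,g}=\psi^{\alpha,f,g}_{\sigma(1)}\wedge\cdots\wedge\psi^{\alpha,f,g}_{\sigma(k)}.$$ $E^{k,r}_{f,g}:\mathcal P_r\Lambda^k(f)\to\mathcal P_r\Lambda^k(g)$ is the unique (well-defined) linear map with $E^{k,r}_{f,g}[(\lambda^f)^\alpha d\lambda^f_\sigma]=(\lambda^g)^\alpha\psi^{\alpha,f,g}_\sigma$ for all such $\alpha,\sigma$, where $(\lambda^g)^\alpha=\prod_{i\in\mathcal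 I(f)}(\lambda_i^g)^{\alpha_i}$. (For $k=0$, $\sigma$ is the empty map and $d\lambda_\sigma^f=1=\psi_\sigma^{\alpha,f,g}$.) *)

theory Defs
  imports "HOL-Analysis.Analysis"
begin

section \<open>Differential forms on simplices\<close>

text \<open>
  A differential \<open>k\<close>-form on a convex set \<open>S\<close> (of any dimension) assigns to each point of \<open>S\<close> an
  alternating \<open>k\<close>-linear function of \<open>k\<close> vectors tangent to \<open>S\<close>. It is represented by
  a function of a point and a list of vectors that is \<open>0\<close> when the point is not in \<open>S\<close> or the list
  is not a list of \<open>k\<close> tangent vectors. With this convention, equality of forms on \<open>S\<close> is equality
  of functions.
\<close>

type_synonym 'a form = "'a \<Rightarrow> 'a list \<Rightarrow> real"

definition tangent :: "'a::euclidean_space set \<Rightarrow> 'a set" where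
  "tangent S = span {y - z | y z. y \<in> S \<and> z \<in> S}"

definition alternating :: "nat \<Rightarrow> 'a::euclidean_space set \<Rightarrow> ('a list \<Rightarrow> real) \<Rightarrow> bool" where
  "alternating k V \<phi> \<longleftrightarrow>
     (\<forall>vs. \<not> (length vs = k \<and> set vs \<subseteq> V) \<longrightarrow> \<phi> vs = 0) \<and>
     (\<forall>vs i v w a b. length vs = k \<and> set vs \<subseteq> V \<and> i < k \<and> v \<in> V \<and> w \<in> V \<longrightarrow>
        \<phi> (vs[i := a *\<^sub>R v + b *\<^sub>R w]) = a * \<phi> (vs[i := v]) + b * \<phi> (vs[i := w])) \<and>
     (\<forall>vs i j. length vs = k \<and> set vs \<subseteq> V \<and> i < j \<and> j < k \<and> vs ! i = vs ! j \<longrightarrow> \<phi> vs = 0)"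

definition poly_fun :: "nat \<Rightarrow> ('a::euclidean_space \<Rightarrow> real) set" where
  "poly_fun r = {p. \<exists>c. \<forall>y. p y =
     (\<Sum>\<alpha> \<in> {\<alpha> :: 'a \<Rightarrow> nat. (\<forall>b. b \<notin> Basis \<longrightarrow> \<alpha> b = 0) \<and> (\<Sum>b\<in>Basis. \<alpha> b) \<le> r}.
        c \<alpha> * (\<Prod>b\<in>Basis. (y \<bullet> b) ^ \<alpha> b))}"

text \<open>
  The space \<open>\<P>\<^sub>r\<Lambda>\<^sup>k(S)\<close>. The coefficients of a form, with respect to any linear coordinates of the
  tangent space, are its values on lists of constant tangent vectors.
\<close>

definition poly_forms :: "nat \<Rightarrow> nat \<Rightarrow> 'a::euclidean_space set \<Rightarrow> 'a form set" where
  "poly_forms r k S = {\<omega>.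
     (\<forall>y\<in>S. alternating k (tangent S) (\<omega> y)) \<and> (\<forall>y. y \<notin> S \<longrightarrow> \<omega> y = (\<lambda>vs. 0)) \<and>
     (\<forall>vs. length vs = k \<and> set vs \<subseteq> tangent S \<longrightarrow> (\<exists>p\<in>poly_fun r. \<forall>y\<in>S. \<omega> y vs = p y))}"

text \<open>
  Pullback under the inclusion of \<open>f\<close>. It is used for forms on sets containing \<open>f\<close>, and to turn a
  formula defining a form into a form on \<open>f\<close> in the sense of the above convention.
\<close>

definition form_trace :: "'a::euclidean_space set \<Rightarrow> 'a form \<Rightarrow> 'a form" where
  "form_trace f \<omega> = (\<lambda>y vs. if y \<in> f \<and> set vs \<subseteq> tangent f then \<omega> y vs else 0)"

definition poly_forms0 :: "nat \<Rightarrow> nat \<Rightarrow> 'a::euclidean_space set \<Rightarrow> 'a form set" where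
  "poly_forms0 r k f = {\<omega> \<in> poly_forms r k f.
     \<forall>e. e face_of f \<and> e \<noteq> {} \<and> e \<noteq> f \<longrightarrow> form_trace e \<omega> = (\<lambda>y vs. 0)}"

definition wedge :: "nat \<Rightarrow> (nat \<Rightarrow> 'a \<Rightarrow> real) \<Rightarrow> 'a list \<Rightarrow> real" where
  "wedge k \<phi> vs = (if length vs = k
     then \<Sum>\<pi> | \<pi> permutes {..<k}. of_int (sign \<pi>) * (\<Prod>m<k. \<phi> m (vs ! \<pi> m)) else 0)"


section \<open>Triangulations\<close>

definition polyhedral_domain :: "'a::euclidean_space set \<Rightarrow> bool" where
  "polyhedral_domain \<Omega> \<longleftrightarrow> open \<Omega> \<and> connected \<Omega> \<and> \<Omega> \<noteq> {} \<and>
     (\<exists>\<F>. finite \<F> \<and> (\<forall>P\<in>\<F>. polytope P) \<and> frontier \<Omega> = \<Union>\<F>)"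

definition simplicial_triangulation ::
  "'a::euclidean_space set set \<Rightarrow> 'a set \<Rightarrow> bool" where
  "simplicial_triangulation \<T> \<Omega> \<longleftrightarrow>
     triangulation \<T> \<and> (\<forall>T\<in>\<T>. int DIM('a) simplex T) \<and> \<Union>\<T> = closure \<Omega>"

definition faces :: "'a::euclidean_space set set \<Rightarrow> 'a set set" where
  "faces \<T> = {f. f \<noteq> {} \<and> (\<exists>T\<in>\<T>. f face_of T)}"

text \<open>The numbering \<open>x\<^sub>0, \<dots>, x\<^sub>N\<close> of the vertices is a list \<open>xs\<close> without repetitions.\<close>

definition vertex_numbering :: "'a::euclidean_space set set \<Rightarrow> 'a list \<Rightarrow> bool" where
  "vertex_numbering \<T> xs \<longleftrightarrow> distinct xs \<and> set xs = {v. \<exists>T\<in>\<T>. v extreme_point_of T}"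

definition vertex_indices :: "'a::euclidean_space list \<Rightarrow> 'a set \<Rightarrow> nat set" where
  "vertex_indices xs f = {i. i < length xs \<and> xs ! i extreme_point_of f}"


section \<open>Barycentric coordinates and the extension operators\<close>

text \<open>
  For a simplex \<open>f\<close>, \<open>bary xs f i\<close> is the affine function on the affine hull of \<open>f\<close> (put to \<open>0\<close>
  elsewhere) that is \<open>1\<close> at the \<open>i\<close>-th vertex and \<open>0\<close> at the other vertices of \<open>f\<close>.
\<close>

definition bary :: "'a::euclidean_space list \<Rightarrow> 'a set \<Rightarrow> nat \<Rightarrow> 'a \<Rightarrow> real" where
  "bary xs f i = (THE l.
     (\<exists>h c. linear h \<and> (\<forall>y\<in>affine hull f. l y = h y + c)) \<and>
     (\<forall>y. y \<notin> affine hull f \<longrightarrow> l y = 0) \<and>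
     (\<forall>j\<in>vertex_indices xs f. l (xs ! j) = (if j = i then 1 else 0)))"

text \<open>
  The differential of the affine function \<open>bary xs f i\<close>, at a vector tangent to \<open>f\<close>, is an increment
  that does not depend on the base point, for which we take the \<open>i\<close>-th vertex.
\<close>

definition dbary :: "'a::euclidean_space list \<Rightarrow> 'a set \<Rightarrow> nat \<Rightarrow> 'a \<Rightarrow> real" where
  "dbary xs f i v = bary xs f i (xs ! i + v) - bary xs f i (xs ! i)"

definition psi ::
  "'a::euclidean_space list \<Rightarrow> (nat \<Rightarrow> nat) \<Rightarrow> 'a set \<Rightarrow> 'a set \<Rightarrow> nat \<Rightarrow> 'a \<Rightarrow> real" where
  "psi xs \<alpha> f g i v = dbary xs g i v -
     real (\<alpha> i) / real (\<Sum>j\<in>vertex_indices xs f. \<alpha> j) * (\<Sum>j\<in>vertex_indices xs f. dbary xs g j v)"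

text \<open>\<open>(\<lambda>\<^sup>f)\<^sup>\<alpha> d\<lambda>\<^sup>f\<^sub>\<sigma>\<close> as a form on \<open>f\<close>, and \<open>(\<lambda>\<^sup>g)\<^sup>\<alpha> \<psi>\<^sub>\<sigma>\<close> as a form on \<open>g\<close>.\<close>

definition bary_form ::
  "'a::euclidean_space list \<Rightarrow> nat \<Rightarrow> 'a set \<Rightarrow> (nat \<Rightarrow> nat) \<Rightarrow> (nat \<Rightarrow> nat) \<Rightarrow> 'a form" where
  "bary_form xs k f \<alpha> \<sigma> = form_trace f (\<lambda>y vs.
     (\<Prod>i\<in>vertex_indices xs f. bary xs f i y ^ \<alpha> i) * wedge k (\<lambda>m. dbary xs f (\<sigma> m)) vs)"

definition psi_form ::
  "'a::euclidean_space list \<Rightarrow> nat \<Rightarrow> 'a set \<Rightarrow> 'a set \<Rightarrow> (nat \<Rightarrow> nat) \<Rightarrow> (nat \<Rightarrow> nat) \<Rightarrow> 'a form"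
  where
  "psi_form xs k f g \<alpha> \<sigma> = form_trace g (\<lambda>y vs.
     (\<Prod>i\<in>vertex_indices xs f. bary xs g i y ^ \<alpha> i) * wedge k (\<lambda>m. psi xs \<alpha> f g (\<sigma> m)) vs)"

text \<open>
  The operator \<open>E\<^sup>k\<^sup>,\<^sup>r\<^bsub>f,g\<^esub>\<close>, put to \<open>0\<close> outside \<open>\<P>\<^sub>r\<Lambda>\<^sup>k(f)\<close>. Only the values of \<open>\<alpha>\<close> on the vertex
  indices of \<open>f\<close> and those of \<open>\<sigma>\<close> on \<open>{..<k}\<close> (instead of \<open>{1..k}\<close>) matter.
\<close>

definition ext_op ::
  "'a::euclidean_space list \<Rightarrow> nat \<Rightarrow> nat \<Rightarrow> 'a set \<Rightarrow> 'a set \<Rightarrow> 'a form \<Rightarrow> 'a form" where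
  "ext_op xs k r f g = (THE E.
     (\<forall>\<omega>\<in>poly_forms r k f. E \<omega> \<in> poly_forms r k g) \<and>
     (\<forall>\<omega>\<in>poly_forms r k f. \<forall>\<eta>\<in>poly_forms r k f. \<forall>a b.
        E (\<lambda>y vs. a * \<omega> y vs + b * \<eta> y vs) = (\<lambda>y vs. a * E \<omega> y vs + b * E \<eta> y vs)) \<and>
     (\<forall>\<alpha> \<sigma>. (\<Sum>i\<in>vertex_indices xs f. \<alpha> i) = r \<and>
        strict_mono_on {..<k} \<sigma> \<and> \<sigma> ` {..<k} \<subseteq> vertex_indices xs f \<longrightarrow>
        E (bary_form xs k f \<alpha> \<sigma>) = psi_form xs k f g \<alpha> \<sigma>) \<and>
     (\<forall>\<omega>. \<omega> \<notin> poly_forms r k f \<longrightarrow> E \<omega> = (\<lambda>y vs. 0)))"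


section \<open>Square-integrable forms\<close>

quotient_type (overloaded) 'a ae_form = "'a::euclidean_space \<Rightarrow> 'a list \<Rightarrow> real" /
  "\<lambda>\<omega> \<eta>. AE y in lebesgue. \<omega> y = \<eta> y"
  by (rule equivpI) (auto simp: reflp_def symp_def transp_def elim: eventually_elim2)

instantiation ae_form :: (euclidean_space) real_vector
begin

lift_definition zero_ae_form :: "'a ae_form" is "\<lambda>y vs. 0" .

lift_definition plus_ae_form :: "'a ae_form \<Rightarrow> 'a ae_form \<Rightarrow> 'a ae_form"
  is "\<lambda>\<omega> \<eta> y vs. \<omega> y vs + \<eta> y vs"
  by (auto elim: eventually_elim2)

lift_definition minus_ae_form :: "'a ae_form \<Rightarrow> 'a ae_form \<Rightarrow> 'a ae_form"
  is "\<lambda>\<omega> \<eta> y vs. \<omega> y vs - \<eta> y vs"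
  by (auto elim: eventually_elim2)

lift_definition uminus_ae_form :: "'a ae_form \<Rightarrow> 'a ae_form"
  is "\<lambda>\<omega> y vs. - \<omega> y vs"
  by (auto elim: eventually_mono)

lift_definition scaleR_ae_form :: "real \<Rightarrow> 'a ae_form \<Rightarrow> 'a ae_form"
  is "\<lambda>c \<omega> y vs. c * \<omega> y vs"
  by (auto elim: eventually_mono)

instance
  by standard (transfer; simp add: algebra_simps)+

end

text \<open>
  \<open>L\<^sup>2\<Lambda>\<^sup>k(\<Omega>)\<close>, whose elements are classes modulo equality almost everywhere; forms on \<open>\<Omega>\<close> are extended
  by \<open>0\<close> to the whole space. Square integrability of the coefficients is expressed by the values on
  lists of constant vectors, as for polynomial forms.
\<close>

definition L2_forms :: "nat \<Rightarrow> 'a::euclidean_space set \<Rightarrow> 'a ae_form set" where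
  "L2_forms k \<Omega> = abs_ae_form ` {\<omega>.
     (\<forall>y\<in>\<Omega>. alternating k UNIV (\<omega> y)) \<and> (\<forall>y. y \<notin> \<Omega> \<longrightarrow> \<omega> y = (\<lambda>vs. 0)) \<and>
     (\<forall>vs. (\<lambda>y. \<omega> y vs) \<in> borel_measurable lebesgue \<and> integrable lebesgue (\<lambda>y. (\<omega> y vs)\<^sup>2))}"

text \<open>
  \<open>restricts_to u T p\<close> says \<open>u|\<^sub>T = p\<close> almost everywhere. For an \<open>n\<close>-simplex \<open>T\<close> of a triangulation and
  a given \<open>u\<close> there is at most one polynomial form \<open>p\<close> on \<open>T\<close> with this property.
\<close>

lift_definition restricts_to :: "'a::euclidean_space ae_form \<Rightarrow> 'a set \<Rightarrow> 'a form \<Rightarrow> bool"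
  is "\<lambda>\<omega> T p. AE y in lebesgue. y \<in> T \<longrightarrow> \<omega> y = p y"
  by (intro iffI ext) (auto elim: eventually_elim2)

text \<open>The space \<open>\<P>\<^sub>r\<Lambda>\<^sup>k(\<T>)\<close>; \<open>p T\<close> is the polynomial form \<open>u|\<^sub>T\<close>.\<close>

definition piecewise_poly_forms ::
  "nat \<Rightarrow> nat \<Rightarrow> 'a::euclidean_space set set \<Rightarrow> 'a set \<Rightarrow> 'a ae_form set" where
  "piecewise_poly_forms r k \<T> \<Omega> = {u \<in> L2_forms k \<Omega>. \<exists>p.
     (\<forall>T\<in>\<T>. p T \<in> poly_forms r k T \<and> restricts_to u T (p T)) \<and>
     (\<forall>f\<in>faces \<T>. int k \<le> aff_dim f \<and> aff_dim f \<le> int DIM('a) - 1 \<longrightarrow>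
        (\<forall>T\<in>\<T>. \<forall>T'\<in>\<T>. f \<subseteq> T \<and> f \<subseteq> T' \<longrightarrow> form_trace f (p T) = form_trace f (p T')))}"

text \<open>The global extension operator \<open>E\<^sub>f\<close>.\<close>

definition global_ext ::
  "'a::euclidean_space list \<Rightarrow> nat \<Rightarrow> nat \<Rightarrow> 'a set set \<Rightarrow> 'a set \<Rightarrow> 'a set \<Rightarrow> 'a form \<Rightarrow> 'a ae_form"
  where
  "global_ext xs k r \<T> \<Omega> f \<mu> = (THE u. u \<in> L2_forms k \<Omega> \<and>
     (\<forall>T\<in>\<T>. restricts_to u T (if f \<subseteq> T then ext_op xs k r f T \<mu> else (\<lambda>y vs. 0))))"


section \<open>Direct sums\<close>

definition is_direct_sum ::
  "'v::real_vector set \<Rightarrow> 'i set \<Rightarrow> ('i \<Rightarrow> 'v set) \<Rightarrow> bool" where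
  "is_direct_sum U I W \<longleftrightarrow> finite I \<and> subspace U \<and> (\<forall>i\<in>I. subspace (W i) \<and> W i \<subseteq> U) \<and>
     (\<forall>u\<in>U. \<exists>!w. w \<in> Pi\<^sub>E I W \<and> u = (\<Sum>i\<in>I. w i))"

end

theory Submission
  imports Defs
begin

text \<open>
  Every \<open>\<mu> \<in> \<P>\<^sub>r\<Lambda>\<^sup>k(f)\<close> is uniquely \<open>\<Sum>\<^bsub>|\<alpha>|=r\<^esub> (\<lambda>\<^sup>f)\<^sup>\<alpha> c\<^sub>\<alpha>\<close> with constant alternating forms \<open>c\<^sub>\<alpha>\<close>, and the
  extension of \<open>\<mu>\<close> to \<open>g\<close> is \<open>\<Sum>\<^sub>\<alpha> (\<lambda>\<^sup>g)\<^sup>\<alpha> L\<^sub>\<alpha>\<^sup>* c\<^sub>\<alpha>\<close>, where \<open>L\<^sub>\<alpha> v = \<Sum>\<^sub>i \<psi>\<^sub>i(v) x\<^sub>i\<close> maps the tangent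
  space of \<open>g\<close> to that of \<open>f\<close>. From this formula, extension from \<open>f\<close> to \<open>f\<close> is the identity,
  extension to \<open>g\<close> followed by the trace on a face \<open>h \<supseteq> f\<close> is extension to \<open>h\<close>, and if \<open>\<mu>\<close> has
  vanishing trace on the boundary of \<open>f\<close>, its extension has vanishing trace on every face \<open>h\<close> that does
  not contain \<open>f\<close>: on \<open>h\<close> only the \<open>\<alpha>\<close> supported in \<open>f \<inter> h\<close> matter, and \<open>L\<^sub>\<alpha>\<close> maps vectors tangent to
  \<open>h\<close> to vectors tangent to \<open>f \<inter> h\<close>, where \<open>c\<^sub>\<alpha>\<close> is zero. Hence for a family of forms with
  single-valued traces \<open>\<phi>\<^sub>h\<close> the equations \<open>\<phi>\<^sub>h = \<Sum>\<^bsub>f \<subseteq> h\<^esub> E\<^bsub>f,h\<^esub> \<mu>\<^sub>f\<close> are triangular with respect to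
  inclusion of faces. They are solved uniquely by
  \<open>\<mu>\<^sub>h = \<phi>\<^sub>h - \<Sum>\<^bsub>f \<subset> h\<^esub> E\<^bsub>f,h\<^esub> \<mu>\<^sub>f\<close>, which has vanishing trace on the boundary of \<open>h\<close>.
\<close>


section \<open>Spans of monomials\<close>

text \<open>Two relations explain the shape of the expansion. On f the barycentric coordinates sum
  to 1, so polynomials of degree at most r are exactly the homogeneous ones of degree r in them, and
  only in homogeneous form are the coefficients unique. The differentials sum to 0, so the forms
  \<open>(\<lambda>^f)^\<alpha> d\<lambda>_\<sigma>\<close> span without being independent, and a
  map prescribed on them must respect this relation. The weights \<open>\<alpha>_i / r\<close> of
  the correction in \<open>\<psi>_i\<close> sum to 1, hence the \<open>\<psi>_i\<close> again sum to
  0. Working with whole coefficients \<open>c_\<alpha>\<close> instead of generators makes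
  well-definedness automatic. If \<open>\<alpha>_i = 0\<close>, the correction vanishes and
  \<open>\<psi>_i\<close> is \<open>d\<lambda>_i\<close>, which is zero along faces of g without
  vertex i; this confines \<open>L_\<alpha>\<close> to f \<inter> h. A second obstacle is that
  members of the space are classes modulo null sets, whereas traces need values on faces, which are
  null. Hence traces are handled with exact forms on closed simplices, and classes enter only
  through gluing, where the polynomial form on each simplex is recovered from the class.\<close>

definition mono_span ::
  "'s set \<Rightarrow> 'b set \<Rightarrow> ('b \<Rightarrow> nat) set \<Rightarrow> ('b \<Rightarrow> 's \<Rightarrow> real) \<Rightarrow> ('s \<Rightarrow> real) set" where
  "mono_span S B D X = {p. \<exists>c. \<forall>y\<in>S. p y = (\<Sum>\<alpha>\<in>D. c \<alpha> * (\<Prod>b\<in>B. X b y ^ \<alpha> b))}"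

text \<open>Exponents are pinned to 0 outside B, so that their values on B determine them and
  finitely many remain when B is finite.\<close>

definition hom_exponents :: "'b set \<Rightarrow> nat \<Rightarrow> ('b \<Rightarrow> nat) set" where
  "hom_exponents B r = {\<alpha>. (\<forall>b. b \<notin> B \<longrightarrow> \<alpha> b = 0) \<and> (\<Sum>b\<in>B. \<alpha> b) = r}"

definition exponents_le :: "'b set \<Rightarrow> nat \<Rightarrow> ('b \<Rightarrow> nat) set" where
  "exponents_le B r = {\<alpha>. (\<forall>b. b \<notin> B \<longrightarrow> \<alpha> b = 0) \<and> (\<Sum>b\<in>B. \<alpha> b) \<le> r}"

lemma finite_exponents_le:
  assumes "finite B"
  shows "finite (exponents_le B r)"
proof -
  have "exponents_le B r \<subseteq> {\<alpha>. \<alpha> ` B \<subseteq> {..r} \<and> {x. \<alpha> x \<noteq> 0} \<subseteq> B}"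
  proof
    fix \<alpha> assume a: "\<alpha> \<in> exponents_le B r"
    have "\<alpha> b \<le> r" if "b \<in> B" for b
      using a member_le_sum[of b B \<alpha>] that assms unfolding exponents_le_def by force
    with a show "\<alpha> \<in> {\<alpha>. \<alpha> ` B \<subseteq> {..r} \<and> {x. \<alpha> x \<noteq> 0} \<subseteq> B}"
      by (auto simp: exponents_le_def)
  qed
  moreover have "finite {\<alpha>. \<alpha> ` B \<subseteq> {..r} \<and> {x. \<alpha> x \<noteq> 0} \<subseteq> B}"
    using finite_set_of_finite_funs[OF assms, of "{..r}" 0]
    by (rule rev_finite_subset) auto
  ultimately show ?thesis by (rule finite_subset)
qed

lemma finite_hom_exponents: "finite B \<Longrightarrow> finite (hom_exponents B r)"
  by (rule finite_subset[OF _ finite_exponents_le[of B r]])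
     (auto simp: hom_exponents_def exponents_le_def)

lemma mono_span_monomial:
  assumes "finite D" "\<alpha> \<in> D"
  shows "(\<lambda>y. \<Prod>b\<in>B. X b y ^ \<alpha> b) \<in> mono_span S B D X"
  unfolding mono_span_def
  by (intro CollectI exI[of _ "\<lambda>\<beta>. if \<beta> = \<alpha> then 1 else 0"])
     (auto simp: assms if_distrib[of "\<lambda>x. x * _"] cong: if_cong)

lemma mono_span_lincomb:
  assumes "p \<in> mono_span S B D X" "q \<in> mono_span S B D X"
  shows "(\<lambda>y. a * p y + b * q y) \<in> mono_span S B D X"
proof -
  from assms obtain c d where
    "\<forall>y\<in>S. p y = (\<Sum>\<alpha>\<in>D. c \<alpha> * (\<Prod>b\<in>B. X b y ^ \<alpha> b))"
    "\<forall>y\<in>S. q y = (\<Sum>\<alpha>\<in>D. d \<alpha> * (\<Prod>b\<in>B. X b y ^ \<alpha> b))"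
    by (auto simp: mono_span_def)
  then show ?thesis unfolding mono_span_def
    by (intro CollectI exI[of _ "\<lambda>\<alpha>. a * c \<alpha> + b * d \<alpha>"])
       (auto simp: algebra_simps sum.distrib sum_distrib_left)
qed

lemma mono_span_zero: "(\<lambda>y. 0) \<in> mono_span S B D X"
  unfolding mono_span_def by (intro CollectI exI[of _ "\<lambda>\<alpha>. 0"]) auto

lemma mono_span_add:
  "p \<in> mono_span S B D X \<Longrightarrow> q \<in> mono_span S B D X \<Longrightarrow> (\<lambda>y. p y + q y) \<in> mono_span S B D X"
  using mono_span_lincomb[of p S B D X q 1 1] by simp

lemma mono_span_scale: "p \<in> mono_span S B D X \<Longrightarrow> (\<lambda>y. a * p y) \<in> mono_span S B D X"
  using mono_span_lincomb[of p S B D X p a 0] by simp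

lemma mono_span_sum:
  assumes "\<And>i. i \<in> J \<Longrightarrow> p i \<in> mono_span S B D X"
  shows "(\<lambda>y. \<Sum>i\<in>J. p i y) \<in> mono_span S B D X"
  using assms
  by (induction J rule: infinite_finite_induct) (auto intro: mono_span_zero mono_span_add)

lemma mono_span_cong: "p \<in> mono_span S B D X \<Longrightarrow> (\<And>y. y \<in> S \<Longrightarrow> p y = q y) \<Longrightarrow> q \<in> mono_span S B D X"
  by (auto simp: mono_span_def)

lemma mono_span_subset:
  assumes "p \<in> mono_span S B D X" "S' \<subseteq> S" "D \<subseteq> D'" "finite D'"
  shows "p \<in> mono_span S' B D' X"
proof -
  from assms(1) obtain c where c: "\<And>y. y \<in> S \<Longrightarrow> p y = (\<Sum>\<alpha>\<in>D. c \<alpha> * (\<Prod>b\<in>B. X b y ^ \<alpha> b))"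
    by (auto simp: mono_span_def)
  have "(\<lambda>y. \<Sum>\<alpha>\<in>D. c \<alpha> * (\<Prod>b\<in>B. X b y ^ \<alpha> b)) \<in> mono_span S' B D' X"
    using assms by (intro mono_span_sum mono_span_scale mono_span_monomial) auto
  then show ?thesis by (rule mono_span_cong) (use c assms in auto)
qed

lemma mono_span_times_var:
  assumes p: "p \<in> mono_span S B D X" and b: "b \<in> B" "finite B" and D': "finite D'"
    and sh: "\<And>\<alpha>. \<alpha> \<in> D \<Longrightarrow> \<alpha>(b := Suc (\<alpha> b)) \<in> D'"
  shows "(\<lambda>y. X b y * p y) \<in> mono_span S B D' X"
proof -
  from p obtain c where c: "\<And>y. y \<in> S \<Longrightarrow> p y = (\<Sum>\<alpha>\<in>D. c \<alpha> * (\<Prod>b\<in>B. X b y ^ \<alpha> b))"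
    by (auto simp: mono_span_def)
  have m: "(\<Prod>b'\<in>B. X b' y ^ (\<alpha>(b := Suc (\<alpha> b))) b') = X b y * (\<Prod>b\<in>B. X b y ^ \<alpha> b)" for \<alpha> y
    using b by (simp add: prod.remove[of B b] mult.assoc)
  have "(\<lambda>y. \<Sum>\<alpha>\<in>D. c \<alpha> * (\<Prod>b'\<in>B. X b' y ^ (\<alpha>(b := Suc (\<alpha> b))) b')) \<in> mono_span S B D' X"
    using sh D' by (intro mono_span_sum mono_span_scale mono_span_monomial)
  then show ?thesis
    by (rule mono_span_cong) (simp only: m c sum_distrib_left mult_ac)
qed

lemma sum_fun_upd_Suc:
  fixes \<alpha> :: "'b \<Rightarrow> nat"
  assumes "finite B" "b \<in> B"
  shows "(\<Sum>x\<in>B. if x = b then Suc (\<alpha> b) else \<alpha> x) = Suc (sum \<alpha> B)"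
proof -
  have "(\<Sum>x\<in>B - {b}. if x = b then Suc (\<alpha> b) else \<alpha> x) = (\<Sum>x\<in>B - {b}. \<alpha> x)"
    by (rule sum.cong) auto
  with assms show ?thesis by (simp add: sum.remove[of B b])
qed

lemma mono_span_hom_times_linear:
  assumes p: "p \<in> mono_span S B (hom_exponents B r) X" and B: "finite B"
    and l: "\<And>y. y \<in> S \<Longrightarrow> l y = (\<Sum>b\<in>B. a b * X b y)"
  shows "(\<lambda>y. l y * p y) \<in> mono_span S B (hom_exponents B (Suc r)) X"
proof -
  have "(\<lambda>y. \<Sum>b\<in>B. a b * (X b y * p y)) \<in> mono_span S B (hom_exponents B (Suc r)) X"
    by (intro mono_span_sum mono_span_scale mono_span_times_var[OF p])
       (use B in \<open>auto simp: finite_hom_exponents\<close>, auto simp: hom_exponents_def sum_fun_upd_Suc)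
  then show ?thesis
    by (rule mono_span_cong) (simp add: l sum_distrib_right mult.assoc)
qed

lemma mono_span_le_times_affine:
  assumes p: "p \<in> mono_span S B (exponents_le B r) X" and B: "finite B"
    and l: "\<And>y. y \<in> S \<Longrightarrow> l y = (\<Sum>b\<in>B. a b * X b y) + c"
  shows "(\<lambda>y. l y * p y) \<in> mono_span S B (exponents_le B (Suc r)) X"
proof -
  have "p \<in> mono_span S B (exponents_le B (Suc r)) X"
    by (rule mono_span_subset[OF p]) (use B in \<open>auto simp: finite_exponents_le\<close>, auto simp: exponents_le_def)
  moreover have "(\<lambda>y. \<Sum>b\<in>B. a b * (X b y * p y)) \<in> mono_span S B (exponents_le B (Suc r)) X"
    by (intro mono_span_sum mono_span_scale mono_span_times_var[OF p])
       (use B in \<open>auto simp: finite_exponents_le\<close>, auto simp: exponents_le_def sum_fun_upd_Suc)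
  ultimately have "(\<lambda>y. (\<Sum>b\<in>B. a b * (X b y * p y)) + c * p y)
      \<in> mono_span S B (exponents_le B (Suc r)) X"
    by (intro mono_span_add mono_span_scale)
  then show ?thesis
    by (rule mono_span_cong) (simp add: l distrib_right sum_distrib_right mult.assoc)
qed

text \<open>\<open>mono_span\<close> leaves the variables X arbitrary and tests equality on S only,
  so that Cartesian coordinates on the whole space (here) and barycentric coordinates on a simplex
  (later) obey the same closure rules.\<close>

lemma poly_fun_eq_mono_span:
  "poly_fun r = mono_span UNIV Basis (exponents_le Basis r) (\<lambda>b (y::'a::euclidean_space). y \<bullet> b)"
  by (simp add: poly_fun_def mono_span_def exponents_le_def)

text \<open>Builds a monomial one factor at a time, with P also recording the degree reached. It
  serves both for monomials in affine functions of Cartesian coordinates and for Cartesian monomials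
  rewritten in barycentric coordinates.\<close>

lemma prod_power_induct [consumes 1, case_names one step]:
  fixes X :: "'b \<Rightarrow> 's \<Rightarrow> real" and \<alpha> :: "'b \<Rightarrow> nat"
  assumes "finite B"
    and one: "P 0 (\<lambda>y. 1)"
    and step: "\<And>b r p. b \<in> B \<Longrightarrow> P r p \<Longrightarrow> P (Suc r) (\<lambda>y. X b y * p y)"
  shows "P (sum \<alpha> B) (\<lambda>y. \<Prod>b\<in>B. X b y ^ \<alpha> b)"
  using assms(1) step
proof (induction B rule: finite_induct)
  case empty
  then show ?case using one by simp
next
  case (insert b B)
  \<comment> \<open>The power of the new variable is raised by an inner induction; m is finally
    \<open>\<alpha> b\<close>.\<close>
  have "P (m + sum \<alpha> B) (\<lambda>y. X b y ^ m * (\<Prod>b\<in>B. X b y ^ \<alpha> b))" for m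
  proof (induction m)
    case 0
    then show ?case using insert by simp
  next
    case (Suc m)
    then show ?case using insert.prems[of b, OF _ Suc] by (simp add: mult.assoc)
  qed
  with insert show ?case by simp
qed

lemma linear_eq_sum_Basis:
  fixes h :: "'a::euclidean_space \<Rightarrow> real"
  assumes "linear h"
  shows "h y = (\<Sum>b\<in>Basis. h b * (y \<bullet> b))"
proof -
  have "h y = h (\<Sum>b\<in>Basis. (y \<bullet> b) *\<^sub>R b)" by (simp add: euclidean_representation)
  also have "\<dots> = (\<Sum>b\<in>Basis. h b * (y \<bullet> b))"
    using assms by (simp add: linear_sum linear_cmul mult.commute)
  finally show ?thesis .
qed

lemma poly_fun_affine_monomial:
  fixes l :: "'b \<Rightarrow> 'a::euclidean_space \<Rightarrow> real"
  assumes B: "finite B" and l: "\<And>b. b \<in> B \<Longrightarrow> \<exists>h c. linear h \<and> (\<forall>y. l b y = h y + c)"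
  shows "(\<lambda>y. \<Prod>b\<in>B. l b y ^ \<alpha> b) \<in> poly_fun (sum \<alpha> B)"
  using B
proof (induction rule: prod_power_induct[where P = "\<lambda>r p. p \<in> poly_fun r"])
  case one
  show ?case unfolding poly_fun_eq_mono_span
    by (rule mono_span_cong[OF mono_span_monomial[of _ "\<lambda>_. 0"]])
       (auto simp: finite_exponents_le, auto simp: exponents_le_def)
next
  case (step b r p)
  from l[OF step(1)] obtain h c where h: "linear h" "\<And>y. l b y = h y + c" by blast
  have "l b y = (\<Sum>i\<in>Basis. h i * (y \<bullet> i)) + c" for y
    using h linear_eq_sum_Basis[of h y] by simp
  then show ?case using step(2) unfolding poly_fun_eq_mono_span
    by (intro mono_span_le_times_affine[where a = h and c = c]) auto
qed

text \<open>Homogenization: a monomial of lower degree is multiplied by a power of \<open>1 = \<Sum>\<^sub>b X\<^sub>b\<close>.\<close>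

lemma poly_fun_imp_hom:
  fixes X :: "'b \<Rightarrow> 'a::euclidean_space \<Rightarrow> real"
  assumes B: "finite B" and one: "\<And>y. y \<in> S \<Longrightarrow> (\<Sum>b\<in>B. X b y) = 1"
    and rep: "\<And>y. y \<in> S \<Longrightarrow> (\<Sum>b\<in>B. X b y *\<^sub>R x b) = y"
    and p: "p \<in> poly_fun r"
  shows "p \<in> mono_span S B (hom_exponents B r) X"
proof -
  have up: "q \<in> mono_span S B (hom_exponents B (d + s)) X"
    if "q \<in> mono_span S B (hom_exponents B s) X" for q s d
  proof (induction d)
    case (Suc d)
    have "(\<lambda>y. 1 * q y) \<in> mono_span S B (hom_exponents B (Suc (d + s))) X"
      using B one by (intro mono_span_hom_times_linear[OF Suc, where a = "\<lambda>_. 1"]) auto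
    then show ?case by simp
  qed (use that in simp)
  have mon: "(\<lambda>y. \<Prod>b\<in>Basis. (y \<bullet> b) ^ \<alpha> b) \<in> mono_span S B (hom_exponents B (sum \<alpha> Basis)) X" for \<alpha>
    using finite_Basis
  proof (induction rule: prod_power_induct
      [where P = "\<lambda>r p. p \<in> mono_span S B (hom_exponents B r) X" and X = "\<lambda>b y. y \<bullet> b"])
    case one
    show ?case
      by (rule mono_span_cong[OF mono_span_monomial[of _ "\<lambda>_. 0"]])
         (use B in \<open>auto simp: finite_hom_exponents\<close>, auto simp: hom_exponents_def)
  next
    case (step e s q)
    \<comment> \<open>A Cartesian coordinate is linear in the variables X on S, because y is the
      combination of the points \<open>x b\<close> with weights \<open>X b y\<close>.\<close>
    have "y \<bullet> e = (\<Sum>b\<in>B. (x b \<bullet> e) * X b y)" if "y \<in> S" for y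
    proof -
      have "y \<bullet> e = (\<Sum>b\<in>B. X b y *\<^sub>R x b) \<bullet> e" using rep[OF that] by simp
      then show ?thesis by (simp add: inner_sum_left mult.commute)
    qed
    then show ?case using B
      by (intro mono_span_hom_times_linear[OF step(2), where a = "\<lambda>b. x b \<bullet> e"]) auto
  qed
  from p obtain c where c: "\<And>y. p y = (\<Sum>\<alpha>\<in>exponents_le Basis r. c \<alpha> * (\<Prod>b\<in>Basis. (y \<bullet> b) ^ \<alpha> b))"
    by (auto simp: poly_fun_eq_mono_span mono_span_def)
  have "(\<lambda>y. \<Sum>\<alpha>\<in>exponents_le Basis r. c \<alpha> * (\<Prod>b\<in>Basis. (y \<bullet> b) ^ \<alpha> b))
      \<in> mono_span S B (hom_exponents B r) X"
  proof (intro mono_span_sum mono_span_scale)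
    fix \<alpha> :: "'a \<Rightarrow> nat" assume "\<alpha> \<in> exponents_le Basis r"
    then have "r = (r - sum \<alpha> Basis) + sum \<alpha> Basis" by (simp add: exponents_le_def)
    with up[OF mon[of \<alpha>], of "r - sum \<alpha> Basis"]
    show "(\<lambda>y. \<Prod>b\<in>Basis. (y \<bullet> b) ^ \<alpha> b) \<in> mono_span S B (hom_exponents B r) X" by simp
  qed
  then show ?thesis by (rule mono_span_cong) (simp add: c)
qed

lemma continuous_poly_fun:
  assumes "p \<in> poly_fun r"
  shows "continuous_on S p"
proof -
  from assms obtain c where
    "p = (\<lambda>y. \<Sum>\<alpha>\<in>exponents_le Basis r. c \<alpha> * (\<Prod>b\<in>Basis. (y \<bullet> b) ^ \<alpha> b))"
    by (auto simp: poly_fun_eq_mono_span mono_span_def)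
  then show ?thesis by (auto intro!: continuous_intros)
qed

lemma poly_fun_lincomb:
  "p \<in> poly_fun r \<Longrightarrow> q \<in> poly_fun r \<Longrightarrow> (\<lambda>y. a * p y + b * q y) \<in> poly_fun r"
  unfolding poly_fun_eq_mono_span by (rule mono_span_lincomb)

lemma poly_fun_sum:
  "(\<And>i. i \<in> J \<Longrightarrow> p i \<in> poly_fun r) \<Longrightarrow> (\<lambda>y. \<Sum>i\<in>J. p i y) \<in> poly_fun r"
  unfolding poly_fun_eq_mono_span by (rule mono_span_sum)

lemma poly_fun_scale: "p \<in> poly_fun r \<Longrightarrow> (\<lambda>y. a * p y) \<in> poly_fun r"
  unfolding poly_fun_eq_mono_span by (rule mono_span_scale)

text \<open>Induction on the variables: isolate b and read the sum as a polynomial in the value s of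
  b. It vanishes for all s > 0, so it has infinitely many roots and all its coefficients are 0; the
  coefficient of \<open>s ^ \<alpha> b\<close> is a sum of the same kind in fewer variables.
  Exponents in D are still told apart by the remaining variables, because D is cut down to those
  with the same value at b.\<close>

lemma monomials_independent_pos:
  fixes c :: "('b \<Rightarrow> nat) \<Rightarrow> real"
  assumes "finite B" "finite D"
    and "\<And>\<alpha> \<beta>. \<alpha> \<in> D \<Longrightarrow> \<beta> \<in> D \<Longrightarrow> (\<And>b. b \<in> B \<Longrightarrow> \<alpha> b = \<beta> b) \<Longrightarrow> \<alpha> = \<beta>"
    and "\<And>t. (\<And>b. t b > 0) \<Longrightarrow> (\<Sum>\<alpha>\<in>D. c \<alpha> * (\<Prod>b\<in>B. t b ^ \<alpha> b)) = 0"
    and "\<alpha> \<in> D"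
  shows "c \<alpha> = 0"
  using assms
proof (induction B arbitrary: D \<alpha> rule: finite_induct)
  case empty
  then have "D = {\<alpha>}" by auto
  then show ?case using empty(3)[of "\<lambda>_. 1"] by simp
next
  case (insert b B)
  let ?m = "\<alpha> b"
  let ?D = "{\<beta> \<in> D. \<beta> b = ?m}"
  obtain N where N: "\<And>\<beta>. \<beta> \<in> D \<Longrightarrow> \<beta> b \<le> N"
    using finite_nat_set_iff_bounded_le[of "(\<lambda>\<beta>. \<beta> b) ` D"] insert.prems(1) by auto
  show ?case
  proof (rule insert.IH[of ?D])
    show "finite ?D" using insert.prems by simp
    show "\<beta> = \<gamma>" if "\<beta> \<in> ?D" "\<gamma> \<in> ?D" "\<And>a. a \<in> B \<Longrightarrow> \<beta> a = \<gamma> a" for \<beta> \<gamma>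
      using that by (intro insert.prems(2)) auto
    show "\<alpha> \<in> ?D" using insert.prems by simp
    fix t :: "'b \<Rightarrow> real" assume t: "\<And>b. t b > 0"
    let ?a = "\<lambda>m. \<Sum>\<beta>\<in>{\<beta> \<in> D. \<beta> b = m}. c \<beta> * (\<Prod>b\<in>B. t b ^ \<beta> b)"
    have z: "(\<Sum>m\<le>N. ?a m * s ^ m) = 0" if "s > 0" for s
    proof -
      have "0 = (\<Sum>\<beta>\<in>D. c \<beta> * (\<Prod>a\<in>insert b B. (t(b := s)) a ^ \<beta> a))"
        by (rule insert.prems(3)[symmetric]) (use t that in auto)
      also have "\<dots> = (\<Sum>\<beta>\<in>D. c \<beta> * (\<Prod>a\<in>B. t a ^ \<beta> a) * s ^ \<beta> b)"
      proof (rule sum.cong, simp)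
        fix \<beta>
        have "(\<Prod>a\<in>B. (t(b := s)) a ^ \<beta> a) = (\<Prod>a\<in>B. t a ^ \<beta> a)"
          using insert.hyps by (intro prod.cong) auto
        then show "c \<beta> * (\<Prod>a\<in>insert b B. (t(b := s)) a ^ \<beta> a) = c \<beta> * (\<Prod>a\<in>B. t a ^ \<beta> a) * s ^ \<beta> b"
          using insert.hyps by simp
      qed
      also have "\<dots> = (\<Sum>m\<le>N. \<Sum>\<beta>\<in>{\<beta> \<in> D. \<beta> b = m}. c \<beta> * (\<Prod>a\<in>B. t a ^ \<beta> a) * s ^ \<beta> b)"
        using N insert.prems(1) by (intro sum.group[symmetric]) auto
      also have "\<dots> = (\<Sum>m\<le>N. ?a m * s ^ m)"
        by (intro sum.cong refl) (auto simp: sum_distrib_right intro!: sum.cong)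
      finally show ?thesis by simp
    qed
    show "?a ?m = 0"
    proof (rule ccontr)
      assume nz: "?a ?m \<noteq> 0"
      have "finite {s. (\<Sum>m\<le>N. ?a m * s ^ m) = 0}"
        using N[OF insert.prems(4)] polyfun_finite_roots[of ?a N] nz by auto
      moreover have "{0<..} \<subseteq> {s. (\<Sum>m\<le>N. ?a m * s ^ m) = 0}" using z by auto
      ultimately have "finite {0::real<..}" by (rule rev_finite_subset)
      then show False by (simp add: infinite_Ioi)
    qed
  qed
qed

text \<open>By homogeneity, vanishing on the unit simplex implies vanishing on the positive orthant.\<close>

lemma hom_monomials_independent:
  fixes c :: "('b \<Rightarrow> nat) \<Rightarrow> real"
  assumes B: "finite B" "B \<noteq> {}"
    and z: "\<And>t. (\<And>b. b \<in> B \<Longrightarrow> t b > 0) \<Longrightarrow> (\<Sum>b\<in>B. t b) = 1 \<Longrightarrow>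
      (\<Sum>\<alpha>\<in>hom_exponents B r. c \<alpha> * (\<Prod>b\<in>B. t b ^ \<alpha> b)) = 0"
    and a: "\<alpha> \<in> hom_exponents B r"
  shows "c \<alpha> = 0"
proof (rule monomials_independent_pos[OF B(1) finite_hom_exponents[OF B(1)] _ _ a])
  show "\<alpha> = \<beta>" if "\<alpha> \<in> hom_exponents B r" "\<beta> \<in> hom_exponents B r" "\<And>b. b \<in> B \<Longrightarrow> \<alpha> b = \<beta> b"
    for \<alpha> \<beta> using that by (intro ext) (metis (mono_tags, lifting) hom_exponents_def mem_Collect_eq)
  fix t :: "'b \<Rightarrow> real" assume t: "\<And>b. t b > 0"
  define s where "s = sum t B"
  have s: "s > 0" unfolding s_def using B t by (intro sum_pos) auto
  have "0 = (\<Sum>\<alpha>\<in>hom_exponents B r. c \<alpha> * (\<Prod>b\<in>B. (t b / s) ^ \<alpha> b))"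
    using s t by (intro z[symmetric]) (auto simp: sum_divide_distrib[symmetric] s_def)
  also have "\<dots> = (\<Sum>\<alpha>\<in>hom_exponents B r. (c \<alpha> * (\<Prod>b\<in>B. t b ^ \<alpha> b)) / s ^ r)"
    by (intro sum.cong refl)
       (auto simp: power_divide prod_dividef power_sum[symmetric] hom_exponents_def)
  finally show "(\<Sum>\<alpha>\<in>hom_exponents B r. c \<alpha> * (\<Prod>b\<in>B. t b ^ \<alpha> b)) = 0"
    using s by (simp add: sum_divide_distrib[symmetric])
qed


section \<open>Alternating forms\<close>

lemma set_list_update_subset: "set xs \<subseteq> A \<Longrightarrow> x \<in> A \<Longrightarrow> set (xs[i := x]) \<subseteq> A"
  using set_update_subset_insert[of xs i x] by blast

lemma alternating_outside: "alternating k V \<phi> \<Longrightarrow> \<not> (length vs = k \<and> set vs \<subseteq> V) \<Longrightarrow> \<phi> vs = 0"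
  unfolding alternating_def by blast

lemma alternating_multilinear:
  "alternating k V \<phi> \<Longrightarrow> length vs = k \<Longrightarrow> set vs \<subseteq> V \<Longrightarrow> i < k \<Longrightarrow> v \<in> V \<Longrightarrow> w \<in> V \<Longrightarrow>
    \<phi> (vs[i := a *\<^sub>R v + b *\<^sub>R w]) = a * \<phi> (vs[i := v]) + b * \<phi> (vs[i := w])"
  unfolding alternating_def by blast

lemma alternating_repeated:
  assumes "alternating k V \<phi>" "i < k" "j < k" "i \<noteq> j" "vs ! i = vs ! j"
  shows "\<phi> vs = 0"
proof (cases "length vs = k \<and> set vs \<subseteq> V")
  case True
  with assms show ?thesis unfolding alternating_def by (metis linorder_neqE_nat)
next
  case False
  with assms show ?thesis by (simp add: alternating_outside)
qed

lemma alternatingI: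
  assumes "\<And>vs. \<not> (length vs = k \<and> set vs \<subseteq> V) \<Longrightarrow> \<phi> vs = 0"
    and "\<And>vs i v w a b. length vs = k \<Longrightarrow> set vs \<subseteq> V \<Longrightarrow> i < k \<Longrightarrow> v \<in> V \<Longrightarrow> w \<in> V \<Longrightarrow>
        \<phi> (vs[i := a *\<^sub>R v + b *\<^sub>R w]) = a * \<phi> (vs[i := v]) + b * \<phi> (vs[i := w])"
    and "\<And>vs i j. length vs = k \<Longrightarrow> set vs \<subseteq> V \<Longrightarrow> i < j \<Longrightarrow> j < k \<Longrightarrow> vs ! i = vs ! j \<Longrightarrow> \<phi> vs = 0"
  shows "alternating k V \<phi>"
  unfolding alternating_def using assms by blast

lemma alternating_zero: "alternating k V (\<lambda>vs. 0)"
  by (simp add: alternating_def)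

lemma alternating_lincomb:
  assumes "alternating k V \<phi>" "alternating k V \<psi>"
  shows "alternating k V (\<lambda>vs. a * \<phi> vs + b * \<psi> vs)"
proof (rule alternatingI)
  show "a * \<phi> vs + b * \<psi> vs = 0" if "\<not> (length vs = k \<and> set vs \<subseteq> V)" for vs
    using that assms by (simp add: alternating_outside)
  show "a * \<phi> vs + b * \<psi> vs = 0" if "i < j" "j < k" "vs ! i = vs ! j" for vs i j
    using that alternating_repeated[OF assms(1), of i j vs] alternating_repeated[OF assms(2), of i j vs] by simp
qed (simp add: alternating_multilinear[OF assms(1)] alternating_multilinear[OF assms(2)] algebra_simps)

lemma alternating_scale: "alternating k V \<phi> \<Longrightarrow> alternating k V (\<lambda>vs. a * \<phi> vs)"
  using alternating_lincomb[of k V \<phi> \<phi> a 0] by simp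

lemma alternating_sum:
  "(\<And>i. i \<in> J \<Longrightarrow> alternating k V (\<phi> i)) \<Longrightarrow> alternating k V (\<lambda>vs. \<Sum>i\<in>J. \<phi> i vs)"
proof (induction J rule: infinite_finite_induct)
  case (insert i J)
  then show ?case using alternating_lincomb[of k V "\<phi> i" "\<lambda>vs. \<Sum>i\<in>J. \<phi> i vs" 1 1] by simp
qed (auto simp: alternating_zero)

text \<open>Linearity of L is assumed on W only, because \<open>psi_map\<close> is linear on tangent
  vectors only; the guard restores the convention that forms are 0 on other lists.\<close>

lemma alternating_pullback:
  assumes \<phi>: "alternating k V \<phi>" and W: "subspace W"
    and L: "\<And>v. v \<in> W \<Longrightarrow> L v \<in> V"
    and lin: "\<And>a b v w. v \<in> W \<Longrightarrow> w \<in> W \<Longrightarrow> L (a *\<^sub>R v + b *\<^sub>R w) = a *\<^sub>R L v + b *\<^sub>R L w"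
  shows "alternating k W (\<lambda>vs. if length vs = k \<and> set vs \<subseteq> W then \<phi> (map L vs) else 0)"
proof (rule alternatingI, goal_cases)
  case (2 vs i v w a b)
  have "a *\<^sub>R v + b *\<^sub>R w \<in> W" using 2 W by (simp add: subspace_add subspace_scale)
  then have in_W: "set (vs[i := a *\<^sub>R v + b *\<^sub>R w]) \<subseteq> W" "set (vs[i := v]) \<subseteq> W" "set (vs[i := w]) \<subseteq> W"
    using 2 by (simp_all add: set_list_update_subset)
  have "\<phi> ((map L vs)[i := a *\<^sub>R L v + b *\<^sub>R L w])
      = a * \<phi> ((map L vs)[i := L v]) + b * \<phi> ((map L vs)[i := L w])"
    using 2 L by (intro alternating_multilinear[OF \<phi>]) auto
  then show ?case using in_W 2 by (simp add: map_update lin)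
next
  case (3 vs i j)
  then have "\<phi> (map L vs) = 0" by (intro alternating_repeated[OF \<phi>, of i j]) auto
  then show ?case by simp
qed auto

lemma alternating_restrict:
  assumes \<phi>: "alternating k V \<phi>" and W: "subspace W" "W \<subseteq> V"
  shows "alternating k W (\<lambda>vs. if set vs \<subseteq> W then \<phi> vs else 0)"
proof -
  have "(\<lambda>vs. if length vs = k \<and> set vs \<subseteq> W then \<phi> (map (\<lambda>v. v) vs) else 0)
      = (\<lambda>vs. if set vs \<subseteq> W then \<phi> vs else 0)"
    using alternating_outside[OF \<phi>] by auto
  with alternating_pullback[OF \<phi> W(1), of "\<lambda>v. v"] W(2) show ?thesis by auto
qed

section \<open>Behaviour of alternating functions under permutation of the arguments\<close>

lemma permute_list_transpose:
  assumes "length vs = k" "i < k" "j < k"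
  shows "permute_list (Transposition.transpose i j) vs = vs[i := vs ! j, j := vs ! i]"
  using assms permutes_swap_id[of i "{..<length vs}" j]
  by (intro nth_equalityI) (auto simp: permute_list_nth nth_list_update Transposition.transpose_def)

text \<open>Polarization: \<phi> vanishes with v + w in both slots, and expanding leaves only the
  two mixed terms, since the terms with equal entries vanish too.\<close>

lemma alternating_swap:
  assumes \<phi>: "alternating k V \<phi>" and V: "subspace V"
    and vs: "length vs = k" "set vs \<subseteq> V" and ij: "i < k" "j < k" "i \<noteq> j"
  shows "\<phi> (vs[i := vs ! j, j := vs ! i]) = - \<phi> vs"
proof -
  let ?v = "vs ! i" and ?w = "vs ! j"
  have v: "?v \<in> V" "?w \<in> V" using vs ij by (auto dest: nth_mem)
  have add: "\<phi> (us[m := x + y]) = \<phi> (us[m := x]) + \<phi> (us[m := y])"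
    if "length us = k" "set us \<subseteq> V" "m < k" "x \<in> V" "y \<in> V" for us m x y
    using alternating_multilinear[OF \<phi> that, of 1 1] by simp
  have rep: "\<phi> (vs[i := x, j := x]) = 0" for x
    using vs ij by (intro alternating_repeated[OF \<phi>, of i j]) auto
  have vw: "?v + ?w \<in> V" using v V by (simp add: subspace_add)
  have "0 = \<phi> (vs[i := ?v + ?w, j := ?v + ?w])" by (simp add: rep)
  also have "\<dots> = \<phi> (vs[i := ?v + ?w, j := ?v]) + \<phi> (vs[i := ?v + ?w, j := ?w])"
    using vs ij v vw by (intro add) (simp_all add: set_list_update_subset)
  also have "\<phi> (vs[i := ?v + ?w, j := ?v]) = \<phi> (vs[j := ?v, i := ?v + ?w])"
    using ij by (simp add: list_update_swap)
  also have "\<dots> = \<phi> (vs[j := ?v, i := ?v]) + \<phi> (vs[j := ?v, i := ?w])"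
    using vs ij v vw by (intro add) (simp_all add: set_list_update_subset)
  also have "\<phi> (vs[j := ?v, i := ?v]) = 0"
    by (metis ij(3) list_update_swap rep)
  also have "\<phi> (vs[i := ?v + ?w, j := ?w]) = \<phi> (vs[j := ?w, i := ?v + ?w])"
    using ij by (simp add: list_update_swap)
  also have "\<dots> = \<phi> (vs[j := ?w, i := ?v]) + \<phi> (vs[j := ?w, i := ?w])"
    using vs ij v vw by (intro add) (simp_all add: set_list_update_subset)
  also have "\<phi> (vs[j := ?w, i := ?w]) = 0"
    by (metis ij(3) list_update_swap rep)
  finally show ?thesis using ij by (simp add: list_update_swap)
qed

lemma alternating_permute:
  assumes \<phi>: "alternating k V \<phi>" and V: "subspace V"
    and vs: "length vs = k" "set vs \<subseteq> V" and \<pi>: "\<pi> permutes {..<k}"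
  shows "\<phi> (permute_list \<pi> vs) = of_int (sign \<pi>) * \<phi> vs"
  using finite_lessThan \<pi>
proof (induction rule: permutes_rev_induct)
  case id
  then show ?case by (simp add: sign_id)
next
  case (swap i j p)
  let ?t = "Transposition.transpose i j"
  have t: "?t permutes {..<k}" using swap by (intro permutes_swap_id) auto
  have "\<phi> (permute_list (p \<circ> ?t) vs) = \<phi> (permute_list ?t (permute_list p vs))"
    using t vs by (simp add: permute_list_compose)
  also have "\<dots> = - \<phi> (permute_list p vs)"
    using swap vs alternating_swap[OF \<phi> V, of "permute_list p vs" i j]
    by (subst permute_list_transpose[where k = k]) auto
  also have "\<dots> = of_int (sign (p \<circ> ?t)) * \<phi> vs"
    using swap t by (auto simp: sign_compose permutes_imp_permutation[of "{..<k}"] sign_swap_id)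
  finally show ?case .
qed

section \<open>Multilinear expansion in a spanning family\<close>

lemma alternating_list_update_sum:
  assumes \<phi>: "alternating k V \<phi>" and V: "subspace V"
    and vs: "length vs = k" "set vs \<subseteq> V" "i < k" and J: "\<And>j. j \<in> J \<Longrightarrow> e j \<in> V"
  shows "\<phi> (vs[i := \<Sum>j\<in>J. c j *\<^sub>R e j]) = (\<Sum>j\<in>J. c j * \<phi> (vs[i := e j]))"
  using J
proof (induction J rule: infinite_finite_induct)
  case (insert j J)
  have "(\<Sum>j\<in>J. c j *\<^sub>R e j) \<in> V" using insert V by (intro subspace_sum subspace_scale) auto
  then show ?case
    using alternating_multilinear[OF \<phi> vs, of "e j" "\<Sum>j\<in>J. c j *\<^sub>R e j" "c j" 1] insert by simp
next
  case empty
  show ?case using alternating_multilinear[OF \<phi> vs, of 0 0 0 0] V by (simp add: subspace_0)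
next
  case (infinite J)
  show ?case using alternating_multilinear[OF \<phi> vs, of 0 0 0 0] V infinite by (simp add: subspace_0)
qed

text \<open>An index map on j + 1 slots is one on j slots together with its value at slot j; this
  drives the slot by slot expansion below.\<close>

lemma sum_PiE_lessThan_Suc:
  "(\<Sum>\<tau> \<in> {..<Suc j} \<rightarrow>\<^sub>E I. F \<tau>) = (\<Sum>\<tau> \<in> {..<j} \<rightarrow>\<^sub>E I. \<Sum>i\<in>I. F (\<tau>(j := i)))"
proof -
  have "inj_on (\<lambda>(i, \<tau>). \<tau>(j := i)) (I \<times> ({..<j} \<rightarrow>\<^sub>E I))"
    by (rule inj_combinator) simp
  then have "(\<Sum>\<tau> \<in> {..<Suc j} \<rightarrow>\<^sub>E I. F \<tau>) = (\<Sum>(i, \<tau>) \<in> I \<times> ({..<j} \<rightarrow>\<^sub>E I). F (\<tau>(j := i)))"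
    by (simp only: lessThan_Suc PiE_insert_eq sum.reindex) (simp add: o_def case_prod_unfold)
  also have "\<dots> = (\<Sum>i\<in>I. \<Sum>\<tau> \<in> {..<j} \<rightarrow>\<^sub>E I. F (\<tau>(j := i)))"
    by (rule sum.cartesian_product[symmetric])
  also have "\<dots> = (\<Sum>\<tau> \<in> {..<j} \<rightarrow>\<^sub>E I. \<Sum>i\<in>I. F (\<tau>(j := i)))"
    by (rule sum.swap)
  finally show ?thesis .
qed

lemma alternating_expand:
  assumes \<phi>: "alternating k V \<phi>" and V: "subspace V" and I: "finite I"
    and e: "\<And>i. i \<in> I \<Longrightarrow> e i \<in> V" and vs: "length vs = k" "set vs \<subseteq> V"
    and a: "\<And>m. m < k \<Longrightarrow> vs ! m = (\<Sum>i\<in>I. a m i *\<^sub>R e i)"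
  shows "\<phi> vs = (\<Sum>\<tau> \<in> {..<k} \<rightarrow>\<^sub>E I. (\<Prod>m<k. a m (\<tau> m)) * \<phi> (map (\<lambda>m. e (\<tau> m)) [0..<k]))"
proof -
  \<comment> \<open>In \<open>?l \<tau> j\<close> the first j slots already hold vectors e and the
    others are untouched; the induction on j replaces one slot at a time.\<close>
  let ?l = "\<lambda>\<tau> j. map (\<lambda>m. if m < j then e (\<tau> m) else vs ! m) [0..<k]"
  have "\<phi> vs = (\<Sum>\<tau> \<in> {..<j} \<rightarrow>\<^sub>E I. (\<Prod>m<j. a m (\<tau> m)) * \<phi> (?l \<tau> j))" if "j \<le> k" for j
    using that
  proof (induction j)
    case 0
    have "map ((!) vs) [0..<k] = vs" using vs(1) map_nth by blast
    then show ?case by simp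
  next
    case (Suc j)
    have step: "\<phi> (?l \<tau> j) = (\<Sum>i\<in>I. a j i * \<phi> (?l (\<tau>(j := i)) (Suc j)))"
      if \<tau>: "\<tau> \<in> {..<j} \<rightarrow>\<^sub>E I" for \<tau>
    proof -
      have l: "?l \<tau> j = (?l \<tau> j)[j := \<Sum>i\<in>I. a j i *\<^sub>R e i]"
        using Suc.prems a by (intro nth_equalityI) (auto simp: nth_list_update)
      have "set (?l \<tau> j) \<subseteq> V" using \<tau> e vs by (fastforce simp: PiE_iff)
      then have "\<phi> (?l \<tau> j) = (\<Sum>i\<in>I. a j i * \<phi> ((?l \<tau> j)[j := e i]))"
        using e Suc.prems by (subst l, intro alternating_list_update_sum[OF \<phi> V]) auto
      also have "\<dots> = (\<Sum>i\<in>I. a j i * \<phi> (?l (\<tau>(j := i)) (Suc j)))"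
        using Suc.prems
        by (intro sum.cong refl arg_cong2[where f = "(*)"] arg_cong[where f = \<phi>] nth_equalityI)
           (auto simp: nth_list_update less_Suc_eq)
      finally show ?thesis .
    qed
    have "\<phi> vs = (\<Sum>\<tau> \<in> {..<j} \<rightarrow>\<^sub>E I. \<Sum>i\<in>I. (\<Prod>m<j. a m (\<tau> m)) * (a j i * \<phi> (?l (\<tau>(j := i)) (Suc j))))"
      using Suc step by (simp add: sum_distrib_left)
    also have "\<dots> = (\<Sum>\<tau> \<in> {..<j} \<rightarrow>\<^sub>E I. \<Sum>i\<in>I.
        (\<Prod>m<Suc j. a m ((\<tau>(j := i)) m)) * \<phi> (?l (\<tau>(j := i)) (Suc j)))"
    proof (intro sum.cong refl)
      fix \<tau> i
      have "(\<Prod>m<j. a m ((\<tau>(j := i)) m)) = (\<Prod>m<j. a m (\<tau> m))" by (intro prod.cong) auto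
      then show "(\<Prod>m<j. a m (\<tau> m)) * (a j i * \<phi> (?l (\<tau>(j := i)) (Suc j)))
          = (\<Prod>m<Suc j. a m ((\<tau>(j := i)) m)) * \<phi> (?l (\<tau>(j := i)) (Suc j))"
        by (simp only: prod.lessThan_Suc mult.assoc fun_upd_same)
    qed
    finally show ?case by (simp only: sum_PiE_lessThan_Suc)
  qed
  from this[of k]
  have "\<phi> vs = (\<Sum>\<tau> \<in> {..<k} \<rightarrow>\<^sub>E I. (\<Prod>m<k. a m (\<tau> m)) * \<phi> (?l \<tau> k))" by simp
  moreover have "?l \<tau> k = map (\<lambda>m. e (\<tau> m)) [0..<k]" for \<tau> by simp
  ultimately show ?thesis by (simp only:)
qed

subsection \<open>Wedge products\<close>

lemma sum_permutes_compose_left: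
  assumes "\<pi> permutes S"
  shows "(\<Sum>\<rho> | \<rho> permutes S. f \<rho>) = (\<Sum>\<rho> | \<rho> permutes S. f (\<pi> \<circ> \<rho>))"
  by (rule sum.reindex_bij_witness[of _ "\<lambda>\<rho>. \<pi> \<circ> \<rho>" "\<lambda>\<rho>. inv \<pi> \<circ> \<rho>"])
     (use assms in \<open>auto simp: permutes_inv permutes_compose o_assoc permutes_inv_o\<close>)

text \<open>In the sum over permutations, permuting the vectors is a reindexing by composition on
  the left; permuting the functionals, in the next lemma, is one on the right. Either way the sign
  factors out.\<close>

lemma wedge_permute_vectors:
  assumes \<pi>: "\<pi> permutes {..<k}" and vs: "length vs = k"
  shows "wedge k \<theta> (permute_list \<pi> vs) = of_int (sign \<pi>) * wedge k \<theta> vs"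
proof -
  have "wedge k \<theta> vs = (\<Sum>\<rho> | \<rho> permutes {..<k}. of_int (sign (\<pi> \<circ> \<rho>)) * (\<Prod>m<k. \<theta> m (vs ! (\<pi> \<circ> \<rho>) m)))"
    unfolding wedge_def using vs
    sum_permutes_compose_left[OF \<pi>, of "\<lambda>\<rho>. of_int (sign \<rho>) * (\<Prod>m<k. \<theta> m (vs ! \<rho> m))"] by simp
  also have "\<dots> = (\<Sum>\<rho> | \<rho> permutes {..<k}. of_int (sign \<pi>) * (of_int (sign \<rho>) * (\<Prod>m<k. \<theta> m (permute_list \<pi> vs ! \<rho> m))))"
  proof (intro sum.cong refl)
    fix \<rho> assume "\<rho> \<in> {\<rho>. \<rho> permutes {..<k}}"
    then have \<rho>: "\<rho> permutes {..<k}" by simp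
    have "permute_list \<pi> vs ! \<rho> m = vs ! (\<pi> (\<rho> m))" if "m < k" for m
      using that vs \<pi> permutes_in_image[OF \<rho>, of m] by (simp add: permute_list_nth)
    then show "of_int (sign (\<pi> \<circ> \<rho>)) * (\<Prod>m<k. \<theta> m (vs ! (\<pi> \<circ> \<rho>) m))
        = of_int (sign \<pi>) * (of_int (sign \<rho>) * (\<Prod>m<k. \<theta> m (permute_list \<pi> vs ! \<rho> m)))"
      using \<pi> \<rho> by (simp add: sign_compose permutes_imp_permutation[of "{..<k}"])
  qed
  also have "\<dots> = of_int (sign \<pi>) * wedge k \<theta> (permute_list \<pi> vs)"
    unfolding wedge_def using vs by (simp add: sum_distrib_left)
  finally have "wedge k \<theta> vs = of_int (sign \<pi>) * wedge k \<theta> (permute_list \<pi> vs)" .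
  then show ?thesis by (simp add: sign_def)
qed

lemma wedge_permute_functionals:
  assumes \<pi>: "\<pi> permutes {..<k}"
  shows "wedge k (\<lambda>m. \<theta> (\<pi> m)) vs = of_int (sign \<pi>) * wedge k \<theta> vs"
proof (cases "length vs = k")
  case True
  have "wedge k (\<lambda>m. \<theta> (\<pi> m)) vs
      = (\<Sum>\<rho> | \<rho> permutes {..<k}. of_int (sign (\<rho> \<circ> \<pi>)) * (\<Prod>m<k. \<theta> (\<pi> m) (vs ! (\<rho> \<circ> \<pi>) m)))"
    unfolding wedge_def using True
    sum_permutations_compose_right[OF \<pi>, of "\<lambda>\<rho>. of_int (sign \<rho>) * (\<Prod>m<k. \<theta> (\<pi> m) (vs ! \<rho> m))"] by simp
  also have "\<dots> = (\<Sum>\<rho> | \<rho> permutes {..<k}. of_int (sign \<pi>) * (of_int (sign \<rho>) * (\<Prod>m<k. \<theta> m (vs ! \<rho> m))))"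
  proof (intro sum.cong refl)
    fix \<rho> assume "\<rho> \<in> {\<rho>. \<rho> permutes {..<k}}"
    then have \<rho>: "\<rho> permutes {..<k}" by simp
    have "(\<Prod>m<k. \<theta> (\<pi> m) (vs ! \<rho> (\<pi> m))) = (\<Prod>m<k. \<theta> m (vs ! \<rho> m))"
      using prod.permute[OF \<pi>, of "\<lambda>m. \<theta> m (vs ! \<rho> m)"] by (simp add: o_def)
    then show "of_int (sign (\<rho> \<circ> \<pi>)) * (\<Prod>m<k. \<theta> (\<pi> m) (vs ! (\<rho> \<circ> \<pi>) m))
        = of_int (sign \<pi>) * (of_int (sign \<rho>) * (\<Prod>m<k. \<theta> m (vs ! \<rho> m)))"
      using \<pi> \<rho> by (simp add: sign_compose permutes_imp_permutation[of "{..<k}"])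
  qed
  finally show ?thesis unfolding wedge_def using True by (simp add: sum_distrib_left)
qed (simp add: wedge_def)

lemma wedge_cong:
  assumes "\<And>m v. m < k \<Longrightarrow> v \<in> set vs \<Longrightarrow> \<theta> m v = \<theta>' m v"
  shows "wedge k \<theta> vs = wedge k \<theta>' vs"
proof -
  have "\<theta> m (vs ! \<pi> m) = \<theta>' m (vs ! \<pi> m)" if "length vs = k" "\<pi> permutes {..<k}" "m < k" for \<pi> m
    using that permutes_in_image[of \<pi> "{..<k}" m] by (intro assms) auto
  then show ?thesis unfolding wedge_def by (auto intro!: sum.cong prod.cong)
qed

text \<open>Exchanging the two equal functionals changes the sign and nothing else.\<close>

lemma wedge_repeated_functional:
  assumes "i < k" "j < k" "i \<noteq> j" "\<theta> i = \<theta> j"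
  shows "wedge k \<theta> vs = 0"
proof -
  have "(\<lambda>m. \<theta> (Transposition.transpose i j m)) = \<theta>" using assms by (auto simp: Transposition.transpose_def)
  with wedge_permute_functionals[of "Transposition.transpose i j" k \<theta> vs] assms show ?thesis
    by (simp add: permutes_swap_id sign_swap_id)
qed

lemma wedge_map: "wedge k \<theta> (map L vs) = wedge k (\<lambda>m v. \<theta> m (L v)) vs"
proof -
  have "\<theta> m (map L vs ! \<pi> m) = \<theta> m (L (vs ! \<pi> m))" if "length vs = k" "\<pi> permutes {..<k}" "m < k" for \<pi> m
    using that permutes_in_image[of \<pi> "{..<k}" m] by simp
  then show ?thesis unfolding wedge_def by (auto intro!: sum.cong prod.cong)
qed

lemma alternating_wedge:
  assumes V: "subspace V"
    and lin: "\<And>m a b v w. m < k \<Longrightarrow> v \<in> V \<Longrightarrow> w \<in> V \<Longrightarrow>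
      \<theta> m (a *\<^sub>R v + b *\<^sub>R w) = a * \<theta> m v + b * \<theta> m w"
  shows "alternating k V (\<lambda>vs. if set vs \<subseteq> V then wedge k \<theta> vs else 0)"
proof (rule alternatingI, goal_cases)
  case (1 vs)
  then show ?case by (auto simp: wedge_def)
next
  case (2 vs i v w a b)
  have "a *\<^sub>R v + b *\<^sub>R w \<in> V" using 2 V by (simp add: subspace_add subspace_scale)
  then have in_V: "set (vs[i := a *\<^sub>R v + b *\<^sub>R w]) \<subseteq> V" "set (vs[i := v]) \<subseteq> V" "set (vs[i := w]) \<subseteq> V"
    using 2 by (simp_all add: set_list_update_subset)
  \<comment> \<open>Under \<pi> the slot i is seen only by the functional with number
    \<open>inv \<pi> i\<close>, so the new entry x enters the product through a single
    factor.\<close>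
  have pr: "(\<Prod>m<k. \<theta> m (vs[i := x] ! \<pi> m))
      = \<theta> (inv \<pi> i) x * (\<Prod>m\<in>{..<k} - {inv \<pi> i}. \<theta> m (vs ! \<pi> m))"
    if \<pi>: "\<pi> permutes {..<k}" for \<pi> x
  proof -
    have m0: "inv \<pi> i \<in> {..<k}" using 2 permutes_in_image[OF permutes_inv[OF \<pi>]] by auto
    have "(\<Prod>m\<in>{..<k} - {inv \<pi> i}. \<theta> m (vs[i := x] ! \<pi> m)) = (\<Prod>m\<in>{..<k} - {inv \<pi> i}. \<theta> m (vs ! \<pi> m))"
      using permutes_inverses[OF \<pi>] by (intro prod.cong refl) (metis DiffE insertI1 nth_list_update_neq)
    with m0 show ?thesis using 2 permutes_inverses[OF \<pi>]
      by (subst prod.remove[of _ "inv \<pi> i"]) auto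
  qed
  have "wedge k \<theta> (vs[i := a *\<^sub>R v + b *\<^sub>R w]) = a * wedge k \<theta> (vs[i := v]) + b * wedge k \<theta> (vs[i := w])"
  proof -
    have "\<theta> (inv \<pi> i) (a *\<^sub>R v + b *\<^sub>R w) = a * \<theta> (inv \<pi> i) v + b * \<theta> (inv \<pi> i) w"
      if \<pi>: "\<pi> permutes {..<k}" for \<pi>
      using 2 permutes_in_image[OF permutes_inv[OF \<pi>], of i] by (intro lin) auto
    then have "of_int (sign \<pi>) * (\<Prod>m<k. \<theta> m (vs[i := a *\<^sub>R v + b *\<^sub>R w] ! \<pi> m))
        = a * (of_int (sign \<pi>) * (\<Prod>m<k. \<theta> m (vs[i := v] ! \<pi> m)))
          + b * (of_int (sign \<pi>) * (\<Prod>m<k. \<theta> m (vs[i := w] ! \<pi> m)))"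
      if "\<pi> permutes {..<k}" for \<pi>
      using that by (simp add: pr algebra_simps)
    then show ?thesis unfolding wedge_def using 2
      by (simp add: sum_distrib_left sum.distrib[symmetric])
  qed
  then show ?case using in_V by simp
next
  case (3 vs i j)
  \<comment> \<open>Exchanging two equal entries returns the same list, so the value equals its own
    negative.\<close>
  have "permute_list (Transposition.transpose i j) vs = vs"
    using 3 permute_list_transpose[of vs k i j] list_update_id[of vs i] list_update_id[of vs j] by simp
  with wedge_permute_vectors[of "Transposition.transpose i j" k vs \<theta>] 3 show ?case
    by (simp add: permutes_swap_id sign_swap_id)
qed

text \<open>The coefficients are those of the expansion in all, not only the increasing, index maps;
  each increasing index set occurs \<open>k!\<close> times.\<close>

lemma alternating_eq_sum_wedge:
  assumes \<phi>: "alternating k V \<phi>" and V: "subspace V" and I: "finite I"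
    and e: "\<And>i. i \<in> I \<Longrightarrow> e i \<in> V" and vs: "length vs = k" "set vs \<subseteq> V"
    and a: "\<And>v. v \<in> V \<Longrightarrow> v = (\<Sum>i\<in>I. a i v *\<^sub>R e i)"
  shows "\<phi> vs = (\<Sum>\<tau> \<in> {..<k} \<rightarrow>\<^sub>E I.
    \<phi> (map (\<lambda>m. e (\<tau> m)) [0..<k]) / fact k * wedge k (\<lambda>m. a (\<tau> m)) vs)"
proof -
  let ?e = "\<lambda>\<tau>. \<phi> (map (\<lambda>m. e (\<tau> m)) [0..<k])"
  have "(\<Sum>\<tau> \<in> {..<k} \<rightarrow>\<^sub>E I. ?e \<tau> * wedge k (\<lambda>m. a (\<tau> m)) vs)
     = (\<Sum>\<tau> \<in> {..<k} \<rightarrow>\<^sub>E I. \<Sum>\<pi> | \<pi> permutes {..<k}. of_int (sign \<pi>) * ((\<Prod>m<k. a (\<tau> m) (vs ! \<pi> m)) * ?e \<tau>))"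
    unfolding wedge_def using vs by (simp add: sum_distrib_left mult_ac)
  also have "\<dots> = (\<Sum>\<pi> | \<pi> permutes {..<k}. of_int (sign \<pi>) * (\<Sum>\<tau> \<in> {..<k} \<rightarrow>\<^sub>E I. (\<Prod>m<k. a (\<tau> m) (vs ! \<pi> m)) * ?e \<tau>))"
    by (subst sum.swap) (simp add: sum_distrib_left)
  also have "\<dots> = (\<Sum>\<pi> | \<pi> permutes {..<k}. \<phi> vs)"
  proof (intro sum.cong refl)
    fix \<pi> assume "\<pi> \<in> {\<pi>. \<pi> permutes {..<k}}"
    then have \<pi>: "\<pi> permutes {..<k}" by simp
    have in_V: "vs ! \<pi> m \<in> V" if "m < k" for m
      using that vs permutes_in_image[OF \<pi>, of m] by (auto dest: nth_mem)
    \<comment> \<open>For fixed \<pi> the inner sum is the full expansion of \<phi> at the permuted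
      list. Its sign cancels the one in the wedge product, so each of the k! permutations
      contributes \<open>\<phi> vs\<close>.\<close>
    have "\<phi> (permute_list \<pi> vs) = (\<Sum>\<tau> \<in> {..<k} \<rightarrow>\<^sub>E I. (\<Prod>m<k. a (\<tau> m) (vs ! \<pi> m)) * ?e \<tau>)"
      using vs \<pi> in_V by (intro alternating_expand[OF \<phi> V I e]) (auto simp: permute_list_nth a[symmetric])
    with alternating_permute[OF \<phi> V vs \<pi>]
    have "(\<Sum>\<tau> \<in> {..<k} \<rightarrow>\<^sub>E I. (\<Prod>m<k. a (\<tau> m) (vs ! \<pi> m)) * ?e \<tau>) = of_int (sign \<pi>) * \<phi> vs"
      by simp
    then show "of_int (sign \<pi>) * (\<Sum>\<tau> \<in> {..<k} \<rightarrow>\<^sub>E I. (\<Prod>m<k. a (\<tau> m) (vs ! \<pi> m)) * ?e \<tau>) = \<phi> vs"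
      by (simp add: sign_def)
  qed
  also have "\<dots> = fact k * \<phi> vs" by (simp add: card_permutations[of _ k])
  finally show ?thesis by (simp add: sum_divide_distrib[symmetric])
qed

text \<open>Pigeonhole: an index map from k slots into fewer than k indices repeats a value, so
  every coefficient of the expansion vanishes.\<close>

lemma alternating_eq_zero:
  assumes \<phi>: "alternating k V \<phi>" and V: "subspace V" and I: "finite I" "card I < k"
    and e: "\<And>i. i \<in> I \<Longrightarrow> e i \<in> V" and a: "\<And>v. v \<in> V \<Longrightarrow> v = (\<Sum>i\<in>I. a i v *\<^sub>R e i)"
  shows "\<phi> = (\<lambda>vs. 0)"
proof
  fix vs
  show "\<phi> vs = 0"
  proof (cases "length vs = k \<and> set vs \<subseteq> V")
    case True
    have "\<phi> (map (\<lambda>m. e (\<tau> m)) [0..<k]) = 0" if \<tau>: "\<tau> \<in> {..<k} \<rightarrow>\<^sub>E I" for \<tau>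
    proof -
      have "\<tau> ` {..<k} \<subseteq> I" using \<tau> by auto
      then have "\<not> inj_on \<tau> {..<k}"
        using card_inj_on_le[of \<tau> "{..<k}" I] I by auto
      then obtain i j where "i < k" "j < k" "i \<noteq> j" "\<tau> i = \<tau> j" by (auto simp: inj_on_def)
      then show ?thesis by (intro alternating_repeated[OF \<phi>, of i j]) auto
    qed
    with alternating_eq_sum_wedge[OF \<phi> V I(1) e _ _ a] True show ?thesis by simp
  qed (simp add: alternating_outside[OF \<phi>])
qed

text \<open>Links the arbitrary index maps that arise from multilinear expansion with the increasing
  ones for which the extension operator is prescribed: \<sigma> lists the image in increasing order
  and \<pi> is \<tau> followed by the inverse of \<sigma>.\<close>

lemma inj_on_lessThan_sort:
  fixes \<tau> :: "nat \<Rightarrow> nat"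
  assumes "inj_on \<tau> {..<k}"
  obtains \<sigma> \<pi> where "strict_mono_on {..<k} \<sigma>" "\<pi> permutes {..<k}" "\<And>m. m < k \<Longrightarrow> \<tau> m = \<sigma> (\<pi> m)"
    "\<sigma> ` {..<k} = \<tau> ` {..<k}"
proof -
  let ?A = "\<tau> ` {..<k}"
  have card: "card ?A = k" using assms by (simp add: card_image)
  define \<sigma> where "\<sigma> m = sorted_list_of_set ?A ! m" for m
  have mono: "strict_mono_on {..<k} \<sigma>"
    unfolding \<sigma>_def strict_mono_on_def using card
    by (auto intro!: sorted_wrt_nth_less[OF strict_sorted_list_of_set])
  have img: "\<sigma> ` {..<k} = ?A"
  proof -
    have "\<sigma> ` {..<k} = set (sorted_list_of_set ?A)"
      unfolding \<sigma>_def set_conv_nth using card by auto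
    then show ?thesis by simp
  qed
  have bs: "bij_betw \<sigma> {..<k} ?A"
    using mono img by (auto simp: bij_betw_def intro: strict_mono_on_imp_inj_on)
  have bt: "bij_betw \<tau> {..<k} ?A" using assms by (simp add: bij_betw_def)
  define \<pi> where "\<pi> m = (if m < k then inv_into {..<k} \<sigma> (\<tau> m) else m)" for m
  have "bij_betw (inv_into {..<k} \<sigma> \<circ> \<tau>) {..<k} {..<k}"
    using bij_betw_trans[OF bt bij_betw_inv_into[OF bs]] .
  then have "bij_betw \<pi> {..<k} {..<k}"
    by (rule bij_betw_cong[THEN iffD1, rotated]) (simp add: \<pi>_def)
  then have "\<pi> permutes {..<k}" by (rule bij_imp_permutes) (simp add: \<pi>_def)
  moreover have "\<tau> m = \<sigma> (\<pi> m)" if "m < k" for m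
    using that img by (auto simp: \<pi>_def f_inv_into_f)
  ultimately show ?thesis using that mono img by blast
qed


section \<open>Barycentric coordinates\<close>

text \<open>The list may contain further points, so that all faces of a triangulation share one
  numbering.\<close>

definition numbered_simplex :: "'a::euclidean_space list \<Rightarrow> 'a set \<Rightarrow> bool" where
  "numbered_simplex xs f \<longleftrightarrow> distinct xs \<and> (\<exists>n. n simplex f) \<and> f \<noteq> {} \<and> {v. v extreme_point_of f} \<subseteq> set xs"

lemma finite_vertex_indices [simp]: "finite (vertex_indices xs f)"
  unfolding vertex_indices_def by (rule finite_subset[of _ "{..<length xs}"]) auto

lemma inj_on_nth_vertex_indices: "distinct xs \<Longrightarrow> inj_on ((!) xs) (vertex_indices xs f)"
  by (auto simp: inj_on_def vertex_indices_def nth_eq_iff_index_eq)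

lemma numbered_simplex_vertices:
  assumes "numbered_simplex xs f"
  shows "\<not> affine_dependent ((!) xs ` vertex_indices xs f)"
    and "f = convex hull ((!) xs ` vertex_indices xs f)"
    and "inj_on ((!) xs) (vertex_indices xs f)" and "vertex_indices xs f \<noteq> {}"
proof -
  from assms obtain n C where C: "\<not> affine_dependent C" "f = convex hull C"
    by (auto simp: numbered_simplex_def simplex_def)
  have ext: "{v. v extreme_point_of f} = C"
    using C by (auto simp: extreme_point_of_convex_hull_affine_independent)
  have "(!) xs ` vertex_indices xs f = {v. v extreme_point_of f}"
    using assms unfolding numbered_simplex_def vertex_indices_def
    by (auto simp: in_set_conv_nth image_iff) (metis mem_Collect_eq nth_mem subsetD in_set_conv_nth)
  with ext have im: "(!) xs ` vertex_indices xs f = C" by simp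
  show "\<not> affine_dependent ((!) xs ` vertex_indices xs f)"
    and "f = convex hull ((!) xs ` vertex_indices xs f)" using C im by simp_all
  show "inj_on ((!) xs) (vertex_indices xs f)"
    using assms by (intro inj_on_nth_vertex_indices) (simp add: numbered_simplex_def)
  show "vertex_indices xs f \<noteq> {}" using im C assms by (auto simp: numbered_simplex_def)
qed

lemma numbered_simplex_affine_hull:
  assumes "numbered_simplex xs f"
  shows "affine hull f = {\<Sum>i\<in>vertex_indices xs f. u i *\<^sub>R xs ! i | u. sum u (vertex_indices xs f) = 1}"
proof -
  let ?I = "vertex_indices xs f"
  note v = numbered_simplex_vertices[OF assms]
  have "affine hull f = affine hull ((!) xs ` ?I)"
    using v(2) affine_hull_convex_hull by metis
  also have "\<dots> = {y. \<exists>u. sum u ((!) xs ` ?I) = 1 \<and> (\<Sum>v\<in>(!) xs ` ?I. u v *\<^sub>R v) = y}"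
    by (simp add: affine_hull_finite)
  also have "\<dots> = {\<Sum>i\<in>?I. u i *\<^sub>R xs ! i | u. sum u ?I = 1}"
  proof (intro set_eqI iffI)
    fix y assume "y \<in> {y. \<exists>u. sum u ((!) xs ` ?I) = 1 \<and> (\<Sum>v\<in>(!) xs ` ?I. u v *\<^sub>R v) = y}"
    then obtain u where "sum u ((!) xs ` ?I) = 1" "(\<Sum>v\<in>(!) xs ` ?I. u v *\<^sub>R v) = y" by blast
    then show "y \<in> {\<Sum>i\<in>?I. u i *\<^sub>R xs ! i | u. sum u ?I = 1}"
      using v(3) by (auto simp: sum.reindex intro!: exI[of _ "\<lambda>i. u (xs ! i)"])
  next
    fix y assume "y \<in> {\<Sum>i\<in>?I. u i *\<^sub>R xs ! i | u. sum u ?I = 1}"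
    then obtain u where "sum u ?I = 1" "y = (\<Sum>i\<in>?I. u i *\<^sub>R xs ! i)" by blast
    then show "y \<in> {y. \<exists>u. sum u ((!) xs ` ?I) = 1 \<and> (\<Sum>v\<in>(!) xs ` ?I. u v *\<^sub>R v) = y}"
      using v(3)
      by (auto simp: sum.reindex inv_into_f_f intro!: exI[of _ "\<lambda>y. u (inv_into ?I ((!) xs) y)"])
  qed
  finally show ?thesis .
qed

text \<open>Affine independence makes the edge vectors from a chosen vertex i0 linearly independent.
  The linear part is prescribed on them by the differences of the values t, and the constant is
  adjusted at i0.\<close>

lemma numbered_simplex_affine_interpolation:
  fixes t :: "nat \<Rightarrow> real"
  assumes "numbered_simplex xs f"
  shows "\<exists>h c. linear h \<and> (\<forall>j\<in>vertex_indices xs f. h (xs ! j) + c = t j)"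
proof -
  let ?I = "vertex_indices xs f"
  note v = numbered_simplex_vertices[OF assms]
  obtain i0 where i0: "i0 \<in> ?I" using v(4) by blast
  let ?B = "(\<lambda>x. - (xs ! i0) + x) ` ((!) xs ` ?I - {xs ! i0})"
  have "independent ?B"
    using affine_dependent_iff_dependent2[of "xs ! i0" "(!) xs ` ?I"] i0 v(1) by auto
  then obtain h :: "_ \<Rightarrow> real" where h: "linear h"
    "\<And>b. b \<in> ?B \<Longrightarrow> h b = t (inv_into ?I ((!) xs) (xs ! i0 + b)) - t i0"
    using linear_independent_extend[of ?B "\<lambda>b. t (inv_into ?I ((!) xs) (xs ! i0 + b)) - t i0"] by blast
  have "h (xs ! j) + (t i0 - h (xs ! i0)) = t j" if j: "j \<in> ?I" for j
  proof (cases "xs ! j = xs ! i0")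
    case True
    then have "j = i0" using v(3) j i0 by (auto dest: inj_onD)
    then show ?thesis by simp
  next
    case False
    then have "h (- (xs ! i0) + xs ! j) = t j - t i0"
      using j v(3) by (subst h(2)) (auto simp: inv_into_f_f)
    then show ?thesis using h(1) by (simp add: linear_diff)
  qed
  with h(1) show ?thesis by blast
qed

lemma affine_fun_combination:
  fixes h :: "'a::real_vector \<Rightarrow> real"
  assumes "linear h" "sum u I = 1"
  shows "h (\<Sum>i\<in>I. u i *\<^sub>R x i) + c = (\<Sum>i\<in>I. u i * (h (x i) + c))"
proof -
  have "(\<Sum>i\<in>I. u i * c) = c" using assms(2) by (simp add: sum_distrib_right[symmetric])
  then show ?thesis using assms(1) by (simp add: linear_sum linear_cmul distrib_left sum.distrib)
qed

text \<open>Resolves the definite description: existence is affine interpolation at the vertices,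
  and uniqueness holds because an affine function on the affine hull is determined by its values at
  the vertices.\<close>

lemma bary_affine:
  assumes ns: "numbered_simplex xs f"
  shows "\<exists>h c. linear h \<and> (\<forall>y\<in>affine hull f. bary xs f i y = h y + c)"
    and bary_vertex: "j \<in> vertex_indices xs f \<Longrightarrow> bary xs f i (xs ! j) = (if j = i then 1 else 0)"
proof -
  let ?I = "vertex_indices xs f"
  let ?P = "\<lambda>l. (\<exists>h c. linear h \<and> (\<forall>y\<in>affine hull f. l y = h y + c)) \<and>
     (\<forall>y. y \<notin> affine hull f \<longrightarrow> l y = 0) \<and>
     (\<forall>j\<in>?I. l (xs ! j) = (if j = i then 1 else 0 :: real))"
  have vert: "xs ! j \<in> affine hull f" if "j \<in> ?I" for j
    using that hull_subset[of f affine] by (auto simp: vertex_indices_def extreme_point_of_def)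
  have "\<exists>!l. ?P l"
  proof (rule ex_ex1I)
    obtain h :: "'a \<Rightarrow> real" and c where h: "linear h" "\<forall>j\<in>?I. h (xs ! j) + c = (if j = i then 1 else 0)"
      using numbered_simplex_affine_interpolation[OF ns, of "\<lambda>j. if j = i then 1 else 0"] by blast
    then show "\<exists>l. ?P l"
      using vert by (intro exI[of _ "\<lambda>y. if y \<in> affine hull f then h y + c else 0"]) auto
  next
    fix l l' assume l: "?P l" and l': "?P l'"
    from l obtain h c where h: "linear h" "\<forall>y\<in>affine hull f. l y = h y + c" by blast
    from l' obtain h' c' where h': "linear h'" "\<forall>y\<in>affine hull f. l' y = h' y + c'" by blast
    show "l = l'"
    proof
      fix y
      show "l y = l' y"
      proof (cases "y \<in> affine hull f")
        case True
        then obtain u where u: "sum u ?I = 1" "y = (\<Sum>i\<in>?I. u i *\<^sub>R xs ! i)"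
          using numbered_simplex_affine_hull[OF ns] by blast
        have "l y = (\<Sum>i\<in>?I. u i * (h (xs ! i) + c))"
          using True h affine_fun_combination[OF h(1) u(1), of "(!) xs" c] u(2) by simp
        also have "\<dots> = (\<Sum>i\<in>?I. u i * (h' (xs ! i) + c'))"
          using l l' h(2) h'(2) vert by (intro sum.cong refl) metis
        also have "\<dots> = l' y"
          using True h' affine_fun_combination[OF h'(1) u(1), of "(!) xs" c'] u(2) by simp
        finally show ?thesis .
      qed (use l l' in auto)
    qed
  qed
  then have "?P (bary xs f i)" unfolding bary_def by (rule theI')
  then show "\<exists>h c. linear h \<and> (\<forall>y\<in>affine hull f. bary xs f i y = h y + c)"
    and "j \<in> ?I \<Longrightarrow> bary xs f i (xs ! j) = (if j = i then 1 else 0)" by blast+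
qed

lemma vertex_in_simplex: "i \<in> vertex_indices xs f \<Longrightarrow> xs ! i \<in> f"
  by (auto simp: vertex_indices_def extreme_point_of_def)

lemma combination_in_affine_hull:
  assumes "numbered_simplex xs f" "sum u (vertex_indices xs f) = 1"
  shows "(\<Sum>i\<in>vertex_indices xs f. u i *\<^sub>R xs ! i) \<in> affine hull f"
  using assms(2) by (auto simp: numbered_simplex_affine_hull[OF assms(1)])

text \<open>Later identities for \<open>bary\<close> follow from this one by exhibiting suitable
  coefficients and reading them off.\<close>

lemma bary_combination:
  assumes ns: "numbered_simplex xs f" and u: "sum u (vertex_indices xs f) = 1"
    and i: "i \<in> vertex_indices xs f"
  shows "bary xs f i (\<Sum>j\<in>vertex_indices xs f. u j *\<^sub>R xs ! j) = u i"
proof -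
  let ?I = "vertex_indices xs f"
  obtain h c where h: "linear h" "\<forall>y\<in>affine hull f. bary xs f i y = h y + c"
    using bary_affine(1)[OF ns] by blast
  have vert: "xs ! j \<in> affine hull f" if "j \<in> ?I" for j
    using vertex_in_simplex[OF that] hull_subset[of f affine] by blast
  have "bary xs f i (\<Sum>j\<in>?I. u j *\<^sub>R xs ! j) = (\<Sum>j\<in>?I. u j * (h (xs ! j) + c))"
    using h combination_in_affine_hull[OF ns u] affine_fun_combination[OF h(1) u] by simp
  also have "\<dots> = (\<Sum>j\<in>?I. u j * (if j = i then 1 else 0))"
    using h(2) vert bary_vertex[OF ns, of _ i] by (intro sum.cong refl) (metis (full_types))
  also have "\<dots> = u i" using i by (simp add: if_distrib cong: if_cong)
  finally show ?thesis .
qed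

lemma bary_representation:
  assumes ns: "numbered_simplex xs f" and y: "y \<in> affine hull f"
  shows "(\<Sum>i\<in>vertex_indices xs f. bary xs f i y) = 1"
    and "(\<Sum>i\<in>vertex_indices xs f. bary xs f i y *\<^sub>R xs ! i) = y"
proof -
  let ?I = "vertex_indices xs f"
  from y obtain u where u: "sum u ?I = 1" "y = (\<Sum>i\<in>?I. u i *\<^sub>R xs ! i)"
    using numbered_simplex_affine_hull[OF ns] by blast
  then have "bary xs f i y = u i" if "i \<in> ?I" for i
    using bary_combination[OF ns u(1) that] by simp
  then show "(\<Sum>i\<in>?I. bary xs f i y) = 1" "(\<Sum>i\<in>?I. bary xs f i y *\<^sub>R xs ! i) = y"
    using u by simp_all
qed

lemma dbary_combination:
  assumes ns: "numbered_simplex xs f" and a: "sum a (vertex_indices xs f) = 0"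
    and i: "i \<in> vertex_indices xs f"
  shows "dbary xs f i (\<Sum>j\<in>vertex_indices xs f. a j *\<^sub>R xs ! j) = a i"
proof -
  let ?I = "vertex_indices xs f"
  \<comment> \<open>Adding 1 at index i accounts for the base point of \<open>dbary\<close> and
    turns coefficients with sum 0 into those of an affine combination.\<close>
  let ?u = "\<lambda>j. (if j = i then 1 else 0) + a j"
  have "(\<Sum>j\<in>?I. ?u j *\<^sub>R xs ! j) = (\<Sum>j\<in>?I. (if j = i then 1 else 0) *\<^sub>R xs ! j) + (\<Sum>j\<in>?I. a j *\<^sub>R xs ! j)"
    by (simp add: scaleR_add_left sum.distrib)
  also have "(\<Sum>j\<in>?I. (if j = i then 1 else 0) *\<^sub>R xs ! j) = xs ! i"
    using i by (simp add: if_distrib[of "\<lambda>c. c *\<^sub>R _"] cong: if_cong)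
  finally have eq: "(\<Sum>j\<in>?I. ?u j *\<^sub>R xs ! j) = xs ! i + (\<Sum>j\<in>?I. a j *\<^sub>R xs ! j)" .
  have "sum ?u ?I = 1" using a i by (simp add: sum.distrib)
  from bary_combination[OF ns this i] eq
  have "bary xs f i (xs ! i + (\<Sum>j\<in>?I. a j *\<^sub>R xs ! j)) = 1 + a i" by simp
  then show ?thesis using bary_vertex[OF ns i, of i] by (simp add: dbary_def)
qed

section \<open>Tangent spaces of simplices\<close>

lemma subspace_tangent: "subspace (tangent S)"
  by (simp add: tangent_def)

lemma tangent_mono: "S \<subseteq> T \<Longrightarrow> tangent S \<subseteq> tangent T"
  unfolding tangent_def by (intro span_mono) auto

lemma tangent_simplex:
  assumes ns: "numbered_simplex xs f"
  shows "tangent f = {\<Sum>i\<in>vertex_indices xs f. a i *\<^sub>R xs ! i | a. sum a (vertex_indices xs f) = 0}"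
    (is "_ = ?V")
proof
  let ?I = "vertex_indices xs f"
  have V: "subspace ?V"
    unfolding subspace_def
  proof (intro conjI ballI allI)
    show "0 \<in> ?V" by (auto intro!: exI[of _ "\<lambda>_. 0"])
    fix v assume "v \<in> ?V"
    then obtain a where a: "v = (\<Sum>i\<in>?I. a i *\<^sub>R xs ! i)" "sum a ?I = 0" by blast
    show "c *\<^sub>R v \<in> ?V" for c
      using a by (auto intro!: exI[of _ "\<lambda>i. c * a i"] simp: scaleR_sum_right sum_distrib_left[symmetric])
    fix w assume "w \<in> ?V"
    then obtain b where b: "w = (\<Sum>i\<in>?I. b i *\<^sub>R xs ! i)" "sum b ?I = 0" by blast
    show "v + w \<in> ?V"
      using a b by (auto intro!: exI[of _ "\<lambda>i. a i + b i"] simp: sum.distrib scaleR_add_left)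
  qed
  show "tangent f \<subseteq> ?V"
    unfolding tangent_def
  proof (rule span_minimal[OF _ V], safe)
    fix y z assume "y \<in> f" "z \<in> f"
    then have yz: "y \<in> affine hull f" "z \<in> affine hull f" by (auto simp: hull_inc)
    let ?a = "\<lambda>i. bary xs f i y - bary xs f i z"
    have "(\<Sum>i\<in>?I. ?a i *\<^sub>R xs ! i) = y - z" "sum ?a ?I = 0"
      using bary_representation[OF ns yz(1)] bary_representation[OF ns yz(2)]
      by (simp_all add: scaleR_diff_left sum_subtractf)
    then show "\<exists>a. y - z = (\<Sum>i\<in>?I. a i *\<^sub>R xs ! i) \<and> sum a ?I = 0" by metis
  qed
  show "?V \<subseteq> tangent f"
  proof safe
    fix a :: "nat \<Rightarrow> real" assume a: "sum a ?I = 0"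
    obtain i0 where i0: "i0 \<in> ?I" using numbered_simplex_vertices(4)[OF ns] by blast
    \<comment> \<open>As the coefficients sum to 0, the vertex i0 may be subtracted in every term,
      which leaves differences of points of f.\<close>
    have "(\<Sum>i\<in>?I. a i *\<^sub>R xs ! i0) = 0" using a by (simp add: scaleR_sum_left[symmetric])
    then have "(\<Sum>i\<in>?I. a i *\<^sub>R xs ! i) = (\<Sum>i\<in>?I. a i *\<^sub>R (xs ! i - xs ! i0))"
      by (simp add: scaleR_diff_right sum_subtractf)
    also have "\<dots> \<in> tangent f"
      unfolding tangent_def using i0 vertex_in_simplex
      by (intro span_sum span_scale span_base) blast
    finally show "(\<Sum>i\<in>?I. a i *\<^sub>R xs ! i) \<in> tangent f" .
  qed
qed

lemma combination_in_tangent: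
  assumes "numbered_simplex xs f" "sum a (vertex_indices xs f) = 0"
  shows "(\<Sum>i\<in>vertex_indices xs f. a i *\<^sub>R xs ! i) \<in> tangent f"
  using assms(2) by (auto simp: tangent_simplex[OF assms(1)])

lemma dbary_representation:
  assumes ns: "numbered_simplex xs f" and v: "v \<in> tangent f"
  shows "(\<Sum>i\<in>vertex_indices xs f. dbary xs f i v) = 0"
    and "(\<Sum>i\<in>vertex_indices xs f. dbary xs f i v *\<^sub>R xs ! i) = v"
proof -
  let ?I = "vertex_indices xs f"
  from v obtain a where a: "sum a ?I = 0" "v = (\<Sum>i\<in>?I. a i *\<^sub>R xs ! i)"
    using tangent_simplex[OF ns] by blast
  then have "dbary xs f i v = a i" if "i \<in> ?I" for i
    using dbary_combination[OF ns a(1) that] by simp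
  then show "(\<Sum>i\<in>?I. dbary xs f i v) = 0" "(\<Sum>i\<in>?I. dbary xs f i v *\<^sub>R xs ! i) = v"
    using a by simp_all
qed

lemma dbary_linear:
  assumes ns: "numbered_simplex xs f" and v: "v \<in> tangent f" and w: "w \<in> tangent f"
    and i: "i \<in> vertex_indices xs f"
  shows "dbary xs f i (a *\<^sub>R v + b *\<^sub>R w) = a * dbary xs f i v + b * dbary xs f i w"
proof -
  let ?I = "vertex_indices xs f"
  let ?c = "\<lambda>i. a * dbary xs f i v + b * dbary xs f i w"
  note r = dbary_representation[OF ns v] dbary_representation[OF ns w]
  have "(\<Sum>i\<in>?I. ?c i *\<^sub>R xs ! i) = a *\<^sub>R (\<Sum>i\<in>?I. dbary xs f i v *\<^sub>R xs ! i) + b *\<^sub>R (\<Sum>i\<in>?I. dbary xs f i w *\<^sub>R xs ! i)"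
    by (simp only: scaleR_add_left sum.distrib scaleR_sum_right scaleR_scaleR)
  then have "(\<Sum>i\<in>?I. ?c i *\<^sub>R xs ! i) = a *\<^sub>R v + b *\<^sub>R w" using r by simp
  moreover have "sum ?c ?I = 0" using r by (simp add: sum.distrib sum_distrib_left[symmetric])
  ultimately show ?thesis using dbary_combination[OF ns _ i, of ?c] by simp
qed

lemma positive_combination_in_simplex:
  assumes ns: "numbered_simplex xs f" and "\<And>i. i \<in> vertex_indices xs f \<Longrightarrow> u i \<ge> 0"
    and "sum u (vertex_indices xs f) = 1"
  shows "(\<Sum>i\<in>vertex_indices xs f. u i *\<^sub>R xs ! i) \<in> f"
proof -
  have "convex f" using numbered_simplex_vertices(2)[OF ns] convex_convex_hull by metis
  then show ?thesis using assms vertex_in_simplex by (intro convex_sum) auto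
qed

subsection \<open>Faces\<close>

lemma numbered_simplex_face:
  assumes ns: "numbered_simplex xs g" and f: "f face_of g" "f \<noteq> {}"
  shows "numbered_simplex xs f"
proof -
  have "\<exists>n. n simplex f"
  proof -
    from ns obtain n C where C: "\<not> affine_dependent C" "g = convex hull C"
      by (auto simp: numbered_simplex_def simplex_def)
    with f(1) obtain c where c: "c \<subseteq> C" "f = convex hull c"
      using face_of_convex_hull_affine_independent by blast
    have "\<not> affine_dependent c" using c C affine_independent_subset by blast
    then show ?thesis using c by (auto simp: simplex_def intro!: exI[of _ "int (card c) - 1"] exI[of _ c])
  qed
  moreover have "{v. v extreme_point_of f} \<subseteq> {v. v extreme_point_of g}"
    using extreme_point_of_face[OF f(1)] by auto
  ultimately show ?thesis using ns f unfolding numbered_simplex_def by blast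
qed

lemma vertex_indices_face:
  "f face_of g \<Longrightarrow> vertex_indices xs f = {i \<in> vertex_indices xs g. xs ! i \<in> f}"
  by (auto simp: vertex_indices_def extreme_point_of_face)

lemma vertex_indices_face_subset: "f face_of g \<Longrightarrow> vertex_indices xs f \<subseteq> vertex_indices xs g"
  by (auto simp: vertex_indices_face)

text \<open>The coordinates in f, continued by 0 to the other vertices of g, represent y in g as
  well, and such a representation is unique. The trace formulas rest on this and on its analogue
  \<open>dbary_face\<close> for differentials.\<close>

lemma bary_face:
  assumes ns: "numbered_simplex xs g" and f: "f face_of g" "f \<noteq> {}"
    and y: "y \<in> affine hull f" and i: "i \<in> vertex_indices xs g"
  shows "bary xs g i y = (if i \<in> vertex_indices xs f then bary xs f i y else 0)"
proof -
  let ?u = "\<lambda>i. if i \<in> vertex_indices xs f then bary xs f i y else 0"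
  note nf = numbered_simplex_face[OF ns f]
  note sub = vertex_indices_face_subset[OF f(1), of xs]
  have "sum ?u (vertex_indices xs g) = 1"
    using bary_representation(1)[OF nf y] sub by (simp add: sum.inter_restrict[symmetric] Int_absorb1)
  moreover have "(\<Sum>i\<in>vertex_indices xs g. ?u i *\<^sub>R xs ! i) = y"
  proof -
    have "(\<Sum>i\<in>vertex_indices xs g. ?u i *\<^sub>R xs ! i) = (\<Sum>i\<in>vertex_indices xs f. ?u i *\<^sub>R xs ! i)"
      using sub by (intro sum.mono_neutral_right) auto
    then show ?thesis using bary_representation(2)[OF nf y] by simp
  qed
  ultimately show ?thesis using bary_combination[OF ns _ i, of ?u] by simp
qed

lemma dbary_face:
  assumes ns: "numbered_simplex xs g" and f: "f face_of g" "f \<noteq> {}"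
    and v: "v \<in> tangent f" and i: "i \<in> vertex_indices xs g"
  shows "dbary xs g i v = (if i \<in> vertex_indices xs f then dbary xs f i v else 0)"
proof -
  let ?u = "\<lambda>i. if i \<in> vertex_indices xs f then dbary xs f i v else 0"
  note nf = numbered_simplex_face[OF ns f]
  note sub = vertex_indices_face_subset[OF f(1), of xs]
  have "sum ?u (vertex_indices xs g) = 0"
    using dbary_representation(1)[OF nf v] sub by (simp add: sum.inter_restrict[symmetric] Int_absorb1)
  moreover have "(\<Sum>i\<in>vertex_indices xs g. ?u i *\<^sub>R xs ! i) = v"
  proof -
    have "(\<Sum>i\<in>vertex_indices xs g. ?u i *\<^sub>R xs ! i) = (\<Sum>i\<in>vertex_indices xs f. ?u i *\<^sub>R xs ! i)"
      using sub by (intro sum.mono_neutral_right) auto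
    then show ?thesis using dbary_representation(2)[OF nf v] by simp
  qed
  ultimately show ?thesis using dbary_combination[OF ns _ i, of ?u] by simp
qed

lemma card_vertex_indices:
  assumes "numbered_simplex xs f"
  shows "int (card (vertex_indices xs f)) = aff_dim f + 1"
proof -
  note v = numbered_simplex_vertices[OF assms]
  have "aff_dim f = aff_dim ((!) xs ` vertex_indices xs f)" using v(2) aff_dim_convex_hull by metis
  also have "\<dots> = int (card ((!) xs ` vertex_indices xs f)) - 1"
    using v(1) by (simp add: aff_dim_affine_independent)
  finally show ?thesis using v(3) by (simp add: card_image)
qed


section \<open>Polynomial forms on a simplex\<close>

lemma poly_formsD:
  assumes "\<omega> \<in> poly_forms r k S"
  shows "y \<in> S \<Longrightarrow> alternating k (tangent S) (\<omega> y)" "y \<notin> S \<Longrightarrow> \<omega> y vs = 0"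
    "length vs = k \<Longrightarrow> set vs \<subseteq> tangent S \<Longrightarrow> \<exists>p\<in>poly_fun r. \<forall>y\<in>S. \<omega> y vs = p y"
    "\<not> (length vs = k \<and> set vs \<subseteq> tangent S) \<Longrightarrow> \<omega> y vs = 0"
proof -
  show a: "y \<in> S \<Longrightarrow> alternating k (tangent S) (\<omega> y)"
    and "y \<notin> S \<Longrightarrow> \<omega> y vs = 0"
    and "length vs = k \<Longrightarrow> set vs \<subseteq> tangent S \<Longrightarrow> \<exists>p\<in>poly_fun r. \<forall>y\<in>S. \<omega> y vs = p y"
    using assms by (auto simp: poly_forms_def)
  show "\<not> (length vs = k \<and> set vs \<subseteq> tangent S) \<Longrightarrow> \<omega> y vs = 0"
    using assms alternating_outside[of k "tangent S" "\<omega> y" vs] by (cases "y \<in> S") (auto simp: poly_forms_def)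
qed

lemma poly_forms_lincomb:
  assumes "\<omega> \<in> poly_forms r k S" "\<eta> \<in> poly_forms r k S"
  shows "(\<lambda>y vs. a * \<omega> y vs + b * \<eta> y vs) \<in> poly_forms r k S"
  unfolding poly_forms_def
proof (intro CollectI conjI ballI allI impI)
  fix vs assume vs: "length vs = k \<and> set vs \<subseteq> tangent S"
  obtain p q where "p \<in> poly_fun r" "\<forall>y\<in>S. \<omega> y vs = p y" "q \<in> poly_fun r" "\<forall>y\<in>S. \<eta> y vs = q y"
    using poly_formsD(3)[OF assms(1), of vs] poly_formsD(3)[OF assms(2), of vs] vs by blast
  then show "\<exists>p\<in>poly_fun r. \<forall>y\<in>S. a * \<omega> y vs + b * \<eta> y vs = p y"
    by (intro bexI[of _ "\<lambda>y. a * p y + b * q y"]) (auto intro: poly_fun_lincomb)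
qed (use assms in \<open>auto simp: poly_forms_def intro: alternating_lincomb\<close>)

lemma poly_fun_zero: "(\<lambda>y. 0) \<in> poly_fun r"
  unfolding poly_fun_eq_mono_span by (rule mono_span_zero)

lemma poly_forms_zero: "(\<lambda>y vs. 0) \<in> poly_forms r k S"
  using poly_fun_zero[of r] by (force simp: poly_forms_def alternating_zero)

lemma poly_forms_sum:
  assumes "\<And>i. i \<in> J \<Longrightarrow> \<omega> i \<in> poly_forms r k S"
  shows "(\<lambda>y vs. \<Sum>i\<in>J. \<omega> i y vs) \<in> poly_forms r k S"
  using assms
proof (induction J rule: infinite_finite_induct)
  case (insert i J)
  then show ?case
    using poly_forms_lincomb[of "\<omega> i" r k S "\<lambda>y vs. \<Sum>i\<in>J. \<omega> i y vs" 1 1] by simp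
qed (simp_all add: poly_forms_zero)

text \<open>The common shape of an expansion with constant coefficients and of its extension to a
  larger simplex.\<close>

lemma poly_forms_coefficient_sum:
  assumes m: "\<And>\<alpha>. \<alpha> \<in> D \<Longrightarrow> \<exists>p\<in>poly_fun r. \<forall>y\<in>S. m \<alpha> y = p y"
    and c: "\<And>\<alpha>. \<alpha> \<in> D \<Longrightarrow> alternating k (tangent S) (c \<alpha>)"
  shows "(\<lambda>y vs. if y \<in> S then \<Sum>\<alpha>\<in>D. m \<alpha> y * c \<alpha> vs else 0) \<in> poly_forms r k S"
  unfolding poly_forms_def
proof (intro CollectI conjI ballI allI impI)
  fix y assume "y \<in> S"
  then show "alternating k (tangent S) (\<lambda>vs. if y \<in> S then \<Sum>\<alpha>\<in>D. m \<alpha> y * c \<alpha> vs else 0)"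
    using c by (simp add: alternating_sum alternating_scale)
next
  fix vs
  from m obtain p where p: "\<And>\<alpha>. \<alpha> \<in> D \<Longrightarrow> p \<alpha> \<in> poly_fun r" "\<And>\<alpha> y. \<alpha> \<in> D \<Longrightarrow> y \<in> S \<Longrightarrow> m \<alpha> y = p \<alpha> y"
    by metis
  have "(\<lambda>y. \<Sum>\<alpha>\<in>D. c \<alpha> vs * p \<alpha> y) \<in> poly_fun r"
    using p(1) by (intro poly_fun_sum poly_fun_scale)
  then show "\<exists>p\<in>poly_fun r. \<forall>y\<in>S. (if y \<in> S then \<Sum>\<alpha>\<in>D. m \<alpha> y * c \<alpha> vs else 0) = p y"
    by (rule rev_bexI) (auto simp: p(2) mult.commute)
qed simp

text \<open>\<open>has_coeffs xs k r f c \<omega>\<close> says \<open>\<omega> = \<Sum>\<^bsub>|\<alpha>|=r\<^esub> (\<lambda>\<^sup>f)\<^sup>\<alpha> c\<^sub>\<alpha>\<close> with constant alternating \<open>c\<^sub>\<alpha>\<close>. Such an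
  expansion exists and is unique; this is what makes the extension operators well defined.\<close>

definition has_coeffs :: "'a::euclidean_space list \<Rightarrow> nat \<Rightarrow> nat \<Rightarrow> 'a set \<Rightarrow>
    ((nat \<Rightarrow> nat) \<Rightarrow> 'a list \<Rightarrow> real) \<Rightarrow> 'a form \<Rightarrow> bool" where
  "has_coeffs xs k r f c \<omega> \<longleftrightarrow> (\<forall>\<alpha>. alternating k (tangent f) (c \<alpha>)) \<and>
     (\<forall>\<alpha>. \<alpha> \<notin> hom_exponents (vertex_indices xs f) r \<longrightarrow> c \<alpha> = (\<lambda>vs. 0)) \<and>
     \<omega> = (\<lambda>y vs. if y \<in> f then \<Sum>\<alpha>\<in>hom_exponents (vertex_indices xs f) r.
       (\<Prod>i\<in>vertex_indices xs f. bary xs f i y ^ \<alpha> i) * c \<alpha> vs else 0)"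

text \<open>Every positive t with sum 1 is the tuple of coordinates of a point of f, so vanishing on
  f is enough for the independence of homogeneous monomials.\<close>

lemma bary_monomials_independent:
  assumes ns: "numbered_simplex xs f" and \<alpha>: "\<alpha> \<in> hom_exponents (vertex_indices xs f) r"
    and z: "\<And>y. y \<in> f \<Longrightarrow> (\<Sum>\<alpha>\<in>hom_exponents (vertex_indices xs f) r.
      (\<Prod>i\<in>vertex_indices xs f. bary xs f i y ^ \<alpha> i) * d \<alpha>) = 0"
  shows "d \<alpha> = 0"
proof (rule hom_monomials_independent[OF finite_vertex_indices _ _ \<alpha>])
  let ?I = "vertex_indices xs f"
  show "?I \<noteq> {}" using numbered_simplex_vertices(4)[OF ns] .
  fix t :: "nat \<Rightarrow> real" assume t: "\<And>b. b \<in> ?I \<Longrightarrow> t b > 0" "sum t ?I = 1"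
  let ?y = "\<Sum>i\<in>?I. t i *\<^sub>R xs ! i"
  have "?y \<in> f" using t by (intro positive_combination_in_simplex[OF ns]) (auto intro: less_imp_le)
  moreover have "(\<Prod>i\<in>?I. bary xs f i ?y ^ \<alpha> i) = (\<Prod>i\<in>?I. t i ^ \<alpha> i)" for \<alpha>
    using bary_combination[OF ns t(2)] by (intro prod.cong) auto
  ultimately show "(\<Sum>\<alpha>\<in>hom_exponents ?I r. d \<alpha> * (\<Prod>b\<in>?I. t b ^ \<alpha> b)) = 0"
    using z[of ?y] by (simp add: mult.commute)
qed

lemma has_coeffs_unique:
  assumes ns: "numbered_simplex xs f" and c: "has_coeffs xs k r f c \<omega>" and c': "has_coeffs xs k r f c' \<omega>"
  shows "c = c'"
proof (intro ext)
  fix \<alpha> vs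
  let ?I = "vertex_indices xs f"
  show "c \<alpha> vs = c' \<alpha> vs"
  proof (cases "\<alpha> \<in> hom_exponents ?I r")
    case True
    have "c \<alpha> vs - c' \<alpha> vs = 0"
    proof (rule bary_monomials_independent[OF ns True, where d = "\<lambda>\<alpha>. c \<alpha> vs - c' \<alpha> vs"])
      fix y assume "y \<in> f"
      moreover have "\<omega> y vs = \<omega> y vs" ..
      ultimately show "(\<Sum>\<alpha>\<in>hom_exponents ?I r. (\<Prod>i\<in>?I. bary xs f i y ^ \<alpha> i) * (c \<alpha> vs - c' \<alpha> vs)) = 0"
        using c c' unfolding has_coeffs_def
        by (simp add: right_diff_distrib sum_subtractf) (metis (no_types, lifting))
    qed
    then show ?thesis by simp
  qed (use c c' in \<open>auto simp: has_coeffs_def\<close>)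
qed

lemma bary_monomial_poly:
  assumes ns: "numbered_simplex xs g" and \<alpha>: "sum \<alpha> I = r" "finite I"
  shows "\<exists>p\<in>poly_fun r. \<forall>y\<in>g. (\<Prod>i\<in>I. bary xs g i y ^ \<alpha> i) = p y"
proof -
  have "\<exists>l. (\<exists>h c. linear h \<and> (\<forall>y. l y = h y + c)) \<and> (\<forall>y\<in>affine hull g. bary xs g i y = l y)" for i
  proof -
    obtain h c where "linear h" "\<forall>y\<in>affine hull g. bary xs g i y = h y + c"
      using bary_affine(1)[OF ns] by blast
    then show ?thesis by (intro exI[of _ "\<lambda>y. h y + c"]) auto
  qed
  then obtain l where l: "\<And>i. \<exists>h c. linear h \<and> (\<forall>y. l i y = h y + c)"
    "\<And>i y. y \<in> affine hull g \<Longrightarrow> bary xs g i y = l i y" by metis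
  have "(\<lambda>y. \<Prod>i\<in>I. l i y ^ \<alpha> i) \<in> poly_fun r"
    using poly_fun_affine_monomial[OF \<alpha>(2), of l \<alpha>] l(1) \<alpha>(1) by simp
  then show ?thesis
    by (rule rev_bexI) (auto simp: l(2) hull_inc)
qed

lemma has_coeffs_poly_forms:
  assumes ns: "numbered_simplex xs f" and c: "has_coeffs xs k r f c \<omega>"
  shows "\<omega> \<in> poly_forms r k f"
proof -
  have "\<omega> = (\<lambda>y vs. if y \<in> f then \<Sum>\<alpha>\<in>hom_exponents (vertex_indices xs f) r.
       (\<Prod>i\<in>vertex_indices xs f. bary xs f i y ^ \<alpha> i) * c \<alpha> vs else 0)"
    using c by (simp only: has_coeffs_def)
  also have "\<dots> \<in> poly_forms r k f"
    using c by (intro poly_forms_coefficient_sum bary_monomial_poly[OF ns]) (auto simp: hom_exponents_def has_coeffs_def)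
  finally show ?thesis .
qed

text \<open>The coefficients are chosen separately for each list of vectors, with no relation
  between different lists. That they are alternating is recovered afterwards: each defect of
  multilinearity or alternation is a coefficient of a homogeneous expansion that vanishes on f,
  hence zero by independence of the monomials.\<close>

lemma poly_forms_has_coeffs:
  assumes ns: "numbered_simplex xs f" and w: "\<omega> \<in> poly_forms r k f"
  shows "\<exists>c. has_coeffs xs k r f c \<omega>"
proof -
  let ?I = "vertex_indices xs f"
  let ?A = "hom_exponents ?I r"
  let ?M = "\<lambda>\<alpha> y. \<Prod>i\<in>?I. bary xs f i y ^ \<alpha> i"
  have ex: "\<exists>d. \<forall>y\<in>f. \<omega> y vs = (\<Sum>\<alpha>\<in>?A. d \<alpha> * ?M \<alpha> y)" if vs: "length vs = k" "set vs \<subseteq> tangent f" for vs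
  proof -
    obtain p where p: "p \<in> poly_fun r" "\<forall>y\<in>f. \<omega> y vs = p y"
      using poly_formsD(3)[OF w vs] by blast
    have "p \<in> mono_span f ?I ?A (bary xs f)"
      by (rule poly_fun_imp_hom[where x = "(!) xs", OF finite_vertex_indices _ _ p(1)])
         (auto simp: bary_representation[OF ns] hull_inc)
    then show ?thesis using p(2) by (auto simp: mono_span_def)
  qed
  define c where "c \<alpha> vs = (if \<alpha> \<in> ?A \<and> length vs = k \<and> set vs \<subseteq> tangent f
    then (SOME d. \<forall>y\<in>f. \<omega> y vs = (\<Sum>\<alpha>\<in>?A. d \<alpha> * ?M \<alpha> y)) \<alpha> else 0)" for \<alpha> vs
  have c: "\<omega> y vs = (\<Sum>\<alpha>\<in>?A. ?M \<alpha> y * c \<alpha> vs)" if y: "y \<in> f" for y vs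
  proof (cases "length vs = k \<and> set vs \<subseteq> tangent f")
    case True
    with someI_ex[OF ex] y show ?thesis by (simp add: c_def mult.commute)
  next
    case False
    then have "c \<alpha> vs = 0" for \<alpha> by (auto simp: c_def)
    then show ?thesis using poly_formsD(4)[OF w False] by simp
  qed
  have "alternating k (tangent f) (c \<alpha>)" if \<alpha>: "\<alpha> \<in> ?A" for \<alpha>
  proof (rule alternatingI)
    show "c \<alpha> vs = 0" if "\<not> (length vs = k \<and> set vs \<subseteq> tangent f)" for vs
      using that by (auto simp: c_def)
  next
    fix vs i v w and a b :: real
    assume h: "length vs = k" "set vs \<subseteq> tangent f" "i < k" "v \<in> tangent f" "w \<in> tangent f"
    have "c \<alpha> (vs[i := a *\<^sub>R v + b *\<^sub>R w]) - (a * c \<alpha> (vs[i := v]) + b * c \<alpha> (vs[i := w])) = 0"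
    proof (rule bary_monomials_independent[OF ns \<alpha>, where
          d = "\<lambda>\<alpha>. c \<alpha> (vs[i := a *\<^sub>R v + b *\<^sub>R w]) - (a * c \<alpha> (vs[i := v]) + b * c \<alpha> (vs[i := w]))"])
      fix y assume y: "y \<in> f"
      have "(\<Sum>\<alpha>\<in>?A. ?M \<alpha> y * (c \<alpha> (vs[i := a *\<^sub>R v + b *\<^sub>R w]) - (a * c \<alpha> (vs[i := v]) + b * c \<alpha> (vs[i := w]))))
        = \<omega> y (vs[i := a *\<^sub>R v + b *\<^sub>R w]) - (a * \<omega> y (vs[i := v]) + b * \<omega> y (vs[i := w]))"
        unfolding c[OF y] by (simp add: algebra_simps sum.distrib sum_subtractf sum_distrib_left)
      also have "\<dots> = 0"
        using alternating_multilinear[OF poly_formsD(1)[OF w y] h] by simp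
      finally show "(\<Sum>\<alpha>\<in>?A. ?M \<alpha> y * (c \<alpha> (vs[i := a *\<^sub>R v + b *\<^sub>R w]) - (a * c \<alpha> (vs[i := v]) + b * c \<alpha> (vs[i := w])))) = 0" .
    qed
    then show "c \<alpha> (vs[i := a *\<^sub>R v + b *\<^sub>R w]) = a * c \<alpha> (vs[i := v]) + b * c \<alpha> (vs[i := w])" by simp
  next
    fix vs :: "'a list" and i j assume h: "i < j" "j < k" "vs ! i = vs ! j"
    show "c \<alpha> vs = 0"
      using c h alternating_repeated[OF poly_formsD(1)[OF w], of _ i j vs]
      by (intro bary_monomials_independent[OF ns \<alpha>, where d = "\<lambda>\<alpha>. c \<alpha> vs"]) auto
  qed
  moreover have "c \<alpha> = (\<lambda>vs. 0)" if "\<alpha> \<notin> ?A" for \<alpha> using that by (simp add: c_def fun_eq_iff)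
  ultimately have "\<forall>\<alpha>. alternating k (tangent f) (c \<alpha>)" "\<forall>\<alpha>. \<alpha> \<notin> ?A \<longrightarrow> c \<alpha> = (\<lambda>vs. 0)"
    by (metis alternating_zero)+
  moreover have "\<omega> = (\<lambda>y vs. if y \<in> f then \<Sum>\<alpha>\<in>?A. ?M \<alpha> y * c \<alpha> vs else 0)"
    using c poly_formsD(2)[OF w] by (auto simp: fun_eq_iff)
  ultimately show ?thesis unfolding has_coeffs_def by blast
qed

section \<open>Linearity of the coefficients, and the generating forms\<close>

lemma has_coeffs_lincomb:
  assumes "has_coeffs xs k r f c \<omega>" "has_coeffs xs k r f d \<eta>"
  shows "has_coeffs xs k r f (\<lambda>\<alpha> vs. a * c \<alpha> vs + b * d \<alpha> vs) (\<lambda>y vs. a * \<omega> y vs + b * \<eta> y vs)"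
proof -
  have "\<omega> = (\<lambda>y vs. if y \<in> f then \<Sum>\<alpha>\<in>hom_exponents (vertex_indices xs f) r.
       (\<Prod>i\<in>vertex_indices xs f. bary xs f i y ^ \<alpha> i) * c \<alpha> vs else 0)"
    "\<eta> = (\<lambda>y vs. if y \<in> f then \<Sum>\<alpha>\<in>hom_exponents (vertex_indices xs f) r.
       (\<Prod>i\<in>vertex_indices xs f. bary xs f i y ^ \<alpha> i) * d \<alpha> vs else 0)"
    using assms by (simp_all only: has_coeffs_def)
  then have "(\<lambda>y vs. a * \<omega> y vs + b * \<eta> y vs) =
    (\<lambda>y vs. if y \<in> f then \<Sum>\<alpha>\<in>hom_exponents (vertex_indices xs f) r.
       (\<Prod>i\<in>vertex_indices xs f. bary xs f i y ^ \<alpha> i) * (a * c \<alpha> vs + b * d \<alpha> vs) else 0)"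
    by (simp add: fun_eq_iff algebra_simps sum.distrib sum_distrib_left)
  moreover have "alternating k (tangent f) (\<lambda>vs. a * c \<alpha> vs + b * d \<alpha> vs)" for \<alpha>
    using assms by (intro alternating_lincomb) (auto simp: has_coeffs_def)
  ultimately show ?thesis using assms unfolding has_coeffs_def by auto
qed

text \<open>In \<open>bary_form\<close> the values of \<alpha> off the vertices of f are arbitrary,
  whereas exponents must be 0 there; hence the only coefficient that can be nonzero sits at the
  truncated exponent.\<close>

lemma has_coeffs_bary_form:
  assumes ns: "numbered_simplex xs f" and \<alpha>: "sum \<alpha> (vertex_indices xs f) = r"
    and \<sigma>: "\<And>m. m < k \<Longrightarrow> \<sigma> m \<in> vertex_indices xs f"
  shows "has_coeffs xs k r f
    (\<lambda>\<beta>. if \<beta> = (\<lambda>i. if i \<in> vertex_indices xs f then \<alpha> i else 0)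
      then (\<lambda>vs. if set vs \<subseteq> tangent f then wedge k (\<lambda>m. dbary xs f (\<sigma> m)) vs else 0) else (\<lambda>vs. 0))
    (bary_form xs k f \<alpha> \<sigma>)"
proof -
  let ?I = "vertex_indices xs f"
  let ?a = "\<lambda>i. if i \<in> ?I then \<alpha> i else 0"
  have A: "?a \<in> hom_exponents ?I r" using \<alpha> by (simp add: hom_exponents_def)
  have "alternating k (tangent f) (\<lambda>vs. if set vs \<subseteq> tangent f then wedge k (\<lambda>m. dbary xs f (\<sigma> m)) vs else 0)"
    using \<sigma> by (intro alternating_wedge subspace_tangent dbary_linear[OF ns])
  moreover have "bary_form xs k f \<alpha> \<sigma> = (\<lambda>y vs. if y \<in> f then \<Sum>\<beta>\<in>hom_exponents ?I r.
       (\<Prod>i\<in>?I. bary xs f i y ^ \<beta> i) *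
       (if \<beta> = ?a then (\<lambda>vs. if set vs \<subseteq> tangent f then wedge k (\<lambda>m. dbary xs f (\<sigma> m)) vs else 0) else (\<lambda>vs. 0)) vs
     else 0)"
  proof (intro ext)
    fix y vs
    have "(\<Sum>\<beta>\<in>hom_exponents ?I r. (\<Prod>i\<in>?I. bary xs f i y ^ \<beta> i) *
       (if \<beta> = ?a then (\<lambda>vs. if set vs \<subseteq> tangent f then wedge k (\<lambda>m. dbary xs f (\<sigma> m)) vs else 0) else (\<lambda>vs. 0)) vs)
       = (\<Sum>\<beta>\<in>hom_exponents ?I r. if \<beta> = ?a then (\<Prod>i\<in>?I. bary xs f i y ^ ?a i) *
       (if set vs \<subseteq> tangent f then wedge k (\<lambda>m. dbary xs f (\<sigma> m)) vs else 0) else 0)"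
      by (intro sum.cong) auto
    also have "\<dots> = (\<Prod>i\<in>?I. bary xs f i y ^ ?a i) *
       (if set vs \<subseteq> tangent f then wedge k (\<lambda>m. dbary xs f (\<sigma> m)) vs else 0)"
      using A by (simp add: finite_hom_exponents)
    finally show "bary_form xs k f \<alpha> \<sigma> y vs = (if y \<in> f then \<Sum>\<beta>\<in>hom_exponents ?I r.
       (\<Prod>i\<in>?I. bary xs f i y ^ \<beta> i) *
       (if \<beta> = ?a then (\<lambda>vs. if set vs \<subseteq> tangent f then wedge k (\<lambda>m. dbary xs f (\<sigma> m)) vs else 0) else (\<lambda>vs. 0)) vs
     else 0)"
      by (simp add: bary_form_def form_trace_def)
  qed
  ultimately show ?thesis unfolding has_coeffs_def using A by (auto simp: alternating_zero)
qed

text \<open>The differentials of all barycentric coordinates are dependent. Leaving out i0, whose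
  term would carry the zero vector, gives a representation by the edges from i0, which are as many
  as the dimension of f.\<close>

lemma tangent_simplex_basis:
  assumes ns: "numbered_simplex xs f" and i0: "i0 \<in> vertex_indices xs f" and v: "v \<in> tangent f"
  shows "v = (\<Sum>i\<in>vertex_indices xs f - {i0}. dbary xs f i v *\<^sub>R (xs ! i - xs ! i0))"
proof -
  let ?I = "vertex_indices xs f"
  have "(\<Sum>i\<in>?I - {i0}. dbary xs f i v *\<^sub>R (xs ! i - xs ! i0)) = (\<Sum>i\<in>?I. dbary xs f i v *\<^sub>R (xs ! i - xs ! i0))"
    using i0 by (simp add: sum.remove[of ?I i0])
  also have "\<dots> = v"
    using dbary_representation[OF ns v]
    by (simp add: scaleR_diff_right sum_subtractf scaleR_sum_left[symmetric])
  finally show ?thesis by simp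
qed

text \<open>Linear induction over the generators, for showing that the extension operator is
  determined by its values on them. Expanding each coefficient in wedge products gives generators
  with arbitrary index maps, which then reduce to increasing ones.\<close>

lemma poly_forms_spanned:
  assumes ns: "numbered_simplex xs f" and \<omega>: "\<omega> \<in> poly_forms r k f"
    and zero: "(\<lambda>y vs. 0) \<in> Q"
    and lin: "\<And>\<omega> \<eta> a b. \<omega> \<in> Q \<Longrightarrow> \<eta> \<in> Q \<Longrightarrow> (\<lambda>y vs. a * \<omega> y vs + b * \<eta> y vs) \<in> Q"
    and base: "\<And>\<alpha> \<sigma>. sum \<alpha> (vertex_indices xs f) = r \<Longrightarrow> strict_mono_on {..<k} \<sigma> \<Longrightarrow>
      \<sigma> ` {..<k} \<subseteq> vertex_indices xs f \<Longrightarrow> bary_form xs k f \<alpha> \<sigma> \<in> Q"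
  shows "\<omega> \<in> Q"
proof -
  let ?I = "vertex_indices xs f"
  obtain c where c: "has_coeffs xs k r f c \<omega>" using poly_forms_has_coeffs[OF ns \<omega>] by blast
  obtain i0 where i0: "i0 \<in> ?I" using numbered_simplex_vertices(4)[OF ns] by blast
  let ?e = "\<lambda>i. xs ! i - xs ! i0"
  have sumQ: "(\<lambda>y vs. \<Sum>j\<in>J. \<eta> j y vs) \<in> Q" if "\<And>j. j \<in> J \<Longrightarrow> \<eta> j \<in> Q" for J :: "'j set" and \<eta>
    using that
  proof (induction J rule: infinite_finite_induct)
    case (insert j J)
    then show ?case using lin[of "\<eta> j" "\<lambda>y vs. \<Sum>j\<in>J. \<eta> j y vs" 1 1] by simp
  qed (simp_all add: zero)
  have scaleQ: "(\<lambda>y vs. a * \<eta> y vs) \<in> Q" if "\<eta> \<in> Q" for \<eta> a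
    using lin[OF that that, of a 0] by simp
  \<comment> \<open>An injective index map gives an increasing one up to sign; for any other, two
    equal differentials make the form zero.\<close>
  have all: "bary_form xs k f \<alpha> \<tau> \<in> Q" if \<alpha>: "sum \<alpha> ?I = r" and \<tau>: "\<tau> ` {..<k} \<subseteq> ?I" for \<alpha> \<tau>
  proof (cases "inj_on \<tau> {..<k}")
    case True
    then obtain \<sigma> \<pi> where s: "strict_mono_on {..<k} \<sigma>" "\<pi> permutes {..<k}"
      "\<And>m. m < k \<Longrightarrow> \<tau> m = \<sigma> (\<pi> m)" "\<sigma> ` {..<k} = \<tau> ` {..<k}"
      using inj_on_lessThan_sort by metis
    have "wedge k (\<lambda>m. dbary xs f (\<tau> m)) vs = of_int (sign \<pi>) * wedge k (\<lambda>m. dbary xs f (\<sigma> m)) vs" for vs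
    proof -
      have "wedge k (\<lambda>m. dbary xs f (\<tau> m)) vs = wedge k (\<lambda>m. dbary xs f (\<sigma> (\<pi> m))) vs"
        using s(3) by (intro wedge_cong) simp
      then show ?thesis using wedge_permute_functionals[OF s(2), of "\<lambda>m. dbary xs f (\<sigma> m)" vs] by simp
    qed
    then have "bary_form xs k f \<alpha> \<tau> = (\<lambda>y vs. of_int (sign \<pi>) * bary_form xs k f \<alpha> \<sigma> y vs)"
      by (simp add: bary_form_def form_trace_def fun_eq_iff)
    then show ?thesis using scaleQ[OF base[OF \<alpha> s(1)]] s(4) \<tau> by simp
  next
    case False
    then obtain i j where "i < k" "j < k" "i \<noteq> j" "\<tau> i = \<tau> j" by (auto simp: inj_on_def)
    then have "wedge k (\<lambda>m. dbary xs f (\<tau> m)) vs = 0" for vs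
      by (intro wedge_repeated_functional[of i k j]) auto
    then have "bary_form xs k f \<alpha> \<tau> = (\<lambda>y vs. 0)"
      by (simp add: bary_form_def form_trace_def fun_eq_iff)
    then show ?thesis using zero by simp
  qed
  let ?\<eta> = "\<lambda>y vs. \<Sum>\<alpha>\<in>hom_exponents ?I r. \<Sum>\<tau>\<in>{..<k} \<rightarrow>\<^sub>E (?I - {i0}).
      c \<alpha> (map (\<lambda>m. ?e (\<tau> m)) [0..<k]) / fact k * bary_form xs k f \<alpha> \<tau> y vs"
  have "\<omega> y vs = ?\<eta> y vs" for y vs
  proof (cases "y \<in> f \<and> length vs = k \<and> set vs \<subseteq> tangent f")
    case True
    have e: "?e i \<in> tangent f" if "i \<in> ?I - {i0}" for i
      using that i0 vertex_in_simplex unfolding tangent_def by (intro span_base) blast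
    have "c \<alpha> vs = (\<Sum>\<tau>\<in>{..<k} \<rightarrow>\<^sub>E (?I - {i0}).
        c \<alpha> (map (\<lambda>m. ?e (\<tau> m)) [0..<k]) / fact k * wedge k (\<lambda>m. dbary xs f (\<tau> m)) vs)" for \<alpha>
      using c True by (intro alternating_eq_sum_wedge[where V = "tangent f"] tangent_simplex_basis[OF ns i0] e subspace_tangent)
        (auto simp: has_coeffs_def)
    then have "(\<Sum>\<alpha>\<in>hom_exponents ?I r. (\<Prod>i\<in>?I. bary xs f i y ^ \<alpha> i) * c \<alpha> vs) = ?\<eta> y vs"
      using True by (simp add: bary_form_def form_trace_def sum_distrib_left mult_ac)
    moreover have "\<omega> y vs = (\<Sum>\<alpha>\<in>hom_exponents ?I r. (\<Prod>i\<in>?I. bary xs f i y ^ \<alpha> i) * c \<alpha> vs)"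
      using c True by (simp add: has_coeffs_def)
    ultimately show ?thesis by simp
  next
    case False
    then have "bary_form xs k f \<alpha> \<tau> y vs = 0" for \<alpha> \<tau>
      by (auto simp: bary_form_def form_trace_def wedge_def)
    moreover have "\<omega> y vs = 0"
      using False poly_formsD(2,4)[OF \<omega>] by blast
    ultimately show ?thesis by simp
  qed
  then have "\<omega> = ?\<eta>" by (intro ext)
  moreover have "?\<eta> \<in> Q"
    by (intro sumQ scaleQ all) (auto simp: hom_exponents_def PiE_iff)
  ultimately show ?thesis by simp
qed


section \<open>The extension operators\<close>

text \<open>The linear map \<open>L\<^sub>\<alpha>\<close> from the tangent space of \<open>g\<close> to that of \<open>f\<close> along which \<open>d\<lambda>\<^sup>f\<^sub>i\<close> pulls back to
  \<open>\<psi>\<^sub>i\<close>. Hence the extension operator replaces each constant coefficient \<open>c\<^sub>\<alpha>\<close> by its pullback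
  along \<open>L\<^sub>\<alpha>\<close>.\<close>

definition psi_map ::
  "'a::euclidean_space list \<Rightarrow> (nat \<Rightarrow> nat) \<Rightarrow> 'a set \<Rightarrow> 'a set \<Rightarrow> 'a \<Rightarrow> 'a" where
  "psi_map xs \<alpha> f g v = (\<Sum>i\<in>vertex_indices xs f. psi xs \<alpha> f g i v *\<^sub>R xs ! i)"

definition extend_coeffs :: "'a::euclidean_space list \<Rightarrow> nat \<Rightarrow> nat \<Rightarrow> 'a set \<Rightarrow> 'a set \<Rightarrow>
    ((nat \<Rightarrow> nat) \<Rightarrow> 'a list \<Rightarrow> real) \<Rightarrow> 'a form" where
  "extend_coeffs xs k r f g c = (\<lambda>y vs. if y \<in> g then \<Sum>\<alpha>\<in>hom_exponents (vertex_indices xs f) r.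
     (\<Prod>i\<in>vertex_indices xs f. bary xs g i y ^ \<alpha> i) *
     (if length vs = k \<and> set vs \<subseteq> tangent g then c \<alpha> (map (psi_map xs \<alpha> f g) vs) else 0) else 0)"

text \<open>The weights \<open>\<alpha> i / r\<close> sum to 1, so the corrections together remove
  exactly the sum of the differentials. This is what puts the values of \<open>psi_map\<close> into
  the tangent space of f.\<close>

lemma psi_sum:
  assumes "sum \<alpha> (vertex_indices xs f) = r" "r \<ge> 1"
  shows "(\<Sum>i\<in>vertex_indices xs f. psi xs \<alpha> f g i v) = 0"
proof -
  have "(\<Sum>i\<in>vertex_indices xs f. real (\<alpha> i) / real r) = 1"
    using assms by (simp add: sum_divide_distrib[symmetric] flip: of_nat_sum)
  then show ?thesis using assms(1)
    by (simp add: psi_def sum_subtractf sum_distrib_right[symmetric] flip: sum_divide_distrib)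
qed

lemma psi_linear:
  assumes "numbered_simplex xs g" "f face_of g" "v \<in> tangent g" "w \<in> tangent g" "i \<in> vertex_indices xs f"
  shows "psi xs \<alpha> f g i (a *\<^sub>R v + b *\<^sub>R w) = a * psi xs \<alpha> f g i v + b * psi xs \<alpha> f g i w"
proof -
  have lin: "dbary xs g j (a *\<^sub>R v + b *\<^sub>R w) = a * dbary xs g j v + b * dbary xs g j w"
    if "j \<in> vertex_indices xs f" for j
    using that assms vertex_indices_face_subset[OF assms(2), of xs] by (intro dbary_linear) auto
  then have "(\<Sum>j\<in>vertex_indices xs f. dbary xs g j (a *\<^sub>R v + b *\<^sub>R w))
      = a * (\<Sum>j\<in>vertex_indices xs f. dbary xs g j v) + b * (\<Sum>j\<in>vertex_indices xs f. dbary xs g j w)"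
    by (simp add: sum.distrib sum_distrib_left)
  then show ?thesis unfolding psi_def lin[OF assms(5)] by (simp add: algebra_simps)
qed

lemma psi_map_tangent:
  assumes "numbered_simplex xs f" "sum \<alpha> (vertex_indices xs f) = r" "r \<ge> 1"
  shows "psi_map xs \<alpha> f g v \<in> tangent f"
  unfolding psi_map_def using assms by (intro combination_in_tangent psi_sum)

lemma dbary_psi_map:
  assumes "numbered_simplex xs f" "sum \<alpha> (vertex_indices xs f) = r" "r \<ge> 1" "i \<in> vertex_indices xs f"
  shows "dbary xs f i (psi_map xs \<alpha> f g v) = psi xs \<alpha> f g i v"
  unfolding psi_map_def using assms by (intro dbary_combination psi_sum)

lemma psi_map_linear:
  assumes "numbered_simplex xs g" "f face_of g" "v \<in> tangent g" "w \<in> tangent g"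
  shows "psi_map xs \<alpha> f g (a *\<^sub>R v + b *\<^sub>R w) = a *\<^sub>R psi_map xs \<alpha> f g v + b *\<^sub>R psi_map xs \<alpha> f g w"
  using psi_linear[OF assms]
  by (simp add: psi_map_def scaleR_add_left sum.distrib scaleR_sum_right)

lemma extend_coeffs_poly_forms:
  assumes g: "numbered_simplex xs g" and f: "f face_of g" "f \<noteq> {}" and r: "r \<ge> 1"
    and c: "has_coeffs xs k r f c \<omega>"
  shows "extend_coeffs xs k r f g c \<in> poly_forms r k g"
  unfolding extend_coeffs_def
proof (rule poly_forms_coefficient_sum)
  fix \<alpha> assume \<alpha>: "\<alpha> \<in> hom_exponents (vertex_indices xs f) r"
  then have s: "sum \<alpha> (vertex_indices xs f) = r" by (simp add: hom_exponents_def)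
  then show "\<exists>p\<in>poly_fun r. \<forall>y\<in>g. (\<Prod>i\<in>vertex_indices xs f. bary xs g i y ^ \<alpha> i) = p y"
    by (intro bary_monomial_poly[OF g]) auto
  show "alternating k (tangent g)
      (\<lambda>vs. if length vs = k \<and> set vs \<subseteq> tangent g then c \<alpha> (map (psi_map xs \<alpha> f g) vs) else 0)"
    using c by (intro alternating_pullback[where V = "tangent f"] subspace_tangent
        psi_map_tangent[OF numbered_simplex_face[OF g f] s r] psi_map_linear[OF g f(1)])
      (auto simp: has_coeffs_def)
qed

lemma extend_coeffs_lincomb:
  "extend_coeffs xs k r f g (\<lambda>\<alpha> vs. a * c \<alpha> vs + b * d \<alpha> vs)
    = (\<lambda>y vs. a * extend_coeffs xs k r f g c y vs + b * extend_coeffs xs k r f g d y vs)"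
proof -
  have "(if P then a * s + b * t else 0) = a * (if P then s else 0) + b * (if P then t else 0)"
    for P and s t :: real by simp
  then show ?thesis
    unfolding extend_coeffs_def
    by (simp add: fun_eq_iff distrib_left sum.distrib sum_distrib_left mult.left_commute)
qed

lemma psi_cong:
  assumes "\<And>j. j \<in> vertex_indices xs f \<Longrightarrow> \<alpha> j = \<beta> j" "i \<in> vertex_indices xs f"
  shows "psi xs \<alpha> f g i = psi xs \<beta> f g i"
  using assms by (auto simp: psi_def fun_eq_iff cong: sum.cong)

text \<open>By uniqueness, c consists of one wedge product of differentials. Pulling it back along
  \<open>psi_map\<close> acts on each factor, and \<open>dbary_psi_map\<close> turns it into the
  corresponding \<open>psi\<close>.\<close>

lemma extend_coeffs_bary_form:
  assumes g: "numbered_simplex xs g" and f: "f face_of g" "f \<noteq> {}" and r: "r \<ge> 1"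
    and \<alpha>: "sum \<alpha> (vertex_indices xs f) = r" and \<sigma>: "\<sigma> ` {..<k} \<subseteq> vertex_indices xs f"
    and c: "has_coeffs xs k r f c (bary_form xs k f \<alpha> \<sigma>)"
  shows "extend_coeffs xs k r f g c = psi_form xs k f g \<alpha> \<sigma>"
proof (intro ext)
  fix y vs
  let ?I = "vertex_indices xs f"
  let ?a = "\<lambda>i. if i \<in> ?I then \<alpha> i else 0"
  let ?w = "\<lambda>vs. if set vs \<subseteq> tangent f then wedge k (\<lambda>m. dbary xs f (\<sigma> m)) vs else 0"
  note nf = numbered_simplex_face[OF g f]
  have ceq: "c = (\<lambda>\<beta>. if \<beta> = ?a then ?w else (\<lambda>vs. 0))"
    using has_coeffs_unique[OF nf c has_coeffs_bary_form[OF nf \<alpha>, of k \<sigma>]] \<sigma> by auto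
  have A: "?a \<in> hom_exponents ?I r" using \<alpha> by (simp add: hom_exponents_def)
  have s: "sum ?a ?I = r" using \<alpha> by simp
  show "extend_coeffs xs k r f g c y vs = psi_form xs k f g \<alpha> \<sigma> y vs"
  proof (cases "y \<in> g \<and> length vs = k \<and> set vs \<subseteq> tangent g")
    case True
    have tan: "set (map (psi_map xs ?a f g) vs) \<subseteq> tangent f"
      using psi_map_tangent[OF nf s r] by auto
    have "extend_coeffs xs k r f g c y vs = (\<Sum>\<beta>\<in>hom_exponents ?I r. if \<beta> = ?a then
        (\<Prod>i\<in>?I. bary xs g i y ^ ?a i) * ?w (map (psi_map xs ?a f g) vs) else 0)"
      unfolding extend_coeffs_def using True by (simp only: ceq if_True) (intro sum.cong, auto)
    also have "\<dots> = (\<Prod>i\<in>?I. bary xs g i y ^ ?a i) * ?w (map (psi_map xs ?a f g) vs)"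
      using A by (simp add: finite_hom_exponents)
    also have "\<dots> = (\<Prod>i\<in>?I. bary xs g i y ^ \<alpha> i) * wedge k (\<lambda>m v. dbary xs f (\<sigma> m) (psi_map xs ?a f g v)) vs"
      using tan by (simp only: if_True wedge_map) simp
    also have "wedge k (\<lambda>m v. dbary xs f (\<sigma> m) (psi_map xs ?a f g v)) vs = wedge k (\<lambda>m. psi xs \<alpha> f g (\<sigma> m)) vs"
    proof (rule wedge_cong)
      fix m v assume "m < k"
      then have "\<sigma> m \<in> ?I" using \<sigma> by auto
      then show "dbary xs f (\<sigma> m) (psi_map xs ?a f g v) = psi xs \<alpha> f g (\<sigma> m) v"
        using psi_cong[of xs f ?a \<alpha> "\<sigma> m" g] by (simp add: dbary_psi_map[OF nf s r])
    qed
    finally show ?thesis using True by (simp add: psi_form_def form_trace_def)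
  next
    case False
    then show ?thesis by (auto simp: extend_coeffs_def psi_form_def form_trace_def wedge_def)
  qed
qed

text \<open>Resolves the definite description. Extending coefficients is well defined because the
  coefficients of a form are unique, and it satisfies all the clauses. Any two candidates agree on
  the generators, hence on the space they span, and both are 0 outside it.\<close>

lemma ext_op_eq:
  assumes g: "numbered_simplex xs g" and f: "f face_of g" "f \<noteq> {}" and r: "r \<ge> 1"
    and c: "has_coeffs xs k r f c \<omega>"
  shows "ext_op xs k r f g \<omega> = extend_coeffs xs k r f g c"
proof -
  note nf = numbered_simplex_face[OF g f]
  let ?P = "\<lambda>E. (\<forall>\<omega>\<in>poly_forms r k f. E \<omega> \<in> poly_forms r k g) \<and>
     (\<forall>\<omega>\<in>poly_forms r k f. \<forall>\<eta>\<in>poly_forms r k f. \<forall>a b.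
        E (\<lambda>y vs. a * \<omega> y vs + b * \<eta> y vs) = (\<lambda>y vs. a * E \<omega> y vs + b * E \<eta> y vs)) \<and>
     (\<forall>\<alpha> \<sigma>. (\<Sum>i\<in>vertex_indices xs f. \<alpha> i) = r \<and>
        strict_mono_on {..<k} \<sigma> \<and> \<sigma> ` {..<k} \<subseteq> vertex_indices xs f \<longrightarrow>
        E (bary_form xs k f \<alpha> \<sigma>) = psi_form xs k f g \<alpha> \<sigma>) \<and>
     (\<forall>\<omega>. \<omega> \<notin> poly_forms r k f \<longrightarrow> E \<omega> = (\<lambda>y vs. 0))"
  define C where "C \<omega> = (SOME c. has_coeffs xs k r f c \<omega>)" for \<omega>
  have C: "has_coeffs xs k r f (C \<omega>) \<omega>" if "\<omega> \<in> poly_forms r k f" for \<omega>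
    unfolding C_def using poly_forms_has_coeffs[OF nf that] by (rule someI_ex)
  define E where "E \<omega> = (if \<omega> \<in> poly_forms r k f then extend_coeffs xs k r f g (C \<omega>) else (\<lambda>y vs. 0))" for \<omega>
  have E: "E \<omega> = extend_coeffs xs k r f g c" if "has_coeffs xs k r f c \<omega>" for c \<omega>
    using that has_coeffs_poly_forms[OF nf that] has_coeffs_unique[OF nf that C] by (simp add: E_def)
  have PE: "?P E"
  proof (intro conjI ballI allI impI)
    show "E \<omega> \<in> poly_forms r k g" if "\<omega> \<in> poly_forms r k f" for \<omega>
      using extend_coeffs_poly_forms[OF g f r C[OF that]] E[OF C[OF that]] by simp
    show "E (\<lambda>y vs. a * \<omega> y vs + b * \<eta> y vs) = (\<lambda>y vs. a * E \<omega> y vs + b * E \<eta> y vs)"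
      if "\<omega> \<in> poly_forms r k f" "\<eta> \<in> poly_forms r k f" for \<omega> \<eta> a b
      using E[OF has_coeffs_lincomb[OF C[OF that(1)] C[OF that(2)]]] E[OF C[OF that(1)]] E[OF C[OF that(2)]]
      by (simp add: extend_coeffs_lincomb)
    show "E (bary_form xs k f \<alpha> \<sigma>) = psi_form xs k f g \<alpha> \<sigma>"
      if "sum \<alpha> (vertex_indices xs f) = r \<and> strict_mono_on {..<k} \<sigma> \<and> \<sigma> ` {..<k} \<subseteq> vertex_indices xs f" for \<alpha> \<sigma>
    proof -
      have hc: "has_coeffs xs k r f (\<lambda>\<beta>. if \<beta> = (\<lambda>i. if i \<in> vertex_indices xs f then \<alpha> i else 0)
      then (\<lambda>vs. if set vs \<subseteq> tangent f then wedge k (\<lambda>m. dbary xs f (\<sigma> m)) vs else 0) else (\<lambda>vs. 0))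
    (bary_form xs k f \<alpha> \<sigma>)"
        using that by (intro has_coeffs_bary_form[OF nf]) auto
      show ?thesis using E[OF hc] extend_coeffs_bary_form[OF g f r _ _ hc] that by simp
    qed
  qed (simp add: E_def)
  have uniq: "E' = E" if PE': "?P E'" for E'
  proof
    fix \<omega>
    show "E' \<omega> = E \<omega>"
    proof (cases "\<omega> \<in> poly_forms r k f")
      case True
      \<comment> \<open>Linearity with both factors 0 fixes the value at the zero form.\<close>
      have zero: "F (\<lambda>y vs. 0) = (\<lambda>y vs. 0)" if "?P F" for F
      proof -
        have "F (\<lambda>y vs. a * \<omega> y vs + b * \<eta> y vs) = (\<lambda>y vs. a * F \<omega> y vs + b * F \<eta> y vs)"
          if "\<omega> \<in> poly_forms r k f" "\<eta> \<in> poly_forms r k f" for \<omega> \<eta> a b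
          using conjunct1[OF conjunct2[OF \<open>?P F\<close>]] that by blast
        from this[OF poly_forms_zero poly_forms_zero, of 0 0]
        show ?thesis by simp
      qed
      have "\<omega> \<in> {\<omega> \<in> poly_forms r k f. E' \<omega> = E \<omega>}"
      proof (rule poly_forms_spanned[OF nf True])
        show "(\<lambda>y vs. 0) \<in> {\<omega> \<in> poly_forms r k f. E' \<omega> = E \<omega>}"
          using zero[OF PE] zero[OF PE'] poly_forms_zero by simp
      next
        fix \<omega> \<eta> and a b :: real
        assume "\<omega> \<in> {\<omega> \<in> poly_forms r k f. E' \<omega> = E \<omega>}" "\<eta> \<in> {\<omega> \<in> poly_forms r k f. E' \<omega> = E \<omega>}"
        then have m: "\<omega> \<in> poly_forms r k f" "\<eta> \<in> poly_forms r k f" "E' \<omega> = E \<omega>" "E' \<eta> = E \<eta>" by auto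
        have "E' (\<lambda>y vs. a * \<omega> y vs + b * \<eta> y vs) = (\<lambda>y vs. a * E' \<omega> y vs + b * E' \<eta> y vs)"
          using PE' m(1,2) by blast
        moreover have "E (\<lambda>y vs. a * \<omega> y vs + b * \<eta> y vs) = (\<lambda>y vs. a * E \<omega> y vs + b * E \<eta> y vs)"
          using PE m(1,2) by blast
        ultimately show "(\<lambda>y vs. a * \<omega> y vs + b * \<eta> y vs) \<in> {\<omega> \<in> poly_forms r k f. E' \<omega> = E \<omega>}"
          using m poly_forms_lincomb[OF m(1,2)] by simp
      next
        fix \<alpha> \<sigma>
        assume h: "sum \<alpha> (vertex_indices xs f) = r" "strict_mono_on {..<k} \<sigma>" "\<sigma> ` {..<k} \<subseteq> vertex_indices xs f"
        then have "bary_form xs k f \<alpha> \<sigma> \<in> poly_forms r k f"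
          by (intro has_coeffs_poly_forms[OF nf has_coeffs_bary_form[OF nf]]) auto
        moreover have "E' (bary_form xs k f \<alpha> \<sigma>) = psi_form xs k f g \<alpha> \<sigma>" using PE' h by blast
        moreover have "E (bary_form xs k f \<alpha> \<sigma>) = psi_form xs k f g \<alpha> \<sigma>" using PE h by blast
        ultimately show "bary_form xs k f \<alpha> \<sigma> \<in> {\<omega> \<in> poly_forms r k f. E' \<omega> = E \<omega>}" by simp
      qed
      then show ?thesis by simp
    next
      case False
      then show ?thesis using PE PE' by metis
    qed
  qed
  have "ext_op xs k r f g = E"
    unfolding ext_op_def using PE uniq by (rule the_equality)
  then show ?thesis using E[OF c] by simp
qed

subsection \<open>Traces of extensions\<close>

lemma psi_face:
  assumes g: "numbered_simplex xs g" and h: "h face_of g" "h \<noteq> {}" and f: "f face_of h"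
    and v: "v \<in> tangent h" and i: "i \<in> vertex_indices xs f"
  shows "psi xs \<alpha> f g i v = psi xs \<alpha> f h i v"
proof -
  have "dbary xs g j v = dbary xs h j v" if "j \<in> vertex_indices xs f" for j
  proof -
    have "j \<in> vertex_indices xs h" "j \<in> vertex_indices xs g"
      using that vertex_indices_face_subset[OF f, of xs] vertex_indices_face_subset[OF h(1), of xs] by auto
    then show ?thesis using dbary_face[OF g h v, of j] by simp
  qed
  then show ?thesis using i by (simp add: psi_def)
qed

text \<open>For vertices of f, the coordinates and differentials of g and of h agree on h, so both
  extensions are the same expression in the same coefficients c.\<close>

lemma extend_coeffs_trace:
  assumes g: "numbered_simplex xs g" and h: "h face_of g" "h \<noteq> {}" and f: "f face_of h"
  shows "form_trace h (extend_coeffs xs k r f g c) = extend_coeffs xs k r f h c"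
proof (intro ext)
  fix y vs
  have hg: "h \<subseteq> g" using h(1) face_of_imp_subset by blast
  show "form_trace h (extend_coeffs xs k r f g c) y vs = extend_coeffs xs k r f h c y vs"
  proof (cases "y \<in> h \<and> length vs = k \<and> set vs \<subseteq> tangent h")
    case True
    have "psi_map xs \<alpha> f g v = psi_map xs \<alpha> f h v" if "v \<in> set vs" for \<alpha> v
      using True that psi_face[OF g h f] by (auto simp: psi_map_def)
    then have m: "map (psi_map xs \<alpha> f g) vs = map (psi_map xs \<alpha> f h) vs" for \<alpha> by simp
    have b: "bary xs g i y = bary xs h i y" if "i \<in> vertex_indices xs f" for i
    proof -
      have "i \<in> vertex_indices xs h" "i \<in> vertex_indices xs g"
        using that vertex_indices_face_subset[OF f, of xs] vertex_indices_face_subset[OF h(1), of xs] by auto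
      then show ?thesis using True bary_face[OF g h, of y i] by (simp add: hull_inc)
    qed
    have "y \<in> g" "set vs \<subseteq> tangent g" using True hg tangent_mono[OF hg] by auto
    moreover have "c \<alpha> (map (psi_map xs \<alpha> f g) vs) = c \<alpha> (map (psi_map xs \<alpha> f h) vs)" for \<alpha>
      by (simp only: m)
    ultimately show ?thesis using True b by (simp add: form_trace_def extend_coeffs_def cong: prod.cong)
  qed (auto simp: form_trace_def extend_coeffs_def)
qed

text \<open>On tangent vectors of f itself the differentials sum to 0, so the correction in
  \<open>psi\<close> disappears.\<close>

lemma psi_map_self:
  assumes nf: "numbered_simplex xs f" and v: "v \<in> tangent f"
  shows "psi_map xs \<alpha> f f v = v"
  using dbary_representation[OF nf v] by (simp add: psi_map_def psi_def)

lemma extend_coeffs_self: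
  assumes nf: "numbered_simplex xs f" and c: "has_coeffs xs k r f c \<omega>"
  shows "extend_coeffs xs k r f f c = \<omega>"
proof (intro ext)
  fix y vs
  have eq: "\<omega> y vs = (if y \<in> f then \<Sum>\<alpha>\<in>hom_exponents (vertex_indices xs f) r.
       (\<Prod>i\<in>vertex_indices xs f. bary xs f i y ^ \<alpha> i) * c \<alpha> vs else 0)"
    using c by (simp add: has_coeffs_def)
  show "extend_coeffs xs k r f f c y vs = \<omega> y vs"
  proof (cases "length vs = k \<and> set vs \<subseteq> tangent f")
    case True
    then have "map (psi_map xs \<alpha> f f) vs = vs" for \<alpha>
      using psi_map_self[OF nf] by (intro map_idI) auto
    then show ?thesis unfolding eq using True by (simp add: extend_coeffs_def)
  next
    case False
    then have "c \<alpha> vs = 0" for \<alpha>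
      using c alternating_outside[of k "tangent f" "c \<alpha>" vs] by (auto simp: has_coeffs_def)
    then show ?thesis unfolding eq extend_coeffs_def if_not_P[OF False] by simp
  qed
qed

text \<open>The monomials that involve a vertex outside \<open>e\<close> vanish on \<open>e\<close>, and the others are independent
  there.\<close>

lemma coeffs_zero_on_face:
  assumes nf: "numbered_simplex xs f" and e: "e face_of f" "e \<noteq> {}"
    and c: "has_coeffs xs k r f c \<mu>" and tr: "form_trace e \<mu> = (\<lambda>y vs. 0)"
    and \<alpha>: "\<alpha> \<in> hom_exponents (vertex_indices xs e) r" and vs: "set vs \<subseteq> tangent e"
  shows "c \<alpha> vs = 0"
proof (rule bary_monomials_independent[OF numbered_simplex_face[OF nf e] \<alpha>, where d = "\<lambda>\<alpha>. c \<alpha> vs"])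
  fix y assume y: "y \<in> e"
  let ?If = "vertex_indices xs f" and ?Ie = "vertex_indices xs e"
  have yf: "y \<in> f" using y e face_of_imp_subset by blast
  have sub: "?Ie \<subseteq> ?If" using e by (simp add: vertex_indices_face_subset)
  have b: "bary xs f i y = (if i \<in> ?Ie then bary xs e i y else 0)" if "i \<in> ?If" for i
    using bary_face[OF nf e _ that] y by (simp add: hull_inc)
  have "hom_exponents ?Ie r \<subseteq> hom_exponents ?If r"
  proof
    fix \<beta> assume \<beta>: "\<beta> \<in> hom_exponents ?Ie r"
    have "sum \<beta> ?If = sum \<beta> ?Ie"
      using \<beta> sub by (intro sum.mono_neutral_right) (auto simp: hom_exponents_def)
    then show "\<beta> \<in> hom_exponents ?If r" using \<beta> sub by (auto simp: hom_exponents_def)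
  qed
  moreover have "(\<Prod>i\<in>?If. bary xs f i y ^ \<beta> i) = 0" if "\<beta> \<in> hom_exponents ?If r - hom_exponents ?Ie r" for \<beta>
  proof -
    have "\<exists>i\<in>?If - ?Ie. \<beta> i \<noteq> 0"
    proof (rule ccontr)
      assume n: "\<not> (\<exists>i\<in>?If - ?Ie. \<beta> i \<noteq> 0)"
      then have "sum \<beta> ?If = sum \<beta> ?Ie" using sub by (intro sum.mono_neutral_right) auto
      moreover have "\<beta> b = 0" if "b \<notin> ?Ie" for b
        using that n \<open>\<beta> \<in> hom_exponents ?If r - _\<close> by (cases "b \<in> ?If") (auto simp: hom_exponents_def)
      ultimately show False using that by (auto simp: hom_exponents_def)
    qed
    then show ?thesis using b by (intro prod_zero) auto
  qed
  moreover have "(\<Prod>i\<in>?If. bary xs f i y ^ \<beta> i) = (\<Prod>i\<in>?Ie. bary xs e i y ^ \<beta> i)"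
    if "\<beta> \<in> hom_exponents ?Ie r" for \<beta>
  proof -
    have "(\<Prod>i\<in>?If. bary xs f i y ^ \<beta> i) = (\<Prod>i\<in>?Ie. bary xs f i y ^ \<beta> i)"
      using that sub by (intro prod.mono_neutral_right) (auto simp: hom_exponents_def)
    also have "\<dots> = (\<Prod>i\<in>?Ie. bary xs e i y ^ \<beta> i)" using b sub by (intro prod.cong) auto
    finally show ?thesis .
  qed
  ultimately have "(\<Sum>\<beta>\<in>hom_exponents ?Ie r. (\<Prod>i\<in>?Ie. bary xs e i y ^ \<beta> i) * c \<beta> vs)
      = (\<Sum>\<beta>\<in>hom_exponents ?If r. (\<Prod>i\<in>?If. bary xs f i y ^ \<beta> i) * c \<beta> vs)"
    by (intro sum.mono_neutral_cong_left) (auto simp: finite_hom_exponents)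
  also have "\<dots> = \<mu> y vs" using c yf by (simp add: has_coeffs_def)
  also have "\<dots> = 0" using fun_cong[OF fun_cong[OF tr, of y], of vs] y vs by (simp add: form_trace_def)
  finally show "(\<Sum>\<beta>\<in>hom_exponents ?Ie r. (\<Prod>i\<in>?Ie. bary xs e i y ^ \<beta> i) * c \<beta> vs) = 0" .
qed

lemma extend_coeffs_trace_zero:
  assumes g: "numbered_simplex xs g" and f: "f face_of g" "f \<noteq> {}" and h: "h face_of g" "h \<noteq> {}"
    and nsub: "\<not> f \<subseteq> h" and r: "r \<ge> 1"
    and c: "has_coeffs xs k r f c \<mu>" and \<mu>: "\<mu> \<in> poly_forms0 r k f"
  shows "form_trace h (extend_coeffs xs k r f g c) = (\<lambda>y vs. 0)"
proof (intro ext)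
  fix y vs
  let ?If = "vertex_indices xs f" and ?Ih = "vertex_indices xs h" and ?e = "f \<inter> h"
  note nf = numbered_simplex_face[OF g f]
  have e_g: "?e face_of g" using f h by (simp add: face_of_Int)
  have e_f: "?e face_of f" using e_g f face_of_imp_subset by (metis Int_lower1 face_of_subset)
  have Ie: "vertex_indices xs ?e = ?If \<inter> ?Ih"
    using f(1) h(1) e_g by (auto simp: vertex_indices_face)
  show "form_trace h (extend_coeffs xs k r f g c) y vs = 0"
  proof (cases "y \<in> h \<and> length vs = k \<and> set vs \<subseteq> tangent h")
    case True
    have "(\<Prod>i\<in>?If. bary xs g i y ^ \<alpha> i) * c \<alpha> (map (psi_map xs \<alpha> f g) vs) = 0"
      if \<alpha>: "\<alpha> \<in> hom_exponents ?If r" for \<alpha>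
    proof (cases "\<exists>i\<in>?If - ?Ih. \<alpha> i \<noteq> 0")
      \<comment> \<open>The monomial contains the coordinate of a vertex outside h, which is zero on
        h.\<close>
      case True': True
      then obtain i where i: "i \<in> ?If - ?Ih" "\<alpha> i \<noteq> 0" by blast
      then have "i \<in> vertex_indices xs g" using vertex_indices_face_subset[OF f(1), of xs] by auto
      then have "bary xs g i y = 0" using bary_face[OF g h] True i by (simp add: hull_inc)
      with i have "(\<Prod>i\<in>?If. bary xs g i y ^ \<alpha> i) = 0" by (intro prod_zero) auto
      then show ?thesis by simp
    next
      case False
      have s: "sum \<alpha> ?If = r" using \<alpha> by (simp add: hom_exponents_def)
      \<comment> \<open>Degree r \<ge> 1 forces a positive exponent somewhere; by the case
        assumption its vertex belongs to both f and h, so f \<inter> h is not empty.\<close>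
      then have "sum \<alpha> ?If \<noteq> 0" using r by simp
      then obtain i where "i \<in> ?If" "\<alpha> i \<noteq> 0" by (meson sum.neutral)
      with False have "xs ! i \<in> ?e" using vertex_in_simplex by blast
      then have ne: "?e \<noteq> {}" by blast
      have "sum \<alpha> (vertex_indices xs ?e) = sum \<alpha> ?If"
        unfolding Ie using False by (intro sum.mono_neutral_left) auto
      then have \<alpha>e: "\<alpha> \<in> hom_exponents (vertex_indices xs ?e) r"
        using \<alpha> False by (auto simp: hom_exponents_def Ie)
      have "psi_map xs \<alpha> f g v \<in> tangent ?e" if v: "v \<in> tangent h" for v
      proof -
        \<comment> \<open>At a vertex outside h the exponent is 0, so \<open>psi\<close> has no
          correction there and reduces to a differential that is zero along h.\<close>
        have z: "psi xs \<alpha> f g i v = 0" if i: "i \<in> ?If - ?Ih" for i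
        proof -
          have "i \<in> vertex_indices xs g" using i vertex_indices_face_subset[OF f(1), of xs] by auto
          then have "dbary xs g i v = 0" using dbary_face[OF g h v] i by simp
          then show ?thesis using i False by (simp add: psi_def)
        qed
        have "psi_map xs \<alpha> f g v = (\<Sum>i\<in>vertex_indices xs ?e. psi xs \<alpha> f g i v *\<^sub>R xs ! i)"
          unfolding psi_map_def Ie using z by (intro sum.mono_neutral_right) auto
        moreover have "(\<Sum>i\<in>vertex_indices xs ?e. psi xs \<alpha> f g i v) = 0"
        proof -
          have "(\<Sum>i\<in>vertex_indices xs ?e. psi xs \<alpha> f g i v) = (\<Sum>i\<in>?If. psi xs \<alpha> f g i v)"
            unfolding Ie using z by (intro sum.mono_neutral_left) auto
          then show ?thesis using psi_sum[OF s r] by simp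
        qed
        ultimately show ?thesis
          using combination_in_tangent[OF numbered_simplex_face[OF g e_g ne]] by simp
      qed
      then have tan: "set (map (psi_map xs \<alpha> f g) vs) \<subseteq> tangent ?e" using True by auto
      \<comment> \<open>f \<inter> h is a proper face of f, because f is not contained in h.\<close>
      have "form_trace ?e \<mu> = (\<lambda>y vs. 0)"
        using \<mu> e_f ne nsub unfolding poly_forms0_def by blast
      then have "c \<alpha> (map (psi_map xs \<alpha> f g) vs) = 0"
        using coeffs_zero_on_face[OF nf e_f ne c _ \<alpha>e tan] by simp
      then show ?thesis by simp
    qed
    then have "(\<Sum>\<alpha>\<in>hom_exponents ?If r. (\<Prod>i\<in>?If. bary xs g i y ^ \<alpha> i) * c \<alpha> (map (psi_map xs \<alpha> f g) vs)) = 0"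
      by (intro sum.neutral) blast
    moreover have "set vs \<subseteq> tangent g"
      using True tangent_mono[OF face_of_imp_subset[OF h(1)]] by blast
    ultimately show ?thesis using True by (simp add: form_trace_def extend_coeffs_def)
  qed (auto simp: form_trace_def extend_coeffs_def)
qed

section \<open>The coefficient formulas restated for \<open>ext_op\<close>\<close>

lemma ext_op_poly_forms:
  assumes "numbered_simplex xs g" "f face_of g" "f \<noteq> {}" "r \<ge> 1" "\<mu> \<in> poly_forms r k f"
  shows "ext_op xs k r f g \<mu> \<in> poly_forms r k g"
  using poly_forms_has_coeffs[OF numbered_simplex_face[OF assms(1-3)] assms(5)]
    ext_op_eq[OF assms(1-4)] extend_coeffs_poly_forms[OF assms(1-4)] by force

lemma ext_op_lincomb:
  assumes "numbered_simplex xs g" "f face_of g" "f \<noteq> {}" "r \<ge> 1"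
    and "\<mu> \<in> poly_forms r k f" "\<nu> \<in> poly_forms r k f"
  shows "ext_op xs k r f g (\<lambda>y vs. a * \<mu> y vs + b * \<nu> y vs)
    = (\<lambda>y vs. a * ext_op xs k r f g \<mu> y vs + b * ext_op xs k r f g \<nu> y vs)"
proof -
  note nf = numbered_simplex_face[OF assms(1-3)]
  obtain c d where c: "has_coeffs xs k r f c \<mu>" and d: "has_coeffs xs k r f d \<nu>"
    using poly_forms_has_coeffs[OF nf assms(5)] poly_forms_has_coeffs[OF nf assms(6)] by blast
  show ?thesis
    using ext_op_eq[OF assms(1-4) c] ext_op_eq[OF assms(1-4) d]
      ext_op_eq[OF assms(1-4) has_coeffs_lincomb[OF c d]] by (simp add: extend_coeffs_lincomb)
qed

lemma ext_op_trace:
  assumes g: "numbered_simplex xs g" and h: "h face_of g" and f: "f face_of h" "f \<noteq> {}"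
    and r: "r \<ge> 1" and \<mu>: "\<mu> \<in> poly_forms r k f"
  shows "form_trace h (ext_op xs k r f g \<mu>) = ext_op xs k r f h \<mu>"
proof -
  have hne: "h \<noteq> {}" using f face_of_imp_subset by blast
  note nh = numbered_simplex_face[OF g h hne]
  have fg: "f face_of g" using f(1) h by (rule face_of_trans)
  obtain c where c: "has_coeffs xs k r f c \<mu>"
    using poly_forms_has_coeffs[OF numbered_simplex_face[OF nh f] \<mu>] by blast
  show ?thesis
    using ext_op_eq[OF g fg f(2) r c] ext_op_eq[OF nh f r c] extend_coeffs_trace[OF g h hne f(1)] by simp
qed

lemma ext_op_self:
  assumes nf: "numbered_simplex xs f" and r: "r \<ge> 1" and \<mu>: "\<mu> \<in> poly_forms r k f"
  shows "ext_op xs k r f f \<mu> = \<mu>"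
proof -
  have ff: "f face_of f" "f \<noteq> {}"
    using nf numbered_simplex_vertices(2)[OF nf] convex_convex_hull face_of_refl
    by (metis, simp add: numbered_simplex_def)
  obtain c where c: "has_coeffs xs k r f c \<mu>" using poly_forms_has_coeffs[OF nf \<mu>] by blast
  show ?thesis using ext_op_eq[OF nf ff r c] extend_coeffs_self[OF nf c] by simp
qed

lemma ext_op_trace_zero:
  assumes "numbered_simplex xs g" "f face_of g" "f \<noteq> {}" "h face_of g" "h \<noteq> {}" "\<not> f \<subseteq> h" "r \<ge> 1"
    and \<mu>: "\<mu> \<in> poly_forms0 r k f"
  shows "form_trace h (ext_op xs k r f g \<mu>) = (\<lambda>y vs. 0)"
proof -
  have "\<mu> \<in> poly_forms r k f" using \<mu> by (simp add: poly_forms0_def)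
  then obtain c where c: "has_coeffs xs k r f c \<mu>"
    using poly_forms_has_coeffs[OF numbered_simplex_face[OF assms(1-3)]] by blast
  show ?thesis
    using ext_op_eq[OF assms(1-3,7) c] extend_coeffs_trace_zero[OF assms(1-7) c \<mu>] by simp
qed


section \<open>Decomposition of compatible families\<close>

lemma form_trace_form_trace: "e \<subseteq> h \<Longrightarrow> form_trace e (form_trace h \<omega>) = form_trace e \<omega>"
  using tangent_mono[of e h] by (auto simp: form_trace_def fun_eq_iff)

lemma form_trace_poly_forms:
  assumes \<omega>: "\<omega> \<in> poly_forms r k g" and sub: "h \<subseteq> g"
  shows "form_trace h \<omega> \<in> poly_forms r k h"
  unfolding poly_forms_def
proof (intro CollectI conjI ballI allI impI)
  note tan = tangent_mono[OF sub]
  show "alternating k (tangent h) (form_trace h \<omega> y)" if "y \<in> h" for y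
    using alternating_restrict[OF poly_formsD(1)[OF \<omega>] subspace_tangent tan, of y] that sub
    by (auto simp: form_trace_def)
  show "form_trace h \<omega> y = (\<lambda>vs. 0)" if "y \<notin> h" for y using that by (simp add: form_trace_def)
  fix vs assume vs: "length vs = k \<and> set vs \<subseteq> tangent h"
  with tan obtain p where "p \<in> poly_fun r" "\<forall>y\<in>g. \<omega> y vs = p y"
    using poly_formsD(3)[OF \<omega>, of vs] by blast
  then show "\<exists>p\<in>poly_fun r. \<forall>y\<in>h. form_trace h \<omega> y vs = p y"
    using vs sub by (intro bexI[of _ p]) (auto simp: form_trace_def)
qed

lemma form_trace_self:
  assumes "\<omega> \<in> poly_forms r k g"
  shows "form_trace g \<omega> = \<omega>"
proof (intro ext)
  fix y vs
  show "form_trace g \<omega> y vs = \<omega> y vs"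
    using poly_formsD(2)[OF assms, of y vs] poly_formsD(4)[OF assms, of vs y]
    by (cases "y \<in> g"; cases "set vs \<subseteq> tangent g") (simp_all add: form_trace_def)
qed

lemma form_trace_sum:
  "form_trace h (\<lambda>y vs. \<Sum>i\<in>J. \<omega> i y vs) = (\<lambda>y vs. \<Sum>i\<in>J. form_trace h (\<omega> i) y vs)"
proof (intro ext)
  fix y vs
  show "form_trace h (\<lambda>y vs. \<Sum>i\<in>J. \<omega> i y vs) y vs = (\<Sum>i\<in>J. form_trace h (\<omega> i) y vs)"
    by (cases "y \<in> h"; cases "set vs \<subseteq> tangent h") (simp_all add: form_trace_def)
qed

text \<open>The edges from one vertex span the tangent space and number fewer than k, so alternating
  functions of k vectors vanish. This removes the faces of dimension below k both from the
  decomposition and from the trace conditions.\<close>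

lemma poly_forms_low_dim:
  assumes nf: "numbered_simplex xs f" and dim: "aff_dim f < int k" and \<omega>: "\<omega> \<in> poly_forms r k f"
  shows "\<omega> = (\<lambda>y vs. 0)"
proof (rule ext)
  fix y
  show "\<omega> y = (\<lambda>vs. 0)"
  proof (cases "y \<in> f")
    case True
    obtain i0 where i0: "i0 \<in> vertex_indices xs f" using numbered_simplex_vertices(4)[OF nf] by blast
    have "card (vertex_indices xs f - {i0}) < k"
    proof -
      have "card (vertex_indices xs f) > 0" using i0 by (auto simp: card_gt_0_iff)
      then show ?thesis using card_vertex_indices[OF nf] dim i0 by simp
    qed
    moreover have "xs ! i - xs ! i0 \<in> tangent f" if "i \<in> vertex_indices xs f - {i0}" for i
      using that i0 vertex_in_simplex unfolding tangent_def by (intro span_base) blast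
    ultimately show ?thesis
      by (intro alternating_eq_zero[OF poly_formsD(1)[OF \<omega> True] subspace_tangent _ _ _
            tangent_simplex_basis[OF nf i0]]) auto
  next
    case False
    then show ?thesis using poly_formsD(2)[OF \<omega> False] by blast
  qed
qed

lemma poly_forms0_subset: "\<mu> \<in> poly_forms0 r k f \<Longrightarrow> \<mu> \<in> poly_forms r k f"
  by (simp add: poly_forms0_def)

lemma poly_forms0_zero: "(\<lambda>y vs. 0) \<in> poly_forms0 r k f"
  by (simp add: poly_forms0_def poly_forms_zero form_trace_def)

lemma poly_forms0_lincomb:
  assumes "\<mu> \<in> poly_forms0 r k f" "\<nu> \<in> poly_forms0 r k f"
  shows "(\<lambda>y vs. a * \<mu> y vs + b * \<nu> y vs) \<in> poly_forms0 r k f"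
proof -
  have "form_trace e (\<lambda>y vs. a * \<mu> y vs + b * \<nu> y vs) = (\<lambda>y vs. a * form_trace e \<mu> y vs + b * form_trace e \<nu> y vs)" for e
    by (auto simp: form_trace_def fun_eq_iff)
  then show ?thesis using assms by (simp add: poly_forms0_def poly_forms_lincomb)
qed

lemma ext_op_zero:
  assumes "numbered_simplex xs g" "f face_of g" "f \<noteq> {}" "r \<ge> 1"
  shows "ext_op xs k r f g (\<lambda>y vs. 0) = (\<lambda>y vs. 0)"
  using ext_op_lincomb[OF assms poly_forms_zero poly_forms_zero, of k 0 0] by simp

text \<open>Only the combinatorics of faces enters here: there is no domain, and simplices may have
  any dimension from 0 on. Nonemptiness excludes the simplex of dimension -1, which
  \<open>triangulation\<close> admits.\<close>

locale numbered_triangulation =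
  fixes \<T> :: "'a::euclidean_space set set" and xs :: "'a list"
  assumes triangulation: "triangulation \<T>"
    and nonempty: "T \<in> \<T> \<Longrightarrow> T \<noteq> {}"
    and numbering: "vertex_numbering \<T> xs"
begin

lemma face_numbered_simplex:
  assumes "f \<in> faces \<T>"
  shows "numbered_simplex xs f"
proof -
  obtain T where T: "T \<in> \<T>" "f face_of T" "f \<noteq> {}" using assms by (auto simp: faces_def)
  have "numbered_simplex xs T"
    using T nonempty triangulation numbering
    by (auto simp: numbered_simplex_def triangulation_def vertex_numbering_def)
  then show ?thesis using T(2,3) by (rule numbered_simplex_face)
qed

lemma faces_nonempty: "f \<in> faces \<T> \<Longrightarrow> f \<noteq> {}"
  by (simp add: faces_def)

lemma face_convex:
  assumes "f \<in> faces \<T>"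
  shows "convex f"
  by (subst numbered_simplex_vertices(2)[OF face_numbered_simplex[OF assms]]) (rule convex_convex_hull)

lemma simplices_are_faces:
  assumes "T \<in> \<T>"
  shows "T \<in> faces \<T>"
proof -
  obtain n where "n simplex T" using assms triangulation unfolding triangulation_def by blast
  then have "T face_of T" using convex_simplex face_of_refl by blast
  then show ?thesis using assms nonempty unfolding faces_def by blast
qed

lemma finite_faces: "finite (faces \<T>)"
proof -
  have "faces \<T> \<subseteq> (\<Union>T\<in>\<T>. {f. f face_of T})" by (auto simp: faces_def)
  moreover have "finite (\<Union>T\<in>\<T>. {f. f face_of T})"
  proof (intro finite_UN_I)
    show "finite \<T>" using triangulation by (simp add: triangulation_def)
    show "finite {f. f face_of T}" if "T \<in> \<T>" for T
      using that triangulation simplex_imp_polytope unfolding triangulation_def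
      by (blast intro: finite_polytope_faces)
  qed
  ultimately show ?thesis by (rule finite_subset)
qed

text \<open>f lies in T \<inter> T', which is a face of T', so f is a face of T' and hence of h.
  Inclusion can therefore serve as the face relation, even between faces of different
  simplices.\<close>

lemma faces_subset_face_of:
  assumes "f \<in> faces \<T>" "h \<in> faces \<T>" "f \<subseteq> h"
  shows "f face_of h"
proof -
  obtain T where T: "T \<in> \<T>" "f face_of T" using assms(1) by (auto simp: faces_def)
  obtain T' where T': "T' \<in> \<T>" "h face_of T'" using assms(2) by (auto simp: faces_def)
  have "f \<subseteq> T \<inter> T'" using T T' assms(3) face_of_imp_subset by blast
  then have "f face_of T \<inter> T'" using T(2) by (meson Int_lower1 face_of_subset)
  moreover have "(T \<inter> T') face_of T'"
    using T T' triangulation unfolding triangulation_def by (metis Int_commute)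
  ultimately have "f face_of T'" by (rule face_of_trans)
  then show ?thesis using assms(3) face_of_imp_subset[OF T'(2)] by (rule face_of_subset)
qed

lemma faces_closed:
  assumes "h \<in> faces \<T>" "e face_of h" "e \<noteq> {}"
  shows "e \<in> faces \<T>"
proof -
  obtain T where "T \<in> \<T>" "h face_of T" using assms(1) by (auto simp: faces_def)
  then show ?thesis using face_of_trans[OF assms(2)] assms(3) by (auto simp: faces_def)
qed

lemma faces_psubset_aff_dim:
  assumes "f \<in> faces \<T>" "h \<in> faces \<T>" "f \<subset> h"
  shows "aff_dim f < aff_dim h"
  by (rule face_of_aff_dim_lt[OF face_convex faces_subset_face_of]) (use assms in auto)

text \<open>The trace deletes the summands whose f is not contained in h and keeps the shape of the
  others; this is the triangularity. J is left general because the recursion sums over proper faces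
  and the uniqueness proof over all faces of a simplex.\<close>

lemma trace_sum_ext_op:
  assumes r: "r \<ge> 1" and g: "g \<in> faces \<T>" and h: "h \<in> faces \<T>" "h \<subseteq> g"
    and J: "J \<subseteq> {f \<in> faces \<T>. f \<subseteq> g}" and \<mu>: "\<And>f. f \<in> J \<Longrightarrow> \<mu> f \<in> poly_forms0 r k f"
  shows "form_trace h (\<lambda>y vs. \<Sum>f\<in>J. ext_op xs k r f g (\<mu> f) y vs)
    = (\<lambda>y vs. \<Sum>f\<in>{f \<in> J. f \<subseteq> h}. ext_op xs k r f h (\<mu> f) y vs)"
proof -
  note ng = face_numbered_simplex[OF g]
  note hg = faces_subset_face_of[OF h(1) g h(2)]
  have "form_trace h (ext_op xs k r f g (\<mu> f)) = (if f \<subseteq> h then ext_op xs k r f h (\<mu> f) else (\<lambda>y vs. 0))"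
    if f: "f \<in> J" for f
  proof (cases "f \<subseteq> h")
    case True
    have fF: "f \<in> faces \<T>" using f J by auto
    then show ?thesis
      using ext_op_trace[OF ng hg faces_subset_face_of[OF fF h(1) True] faces_nonempty[OF fF] r
          poly_forms0_subset[OF \<mu>[OF f]]] True by simp
  next
    case False
    have fF: "f \<in> faces \<T>" "f \<subseteq> g" using f J by auto
    show ?thesis
      using ext_op_trace_zero[OF ng faces_subset_face_of[OF fF(1) g fF(2)] faces_nonempty[OF fF(1)] hg
          faces_nonempty[OF h(1)] False r \<mu>[OF f]] False by simp
  qed
  then have "form_trace h (\<lambda>y vs. \<Sum>f\<in>J. ext_op xs k r f g (\<mu> f) y vs)
    = (\<lambda>y vs. \<Sum>f\<in>J. if f \<subseteq> h then ext_op xs k r f h (\<mu> f) y vs else 0)"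
    unfolding form_trace_sum by (intro ext sum.cong) auto
  moreover have "finite J" using J finite_faces by (auto intro: finite_subset)
  ultimately show ?thesis by (simp add: sum.inter_filter)
qed

text \<open>The recursion goes by levels of dimension: level m provides forms on all faces of
  dimension below m, and the induction step sets new values in dimension m only.\<close>

lemma decomposition_exists:
  assumes r: "r \<ge> 1" and \<phi>: "\<And>h. h \<in> faces \<T> \<Longrightarrow> \<phi> h \<in> poly_forms r k h"
    and tr: "\<And>e h. e \<in> faces \<T> \<Longrightarrow> h \<in> faces \<T> \<Longrightarrow> e \<subseteq> h \<Longrightarrow> form_trace e (\<phi> h) = \<phi> e"
  shows "\<exists>\<mu>. (\<forall>f\<in>faces \<T>. \<mu> f \<in> poly_forms0 r k f) \<and>
    (\<forall>h\<in>faces \<T>. \<phi> h = (\<lambda>y vs. \<Sum>f\<in>{f \<in> faces \<T>. f \<subseteq> h}. ext_op xs k r f h (\<mu> f) y vs))"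
proof -
  let ?Q = "\<lambda>\<mu> h. \<mu> h \<in> poly_forms0 r k h \<and>
    \<phi> h = (\<lambda>y vs. \<Sum>f\<in>{f \<in> faces \<T>. f \<subseteq> h}. ext_op xs k r f h (\<mu> f) y vs)"
  have "\<exists>\<mu>. \<forall>h\<in>faces \<T>. aff_dim h < int m \<longrightarrow> ?Q \<mu> h" for m
  proof (induction m)
    case 0
    show ?case
    proof (intro exI ballI impI)
      fix h assume "h \<in> faces \<T>" "aff_dim h < int 0"
      then have "aff_dim h = -1" using aff_dim_geq[of h] by linarith
      then have "h = {}" by (simp add: aff_dim_empty)
      then show "?Q undefined h" using \<open>h \<in> faces \<T>\<close> faces_nonempty by blast
    qed
  next
    case (Suc m)
    then obtain \<mu> where \<mu>: "\<And>h. h \<in> faces \<T> \<Longrightarrow> aff_dim h < int m \<Longrightarrow> ?Q \<mu> h" by blast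
    \<comment> \<open>The sum runs over proper faces, which have dimension below m, so it uses only
      values of \<mu> that are already correct.\<close>
    define \<nu> where "\<nu> h = (if aff_dim h = int m
      then (\<lambda>y vs. \<phi> h y vs - (\<Sum>f\<in>{f \<in> faces \<T>. f \<subset> h}. ext_op xs k r f h (\<mu> f) y vs)) else \<mu> h)" for h
    have "?Q \<nu> h" if h: "h \<in> faces \<T>" "aff_dim h < int (Suc m)" for h
    proof -
      have lt: "aff_dim f < int m" if "f \<in> faces \<T>" "f \<subset> h" for f
        using faces_psubset_aff_dim[OF that(1) h(1) that(2)] h(2) by simp
      then have \<nu>\<mu>: "\<nu> f = \<mu> f" if "f \<in> faces \<T>" "f \<subset> h" for f
        using that by (force simp: \<nu>_def)
      note nh = face_numbered_simplex[OF h(1)]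
      show ?thesis
      proof (cases "aff_dim h = int m")
        case False
        then have "aff_dim h < int m" using h(2) by simp
        moreover have "\<nu> f = \<mu> f" if "f \<in> faces \<T>" "f \<subseteq> h" for f
          using that \<nu>\<mu>[of f] False by (cases "f = h") (auto simp: \<nu>_def)
        ultimately show ?thesis using \<mu>[OF h(1)] h(1) by simp
      next
        case True
        let ?J = "{f \<in> faces \<T>. f \<subset> h}"
        let ?S = "\<lambda>y vs. \<Sum>f\<in>?J. ext_op xs k r f h (\<mu> f) y vs"
        have \<mu>J: "\<mu> f \<in> poly_forms0 r k f" if "f \<in> ?J" for f using \<mu> lt that by blast
        have \<nu>h: "\<nu> h = (\<lambda>y vs. 1 * \<phi> h y vs + (-1) * ?S y vs)" using True by (simp add: \<nu>_def)
        have "?S \<in> poly_forms r k h"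
          using h(1) r nh faces_nonempty poly_forms0_subset[OF \<mu>J]
          by (intro poly_forms_sum ext_op_poly_forms) (auto intro: faces_subset_face_of)
        then have P: "\<nu> h \<in> poly_forms r k h"
          unfolding \<nu>h by (intro poly_forms_lincomb \<phi> h(1))
        have "form_trace e (\<nu> h) = (\<lambda>y vs. 0)" if e: "e face_of h" "e \<noteq> {}" "e \<noteq> h" for e
        proof -
          have eF: "e \<in> faces \<T>" using faces_closed[OF h(1) e(1,2)] .
          have sub: "e \<subset> h" using e face_of_imp_subset by blast
          have "form_trace e (\<nu> h) = (\<lambda>y vs. form_trace e (\<phi> h) y vs - form_trace e ?S y vs)"
            unfolding \<nu>h by (auto simp: form_trace_def fun_eq_iff)
          also have "form_trace e ?S = (\<lambda>y vs. \<Sum>f\<in>{f \<in> ?J. f \<subseteq> e}. ext_op xs k r f e (\<mu> f) y vs)"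
            using sub by (intro trace_sum_ext_op[OF r h(1) eF] \<mu>J) auto
          also have "{f \<in> ?J. f \<subseteq> e} = {f \<in> faces \<T>. f \<subseteq> e}" using sub by auto
          \<comment> \<open>Induction hypothesis at e: what the sum leaves on e is all of
            \<open>\<phi> e\<close>, so it cancels the trace of \<open>\<phi> h\<close>.\<close>
          also have "(\<lambda>y vs. \<Sum>f\<in>{f \<in> faces \<T>. f \<subseteq> e}. ext_op xs k r f e (\<mu> f) y vs) = \<phi> e"
            using \<mu>[OF eF lt[OF eF sub]] by simp
          also have "form_trace e (\<phi> h) = \<phi> e" using tr[OF eF h(1)] sub by simp
          finally show ?thesis by simp
        qed
        with P have P0: "\<nu> h \<in> poly_forms0 r k h" by (simp add: poly_forms0_def)
        have "{f \<in> faces \<T>. f \<subseteq> h} = insert h ?J" using h(1) by auto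
        moreover have "finite ?J" using finite_faces by simp
        ultimately have "(\<Sum>f\<in>{f \<in> faces \<T>. f \<subseteq> h}. ext_op xs k r f h (\<nu> f) y vs)
            = ext_op xs k r h h (\<nu> h) y vs + ?S y vs" for y vs
          using \<nu>\<mu> by simp
        \<comment> \<open>Extension from h to h is the identity, so the summand of h supplies
          exactly the missing difference.\<close>
        then have "\<phi> h = (\<lambda>y vs. \<Sum>f\<in>{f \<in> faces \<T>. f \<subseteq> h}. ext_op xs k r f h (\<nu> f) y vs)"
          using ext_op_self[OF nh r P] by (simp add: \<nu>h)
        with P0 show ?thesis by simp
      qed
    qed
    then show ?case by blast
  qed
  \<comment> \<open>No set has dimension above \<open>DIM('a)\<close>, so this level covers all
    faces.\<close>
  from this[of "Suc DIM('a)"]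
  obtain \<mu> where \<mu>: "\<forall>h\<in>faces \<T>. aff_dim h < int (Suc DIM('a)) \<longrightarrow> ?Q \<mu> h" by blast
  have "aff_dim h < int (Suc DIM('a))" for h :: "'a set" using aff_dim_le_DIM[of h] by simp
  with \<mu> show ?thesis by (intro exI[of _ \<mu>]) blast
qed

text \<open>Induction on dimension: the trace on h of the vanishing sum on a simplex containing h
  leaves the summands of the faces of h. Those of proper faces vanish by induction, and the one of h
  is \<open>\<nu> h\<close> itself.\<close>

lemma decomposition_unique:
  assumes r: "r \<ge> 1" and \<nu>: "\<And>f. f \<in> faces \<T> \<Longrightarrow> \<nu> f \<in> poly_forms0 r k f"
    and zero: "\<And>T. T \<in> \<T> \<Longrightarrow>
      (\<lambda>y vs. \<Sum>f\<in>{f \<in> faces \<T>. f \<subseteq> T}. ext_op xs k r f T (\<nu> f) y vs) = (\<lambda>y vs. 0)"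
    and h: "h \<in> faces \<T>"
  shows "\<nu> h = (\<lambda>y vs. 0)"
  using h
proof (induction "nat (aff_dim h)" arbitrary: h rule: less_induct)
  case less
  note nh = face_numbered_simplex[OF less.prems]
  obtain T where T: "T \<in> \<T>" "h face_of T" using less.prems by (auto simp: faces_def)
  note TF = simplices_are_faces[OF T(1)] and hT = face_of_imp_subset[OF T(2)]
  let ?J = "{f \<in> faces \<T>. f \<subset> h}"
  have "(\<lambda>y vs. \<Sum>f\<in>{f \<in> {f \<in> faces \<T>. f \<subseteq> T}. f \<subseteq> h}. ext_op xs k r f h (\<nu> f) y vs)
      = form_trace h (\<lambda>y vs. \<Sum>f\<in>{f \<in> faces \<T>. f \<subseteq> T}. ext_op xs k r f T (\<nu> f) y vs)"
    using \<nu> by (intro trace_sum_ext_op[OF r TF less.prems hT, symmetric]) auto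
  also have "\<dots> = (\<lambda>y vs. 0)" unfolding zero[OF T(1)] by (simp add: form_trace_def)
  also have "{f \<in> {f \<in> faces \<T>. f \<subseteq> T}. f \<subseteq> h} = insert h ?J" using hT less.prems by auto
  finally have sum0: "(\<lambda>y vs. \<Sum>f\<in>insert h ?J. ext_op xs k r f h (\<nu> f) y vs) = (\<lambda>y vs. 0)" .
  have "ext_op xs k r f h (\<nu> f) = (\<lambda>y vs. 0)" if f: "f \<in> ?J" for f
  proof -
    have fF: "f \<in> faces \<T>" "f \<subset> h" using f by auto
    have "f \<noteq> {}" using fF faces_nonempty by blast
    \<comment> \<open>Nonempty faces have dimension at least 0, where \<open>nat\<close> preserves
      strict inequality.\<close>
    then have "aff_dim f \<ge> 0" using aff_dim_geq[of f] aff_dim_empty[of f] by linarith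
    then have "nat (aff_dim f) < nat (aff_dim h)"
      using faces_psubset_aff_dim[OF fF(1) less.prems fF(2)] by linarith
    then have "\<nu> f = (\<lambda>y vs. 0)" using less.hyps fF by blast
    then show ?thesis
      using ext_op_zero[OF nh _ \<open>f \<noteq> {}\<close> r] fF less.prems by (auto intro: faces_subset_face_of)
  qed
  then have "ext_op xs k r h h (\<nu> h) y vs = 0" for y vs
    using fun_cong[OF fun_cong[OF sum0, of y], of vs] finite_faces by simp
  then show ?case
    using ext_op_self[OF nh r poly_forms0_subset[OF \<nu>[OF less.prems]]] by (simp add: fun_eq_iff)
qed

text \<open>Traces on faces of dimension less than \<open>k\<close> vanish, and a face of full dimension lies in a single
  simplex, so single-valuedness on the remaining faces is enough.\<close>

lemma trace_single_valued:
  fixes p :: "'a set \<Rightarrow> 'a form"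
  assumes p: "\<And>T. T \<in> \<T> \<Longrightarrow> p T \<in> poly_forms r k T"
    and sv: "\<And>f T T'. f \<in> faces \<T> \<Longrightarrow> int k \<le> aff_dim f \<Longrightarrow> aff_dim f \<le> int DIM('a) - 1 \<Longrightarrow>
      T \<in> \<T> \<Longrightarrow> T' \<in> \<T> \<Longrightarrow> f \<subseteq> T \<Longrightarrow> f \<subseteq> T' \<Longrightarrow> form_trace f (p T) = form_trace f (p T')"
    and f: "f \<in> faces \<T>" and T: "T \<in> \<T>" "f \<subseteq> T" and T': "T' \<in> \<T>" "f \<subseteq> T'"
  shows "form_trace f (p T) = form_trace f (p T')"
proof -
  consider "aff_dim f < int k" | "int k \<le> aff_dim f" "aff_dim f \<le> int DIM('a) - 1" | "aff_dim f \<ge> int DIM('a)"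
    by linarith
  then show ?thesis
  proof cases
    case 1
    show ?thesis
      using poly_forms_low_dim[OF face_numbered_simplex[OF f] 1]
        form_trace_poly_forms[OF p[OF T(1)] T(2)] form_trace_poly_forms[OF p[OF T'(1)] T'(2)] by metis
  next
    case 3
    have "f = S" if S: "S \<in> \<T>" "f \<subseteq> S" for S
      using faces_psubset_aff_dim[OF f simplices_are_faces[OF S(1)]] S(2) 3 aff_dim_le_DIM[of S] by force
    then show ?thesis using T T' by blast
  next
    case 2
    show ?thesis by (rule sv[OF f 2 T(1) T'(1) T(2) T'(2)])
  qed
qed

end


section \<open>Gluing polynomial forms\<close>

text \<open>A polytope P in the frontier has empty interior: that interior is open and misses
  \<Omega>, so it also misses the closure of \<Omega>, in which it lies. Convex sets with empty
  interior are null. Polyhedrality matters here, as the frontier of a general open set can have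
  positive measure.\<close>

lemma polyhedral_domain_negligible_frontier:
  assumes "polyhedral_domain \<Omega>"
  shows "negligible (frontier \<Omega>)"
proof -
  from assms obtain \<F> where \<F>: "open \<Omega>" "finite \<F>" "\<And>P. P \<in> \<F> \<Longrightarrow> polytope P" "frontier \<Omega> = \<Union>\<F>"
    unfolding polyhedral_domain_def by blast
  have "negligible P" if P: "P \<in> \<F>" for P
  proof -
    have sub: "interior P \<subseteq> closure \<Omega>" "interior P \<inter> \<Omega> = {}"
      using P \<F>(1,4) interior_subset[of P] by (auto simp: frontier_def interior_open)
    then have "interior P \<inter> closure \<Omega> = {}"
      using open_Int_closure_eq_empty[of "interior P" \<Omega>] by simp
    with sub have "interior P = {}" by blast
    then show ?thesis
      using negligible_convex_interior polytope_imp_convex[OF \<F>(3)[OF P]] by blast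
  qed
  then show ?thesis unfolding \<F>(4) using \<F>(2) by (intro negligible_Union)
qed

lemma interior_full_simplex:
  fixes T :: "'a::euclidean_space set"
  assumes "int DIM('a) simplex T"
  shows "interior T \<noteq> {}" "closure (interior T) = T" "tangent T = UNIV"
proof -
  have conv: "convex T" and "closed T" and dim: "aff_dim T = int DIM('a)"
    using assms convex_simplex closed_simplex aff_dim_simplex by blast+
  have "T \<noteq> {}" using dim by auto
  then show ne: "interior T \<noteq> {}"
    using interior_rel_interior[OF dim] rel_interior_eq_empty[OF conv] by simp
  show "closure (interior T) = T"
    using convex_closure_interior[OF conv ne] \<open>closed T\<close> by simp
  show "tangent T = UNIV"
  proof (intro set_eqI iffI UNIV_I)
    fix v :: 'a
    obtain x where x: "x \<in> interior T" using ne by blast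
    then obtain e where e: "e > 0" "ball x e \<subseteq> T" by (auto simp: mem_interior)
    \<comment> \<open>Scaled so that x + c v stays in the ball; the added 1 covers v = 0.\<close>
    define c where "c = e / (2 * (norm v + 1))"
    have c: "c > 0" using e by (simp add: c_def add_nonneg_pos)
    have "c * norm v < e"
    proof -
      have "norm v / (2 * (norm v + 1)) < 1" by (simp add: divide_simps add_nonneg_pos)
      then show ?thesis using e mult_strict_left_mono[of "norm v / (2 * (norm v + 1))" 1 e] by (simp add: c_def)
    qed
    then have "x + c *\<^sub>R v \<in> T" using e c by (auto simp: subset_iff dist_norm)
    moreover have "x \<in> T" using x interior_subset by blast
    ultimately have "(x + c *\<^sub>R v) - x \<in> tangent T" unfolding tangent_def by (intro span_base) blast
    then have "(1 / c) *\<^sub>R (x + c *\<^sub>R v - x) \<in> tangent T" by (rule subspace_scale[OF subspace_tangent])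
    then show "v \<in> tangent T" using c by simp
  qed
qed

lemma poly_form_measurable:
  fixes T :: "'a::euclidean_space set"
  assumes p: "p \<in> poly_forms r k T" and A: "A \<in> sets borel" "A \<subseteq> T"
  shows "(\<lambda>y. indicator A y * p y vs) \<in> borel_measurable borel"
proof (cases "length vs = k \<and> set vs \<subseteq> tangent T")
  case True
  then obtain q where q: "q \<in> poly_fun r" "\<forall>y\<in>T. p y vs = q y" using poly_formsD(3)[OF p] by blast
  have "(\<lambda>y. indicator A y *\<^sub>R q y) \<in> borel_measurable borel"
    using A(1) continuous_poly_fun[OF q(1)] by (rule borel_measurable_continuous_on_indicator)
  also have "(\<lambda>y. indicator A y *\<^sub>R q y) = (\<lambda>y. indicator A y * p y vs)"
    using q(2) A(2) by (auto simp: indicator_def fun_eq_iff)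
  finally show ?thesis .
next
  case False
  then show ?thesis using poly_formsD(4)[OF p False] by simp
qed

lemma poly_form_bounded:
  assumes p: "p \<in> poly_forms r k T" and T: "compact T"
  shows "\<exists>B. \<forall>y. \<bar>p y vs\<bar> \<le> B"
proof (cases "length vs = k \<and> set vs \<subseteq> tangent T")
  case True
  then obtain q where q: "q \<in> poly_fun r" "\<forall>y\<in>T. p y vs = q y" using poly_formsD(3)[OF p] by blast
  have "bounded (q ` T)"
    using compact_continuous_image[OF continuous_poly_fun[OF q(1)] T] by (rule compact_imp_bounded)
  then obtain B where B: "\<And>y. y \<in> T \<Longrightarrow> \<bar>q y\<bar> \<le> B" by (auto simp: bounded_iff)
  have "\<bar>p y vs\<bar> \<le> max B 0" for y
    using B[of y] q(2) poly_formsD(2)[OF p, of y vs] by (cases "y \<in> T") auto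
  then show ?thesis by blast
next
  case False
  then show ?thesis using poly_formsD(4)[OF p False] by auto
qed

section \<open>Vector space structure of classes of forms\<close>

lemma subspaceI_lincomb:
  assumes zero: "0 \<in> S" and lin: "\<And>a b u v. u \<in> S \<Longrightarrow> v \<in> S \<Longrightarrow> a *\<^sub>R u + b *\<^sub>R v \<in> S"
  shows "subspace S"
  unfolding subspace_def
proof (intro conjI ballI allI)
  show "u + v \<in> S" if "u \<in> S" "v \<in> S" for u v using lin[OF that, of 1 1] by simp
  show "a *\<^sub>R u \<in> S" if "u \<in> S" for a u using lin[OF that that, of a 0] by simp
qed (rule zero)

lemma L2_forms_lincomb:
  assumes "u \<in> L2_forms k \<Omega>" "v \<in> L2_forms k \<Omega>"
  shows "a *\<^sub>R u + b *\<^sub>R v \<in> L2_forms k \<Omega>"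
proof -
  let ?L = "\<lambda>\<omega>. (\<forall>y\<in>\<Omega>. alternating k UNIV (\<omega> y)) \<and> (\<forall>y. y \<notin> \<Omega> \<longrightarrow> \<omega> y = (\<lambda>vs. 0)) \<and>
     (\<forall>vs. (\<lambda>y. \<omega> y vs) \<in> borel_measurable lebesgue \<and> integrable lebesgue (\<lambda>y. (\<omega> y vs)\<^sup>2))"
  obtain \<omega> \<eta> where w: "u = abs_ae_form \<omega>" "?L \<omega>" and e: "v = abs_ae_form \<eta>" "?L \<eta>"
    using assms unfolding L2_forms_def by blast
  let ?z = "\<lambda>y vs. a * \<omega> y vs + b * \<eta> y vs"
  have "a *\<^sub>R u + b *\<^sub>R v = abs_ae_form ?z"
    unfolding w e by (simp add: scaleR_ae_form.abs_eq plus_ae_form.abs_eq)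
  moreover have "?L ?z"
  proof (intro conjI ballI allI impI)
    show "alternating k UNIV (\<lambda>vs. a * \<omega> y vs + b * \<eta> y vs)" if "y \<in> \<Omega>" for y
      using that w e by (intro alternating_lincomb) auto
    show "(\<lambda>vs. a * \<omega> y vs + b * \<eta> y vs) = (\<lambda>vs. 0)" if "y \<notin> \<Omega>" for y using that w e by simp
    fix vs
    have m[measurable]: "(\<lambda>y. \<omega> y vs) \<in> borel_measurable lebesgue" "(\<lambda>y. \<eta> y vs) \<in> borel_measurable lebesgue"
      using w e by auto
    show "(\<lambda>y. a * \<omega> y vs + b * \<eta> y vs) \<in> borel_measurable lebesgue" by measurable
    \<comment> \<open>Dominating function, from
      \<open>(s + t)^2 \<le> 2 s^2 + 2 t^2\<close>.\<close>
    have "integrable lebesgue (\<lambda>y. 2 * a\<^sup>2 * (\<omega> y vs)\<^sup>2 + 2 * b\<^sup>2 * (\<eta> y vs)\<^sup>2)"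
      using w e by (intro Bochner_Integration.integrable_add integrable_mult_right) auto
    then show "integrable lebesgue (\<lambda>y. (a * \<omega> y vs + b * \<eta> y vs)\<^sup>2)"
    proof (rule Bochner_Integration.integrable_bound)
      show "(\<lambda>y. (a * \<omega> y vs + b * \<eta> y vs)\<^sup>2) \<in> borel_measurable lebesgue" by measurable
      have "(s + t)\<^sup>2 \<le> 2 * s\<^sup>2 + 2 * t\<^sup>2" for s t :: real
        using zero_le_power2[of "s - t"] by (simp add: power2_eq_square algebra_simps)
      then have "(a * \<omega> y vs + b * \<eta> y vs)\<^sup>2 \<le> 2 * a\<^sup>2 * (\<omega> y vs)\<^sup>2 + 2 * b\<^sup>2 * (\<eta> y vs)\<^sup>2" for y
        by (metis (no_types, lifting) mult.assoc power_mult_distrib)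
      then show "AE y in lebesgue. norm ((a * \<omega> y vs + b * \<eta> y vs)\<^sup>2)
          \<le> norm (2 * a\<^sup>2 * (\<omega> y vs)\<^sup>2 + 2 * b\<^sup>2 * (\<eta> y vs)\<^sup>2)"
        by (intro AE_I2) (auto intro: order_trans)
    qed
  qed
  ultimately show ?thesis unfolding L2_forms_def by blast
qed

lemma L2_forms_zero: "0 \<in> L2_forms k \<Omega>"
  unfolding L2_forms_def
  by (intro image_eqI[of _ _ "\<lambda>y vs. 0"]) (auto simp: zero_ae_form_def alternating_zero)

lemma restricts_to_zero: "restricts_to 0 T (\<lambda>y vs. 0)"
  by transfer simp

lemma restricts_to_lincomb:
  assumes "restricts_to u T p" "restricts_to v T q"
  shows "restricts_to (a *\<^sub>R u + b *\<^sub>R v) T (\<lambda>y vs. a * p y vs + b * q y vs)"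
  using assms by transfer (auto elim!: eventually_elim2)

locale domain_triangulation = numbered_triangulation \<T> xs
  for \<T> :: "'a::euclidean_space set set" and xs +
  fixes \<Omega> :: "'a set"
  assumes domain: "polyhedral_domain \<Omega>" and bounded_domain: "bounded \<Omega>"
    and full_dim: "T \<in> \<T> \<Longrightarrow> int DIM('a) simplex T" and union: "\<Union>\<T> = closure \<Omega>"
begin

lemma finite_triangulation: "finite \<T>"
  using triangulation by (simp add: triangulation_def)

lemma interiors_disjoint:
  assumes "T \<in> \<T>" "T' \<in> \<T>" "T \<noteq> T'"
  shows "interior T \<inter> interior T' = {}"
proof (rule ccontr)
  assume "interior T \<inter> interior T' \<noteq> {}"
  then obtain x where x: "x \<in> interior T" "x \<in> interior T'" by blast
  then have in_T: "x \<in> T" "x \<in> T'" using interior_subset by blast+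
  have "(T \<inter> T') face_of T" "(T' \<inter> T) face_of T'" using assms triangulation by (auto simp: triangulation_def)
  with x in_T have "T \<inter> T' = T" "T' \<inter> T = T'" using face_of_disjoint_interior by blast+
  with assms(3) show False by blast
qed

text \<open>Bridge between exact forms p on closed simplices, for which traces make sense, and a
  class u modulo null sets. For polynomial p each determines the other on \<T>, by the existence
  lemma and the two uniqueness lemmas below.\<close>

definition glues :: "nat \<Rightarrow> ('a set \<Rightarrow> 'a form) \<Rightarrow> 'a ae_form \<Rightarrow> bool" where
  "glues k p u \<longleftrightarrow> u \<in> L2_forms k \<Omega> \<and> (\<forall>T\<in>\<T>. restricts_to u T (p T))"

lemma glues_exists:
  assumes p: "\<And>T. T \<in> \<T> \<Longrightarrow> p T \<in> poly_forms r k T"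
  shows "\<exists>u. glues k p u"
proof -
  \<comment> \<open>Interiors of distinct simplices are disjoint, so at most one summand is nonzero
    at a point. Intersecting with \<Omega> makes the form vanish off \<Omega>: interior points of a
    simplex may lie on the frontier of \<Omega>, as for a slit domain.\<close>
  define \<omega> where "\<omega> y vs = (\<Sum>T\<in>\<T>. indicator (interior T \<inter> \<Omega>) y * p T y vs)" for y vs
  have op: "open \<Omega>" using domain by (simp add: polyhedral_domain_def)
  have alt: "alternating k UNIV (\<omega> y)" for y
  proof -
    have "alternating k UNIV (p T y)" if T: "T \<in> \<T>" for T
      using poly_formsD(1)[OF p[OF T], of y] poly_formsD(2)[OF p[OF T], of y]
        interior_full_simplex(3)[OF full_dim[OF T]]
      by (cases "y \<in> T") (auto simp: alternating_def)
    then show ?thesis unfolding \<omega>_def by (intro alternating_sum alternating_scale)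
  qed
  have out: "\<omega> y = (\<lambda>vs. 0)" if "y \<notin> \<Omega>" for y using that by (simp add: \<omega>_def fun_eq_iff)
  have meas: "(\<lambda>y. \<omega> y vs) \<in> borel_measurable lebesgue" for vs
  proof -
    have "(\<lambda>y. \<omega> y vs) \<in> borel_measurable borel"
      unfolding \<omega>_def using op interior_subset by (intro borel_measurable_sum poly_form_measurable[OF p]) auto
    then show ?thesis by (simp add: measurable_completion)
  qed
  have "integrable lebesgue (\<lambda>y. (\<omega> y vs)\<^sup>2)" for vs
  proof -
    have "\<exists>B. \<forall>y. \<bar>p T y vs\<bar> \<le> B" if "T \<in> \<T>" for T
      using poly_form_bounded[OF p[OF that]] compact_simplex[OF full_dim[OF that]] by blast
    then obtain B where B: "\<And>T y. T \<in> \<T> \<Longrightarrow> \<bar>p T y vs\<bar> \<le> B T" by metis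
    have bd: "\<bar>\<omega> y vs\<bar> \<le> (\<Sum>T\<in>\<T>. B T)" for y
      unfolding \<omega>_def
    proof (rule order_trans[OF sum_abs sum_mono])
      fix T assume "T \<in> \<T>"
      then show "\<bar>indicator (interior T \<inter> \<Omega>) y * p T y vs\<bar> \<le> B T"
        using B[of T y] by (auto simp: indicator_def)
    qed
    show ?thesis
    proof (rule integrableI_bounded_set[where A = \<Omega> and B = "(\<Sum>T\<in>\<T>. B T)\<^sup>2"])
      show "\<Omega> \<in> sets lebesgue" using op by auto
      show "(\<lambda>y. (\<omega> y vs)\<^sup>2) \<in> borel_measurable lebesgue" using meas by measurable
      show "emeasure lebesgue \<Omega> < \<infinity>"
        unfolding infinity_ennreal_def less_top[symmetric]
        by (rule fmeasurableD2[OF lmeasurable_open[OF bounded_domain op]])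
      show "AE y in lebesgue. y \<in> \<Omega> \<longrightarrow> norm ((\<omega> y vs)\<^sup>2) \<le> (\<Sum>T\<in>\<T>. B T)\<^sup>2"
        using bd by (intro AE_I2) (simp add: abs_le_square_iff[symmetric] order_trans[OF bd abs_ge_self])
      show "AE y in lebesgue. y \<notin> \<Omega> \<longrightarrow> (\<omega> y vs)\<^sup>2 = 0" using out by (intro AE_I2) simp
    qed
  qed
  with alt out meas have L2: "abs_ae_form \<omega> \<in> L2_forms k \<Omega>" unfolding L2_forms_def by blast
  have "restricts_to (abs_ae_form \<omega>) T (p T)" if T: "T \<in> \<T>" for T
  proof -
    \<comment> \<open>On T the representative can differ from \<open>p T\<close> only on these two
      null sets: off them a point of T lies in its interior and in \<Omega>.\<close>
    let ?N = "frontier T \<union> frontier \<Omega>"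
    have "negligible ?N"
      using negligible_convex_frontier[of T] convex_simplex[OF full_dim[OF T]]
        polyhedral_domain_negligible_frontier[OF domain] by (simp add: negligible_Un)
    then have "AE y in lebesgue. y \<notin> ?N" unfolding negligible_iff_null_sets by (rule AE_not_in)
    then have "AE y in lebesgue. y \<in> T \<longrightarrow> \<omega> y = p T y"
    proof (rule AE_mp, intro AE_I2 impI)
      fix y assume y: "y \<notin> ?N" "y \<in> T"
      have "closed T" using closed_simplex[OF full_dim[OF T]] .
      then have yi: "y \<in> interior T" using y by (auto simp: frontier_def)
      have "y \<in> closure \<Omega>" using y T union by blast
      then have y\<Omega>: "y \<in> \<Omega>" using y op by (auto simp: frontier_def interior_open)
      have "\<omega> y vs = p T y vs" for vs
      proof -
        have "indicator (interior S \<inter> \<Omega>) y * p S y vs = 0" if "S \<in> \<T> - {T}" for S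
        proof -
          have "y \<notin> interior S" using that interiors_disjoint[of S T] T yi by blast
          then show ?thesis by simp
        qed
        then have "(\<Sum>S\<in>\<T> - {T}. indicator (interior S \<inter> \<Omega>) y * p S y vs) = 0"
          by (rule sum.neutral[OF ballI])
        moreover have "\<omega> y vs = indicator (interior T \<inter> \<Omega>) y * p T y vs
            + (\<Sum>S\<in>\<T> - {T}. indicator (interior S \<inter> \<Omega>) y * p S y vs)"
          unfolding \<omega>_def using finite_triangulation T by (rule sum.remove)
        ultimately show ?thesis using yi y\<Omega> by simp
      qed
      then show "\<omega> y = p T y" ..
    qed
    then show ?thesis by (simp add: restricts_to.abs_eq)
  qed
  with L2 show ?thesis unfolding glues_def by blast
qed

text \<open>The finitely many simplices cover \<Omega>, and outside \<Omega> both representatives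
  are 0.\<close>

lemma glues_unique:
  assumes "glues k p u" "glues k p v"
  shows "u = v"
proof -
  obtain \<omega> \<eta> where w: "u = abs_ae_form \<omega>" "\<And>y. y \<notin> \<Omega> \<Longrightarrow> \<omega> y = (\<lambda>vs. 0)"
    and e: "v = abs_ae_form \<eta>" "\<And>y. y \<notin> \<Omega> \<Longrightarrow> \<eta> y = (\<lambda>vs. 0)"
    using assms unfolding glues_def L2_forms_def by blast
  have "AE y in lebesgue. \<forall>T\<in>\<T>. y \<in> T \<longrightarrow> \<omega> y = \<eta> y"
  proof (rule AE_finite_allI[OF finite_triangulation])
    fix T assume T: "T \<in> \<T>"
    then have "AE y in lebesgue. y \<in> T \<longrightarrow> \<omega> y = p T y" "AE y in lebesgue. y \<in> T \<longrightarrow> \<eta> y = p T y"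
      using assms by (auto simp: glues_def w(1) e(1) restricts_to.abs_eq)
    then show "AE y in lebesgue. y \<in> T \<longrightarrow> \<omega> y = \<eta> y" by (rule eventually_elim2) simp
  qed
  then have "AE y in lebesgue. \<omega> y = \<eta> y"
  proof (rule AE_mp, intro AE_I2 impI)
    fix y assume y: "\<forall>T\<in>\<T>. y \<in> T \<longrightarrow> \<omega> y = \<eta> y"
    show "\<omega> y = \<eta> y"
    proof (cases "y \<in> \<Omega>")
      case True
      then have "y \<in> \<Union>\<T>" using union closure_subset by blast
      then show ?thesis using y by blast
    qed (simp add: w(2) e(2))
  qed
  then show ?thesis unfolding w(1) e(1) by (simp add: ae_form.abs_eq_iff)
qed

text \<open>Where two polynomials agree almost everywhere on T, the points of the interior at which
  they differ form an open null set, which is empty. By continuity they agree on the closure of the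
  interior, which is T.\<close>

lemma glues_inj:
  assumes u: "glues k p u" "glues k q u" and T: "T \<in> \<T>"
    and p: "p T \<in> poly_forms r k T" and q: "q T \<in> poly_forms r k T"
  shows "p T = q T"
proof -
  obtain \<omega> where w: "u = abs_ae_form \<omega>" using u unfolding glues_def L2_forms_def by blast
  have "AE y in lebesgue. y \<in> T \<longrightarrow> \<omega> y = p T y" "AE y in lebesgue. y \<in> T \<longrightarrow> \<omega> y = q T y"
    using u T by (auto simp: glues_def w restricts_to.abs_eq)
  then have ae: "AE y in lebesgue. y \<in> T \<longrightarrow> p T y = q T y" by (rule eventually_elim2) simp
  have "p T y vs = q T y vs" if y: "y \<in> T" and vs: "length vs = k" "set vs \<subseteq> tangent T" for y vs
  proof -
    obtain f g where f: "f \<in> poly_fun r" "\<forall>y\<in>T. p T y vs = f y" and g: "g \<in> poly_fun r" "\<forall>y\<in>T. q T y vs = g y"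
      using poly_formsD(3)[OF p vs] poly_formsD(3)[OF q vs] by blast
    let ?D = "{y \<in> interior T. f y \<noteq> g y}"
    have cont: "continuous_on UNIV (\<lambda>y. f y - g y)"
      using continuous_poly_fun[OF f(1)] continuous_poly_fun[OF g(1)] by (intro continuous_intros)
    have "open ((\<lambda>y. f y - g y) -` (- {0}) \<inter> interior T)"
      using cont by (intro open_Int open_vimage) auto
    moreover have "(\<lambda>y. f y - g y) -` (- {0}) \<inter> interior T = ?D" by auto
    ultimately have "open ?D" by simp
    moreover have "negligible ?D"
    proof -
      have "AE y in lebesgue. y \<notin> ?D"
        using ae
      proof (rule AE_mp, intro AE_I2 impI)
        fix y assume "y \<in> T \<longrightarrow> p T y = q T y"
        then show "y \<notin> ?D" using f(2) g(2) interior_subset[of T] by force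
      qed
      moreover have "?D \<in> sets lebesgue" using \<open>open ?D\<close> by auto
      ultimately have "?D \<in> null_sets lebesgue"
        by (subst AE_iff_null_sets) auto
      then show ?thesis by (simp add: negligible_iff_null_sets)
    qed
    ultimately have "?D = {}" using open_not_negligible by blast
    then have "f y - g y = 0" if "y \<in> interior T" for y using that by auto
    then have "f y - g y = 0" if "y \<in> closure (interior T)" for y
      using continuous_constant_on_closure[of "interior T" "\<lambda>y. f y - g y" 0 y] that
        continuous_on_subset[OF cont] by blast
    then show ?thesis using f(2) g(2) y interior_full_simplex(2)[OF full_dim[OF T]] by auto
  qed
  moreover have "p T y vs = q T y vs" if "\<not> (y \<in> T \<and> length vs = k \<and> set vs \<subseteq> tangent T)" for y vs
    using that poly_formsD(2,4)[OF p] poly_formsD(2,4)[OF q] by metis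
  ultimately show ?thesis by (intro ext) blast
qed

lemma glues_cong: "glues k p u \<Longrightarrow> (\<And>T. T \<in> \<T> \<Longrightarrow> p T = q T) \<Longrightarrow> glues k q u"
  by (simp add: glues_def)

lemma glues_zero: "glues k (\<lambda>T y vs. 0) 0"
  by (simp add: glues_def L2_forms_zero restricts_to_zero)

lemma glues_lincomb:
  "glues k p u \<Longrightarrow> glues k q v \<Longrightarrow> glues k (\<lambda>T y vs. a * p T y vs + b * q T y vs) (a *\<^sub>R u + b *\<^sub>R v)"
  by (simp add: glues_def L2_forms_lincomb restricts_to_lincomb)

lemma glues_sum:
  assumes "\<And>i. i \<in> J \<Longrightarrow> glues k (p i) (u i)"
  shows "glues k (\<lambda>T y vs. \<Sum>i\<in>J. p i T y vs) (\<Sum>i\<in>J. u i)"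
  using assms
proof (induction J rule: infinite_finite_induct)
  case (insert i J)
  then show ?case
    using glues_lincomb[of k "p i" "u i" "\<lambda>T y vs. \<Sum>i\<in>J. p i T y vs" "\<Sum>i\<in>J. u i" 1 1] by simp
qed (simp_all add: glues_zero)

text \<open>Single-valued traces are demanded on all faces, not just on those of dimension between k
  and n - 1, so that traces can be compared without case distinctions;
  \<open>piecewise_poly_forms_iff\<close> shows that this describes the same space.\<close>

definition compatible :: "nat \<Rightarrow> nat \<Rightarrow> ('a set \<Rightarrow> 'a form) \<Rightarrow> bool" where
  "compatible r k p \<longleftrightarrow> (\<forall>T\<in>\<T>. p T \<in> poly_forms r k T) \<and>
     (\<forall>f\<in>faces \<T>. \<forall>T\<in>\<T>. \<forall>T'\<in>\<T>. f \<subseteq> T \<longrightarrow> f \<subseteq> T' \<longrightarrow> form_trace f (p T) = form_trace f (p T'))"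

lemma compatible_poly_forms: "compatible r k p \<Longrightarrow> T \<in> \<T> \<Longrightarrow> p T \<in> poly_forms r k T"
  by (simp add: compatible_def)

lemma compatible_trace:
  "compatible r k p \<Longrightarrow> f \<in> faces \<T> \<Longrightarrow> T \<in> \<T> \<Longrightarrow> T' \<in> \<T> \<Longrightarrow> f \<subseteq> T \<Longrightarrow> f \<subseteq> T' \<Longrightarrow>
    form_trace f (p T) = form_trace f (p T')"
  unfolding compatible_def by blast

lemma compatibleI:
  assumes "\<And>T. T \<in> \<T> \<Longrightarrow> p T \<in> poly_forms r k T"
    and "\<And>f T T'. f \<in> faces \<T> \<Longrightarrow> T \<in> \<T> \<Longrightarrow> T' \<in> \<T> \<Longrightarrow> f \<subseteq> T \<Longrightarrow> f \<subseteq> T' \<Longrightarrow>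
      form_trace f (p T) = form_trace f (p T')"
  shows "compatible r k p"
  unfolding compatible_def by (intro conjI ballI impI assms)

lemma piecewise_poly_forms_iff:
  "u \<in> piecewise_poly_forms r k \<T> \<Omega> \<longleftrightarrow> (\<exists>p. glues k p u \<and> compatible r k p)"
proof
  assume "u \<in> piecewise_poly_forms r k \<T> \<Omega>"
  then have "u \<in> L2_forms k \<Omega> \<and> (\<exists>p. (\<forall>T\<in>\<T>. p T \<in> poly_forms r k T \<and> restricts_to u T (p T)) \<and>
     (\<forall>f\<in>faces \<T>. int k \<le> aff_dim f \<and> aff_dim f \<le> int DIM('a) - 1 \<longrightarrow>
        (\<forall>T\<in>\<T>. \<forall>T'\<in>\<T>. f \<subseteq> T \<and> f \<subseteq> T' \<longrightarrow> form_trace f (p T) = form_trace f (p T'))))"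
    unfolding piecewise_poly_forms_def by (rule CollectD)
  then obtain p where u: "u \<in> L2_forms k \<Omega>"
    and p: "\<forall>T\<in>\<T>. p T \<in> poly_forms r k T \<and> restricts_to u T (p T)"
    and sv: "\<forall>f\<in>faces \<T>. int k \<le> aff_dim f \<and> aff_dim f \<le> int DIM('a) - 1 \<longrightarrow>
        (\<forall>T\<in>\<T>. \<forall>T'\<in>\<T>. f \<subseteq> T \<and> f \<subseteq> T' \<longrightarrow> form_trace f (p T) = form_trace f (p T'))"
    by (elim conjE exE) (rule that)
  have P: "p T \<in> poly_forms r k T" if "T \<in> \<T>" for T using p that by simp
  have "compatible r k p"
  proof (rule compatibleI[OF P])
    fix f T T' assume h: "f \<in> faces \<T>" "T \<in> \<T>" "T' \<in> \<T>" "f \<subseteq> T" "f \<subseteq> T'"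
    show "form_trace f (p T) = form_trace f (p T')"
      by (rule trace_single_valued[of p r k, OF P _ h(1,2,4,3,5)], assumption)
         (rule sv[rule_format], auto)
  qed
  moreover have "glues k p u" using u p by (simp add: glues_def)
  ultimately show "\<exists>p. glues k p u \<and> compatible r k p" by blast
next
  assume "\<exists>p. glues k p u \<and> compatible r k p"
  then obtain p where p: "glues k p u" "compatible r k p" by blast
  show "u \<in> piecewise_poly_forms r k \<T> \<Omega>"
    unfolding piecewise_poly_forms_def
  proof (intro CollectI conjI exI[of _ p] ballI impI)
    show "form_trace f (p T) = form_trace f (p T')"
      if "f \<in> faces \<T>" "T \<in> \<T>" "T' \<in> \<T>" "f \<subseteq> T \<and> f \<subseteq> T'" for f T T'
      using that by (intro compatible_trace[OF p(2)]) auto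
  qed (use p compatible_poly_forms[OF p(2)] in \<open>simp_all add: glues_def\<close>)
qed

lemma compatible_lincomb:
  assumes p: "compatible r k p" and q: "compatible r k q"
  shows "compatible r k (\<lambda>T y vs. a * p T y vs + b * q T y vs)"
proof (rule compatibleI)
  show "(\<lambda>y vs. a * p T y vs + b * q T y vs) \<in> poly_forms r k T" if "T \<in> \<T>" for T
    using that by (intro poly_forms_lincomb compatible_poly_forms[OF p] compatible_poly_forms[OF q])
  have tr: "form_trace f (\<lambda>y vs. a * p T y vs + b * q T y vs)
      = (\<lambda>y vs. a * form_trace f (p T) y vs + b * form_trace f (q T) y vs)" for f T
    by (auto simp: form_trace_def fun_eq_iff)
  show "form_trace f (\<lambda>y vs. a * p T y vs + b * q T y vs) = form_trace f (\<lambda>y vs. a * p T' y vs + b * q T' y vs)"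
    if "f \<in> faces \<T>" "T \<in> \<T>" "T' \<in> \<T>" "f \<subseteq> T" "f \<subseteq> T'" for f T T'
    unfolding tr compatible_trace[OF p that] compatible_trace[OF q that] ..
qed

lemma subspace_piecewise_poly_forms: "subspace (piecewise_poly_forms r k \<T> \<Omega>)"
proof (rule subspaceI_lincomb)
  have "compatible r k (\<lambda>T y vs. 0)" by (intro compatibleI poly_forms_zero refl)
  then show "0 \<in> piecewise_poly_forms r k \<T> \<Omega>"
    unfolding piecewise_poly_forms_iff using glues_zero by blast
  show "a *\<^sub>R u + b *\<^sub>R v \<in> piecewise_poly_forms r k \<T> \<Omega>"
    if "u \<in> piecewise_poly_forms r k \<T> \<Omega>" "v \<in> piecewise_poly_forms r k \<T> \<Omega>" for a b u v
    using that unfolding piecewise_poly_forms_iff by (blast intro: glues_lincomb compatible_lincomb)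
qed

subsection \<open>The global extension operators\<close>

definition local_ext :: "nat \<Rightarrow> nat \<Rightarrow> 'a set \<Rightarrow> 'a form \<Rightarrow> 'a set \<Rightarrow> 'a form" where
  "local_ext k r f \<mu> T = (if f \<subseteq> T then ext_op xs k r f T \<mu> else (\<lambda>y vs. 0))"

lemma local_ext_poly_forms:
  assumes "r \<ge> 1" "f \<in> faces \<T>" "\<mu> \<in> poly_forms r k f" "T \<in> \<T>"
  shows "local_ext k r f \<mu> T \<in> poly_forms r k T"
  using ext_op_poly_forms[OF face_numbered_simplex[OF simplices_are_faces[OF assms(4)]] _ faces_nonempty[OF assms(2)] assms(1,3)]
    faces_subset_face_of[OF assms(2) simplices_are_faces[OF assms(4)]]
  by (simp add: local_ext_def poly_forms_zero)

lemma local_ext_lincomb: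
  assumes "r \<ge> 1" "f \<in> faces \<T>" "\<mu> \<in> poly_forms r k f" "\<nu> \<in> poly_forms r k f" "T \<in> \<T>"
  shows "local_ext k r f (\<lambda>y vs. a * \<mu> y vs + b * \<nu> y vs) T
    = (\<lambda>y vs. a * local_ext k r f \<mu> T y vs + b * local_ext k r f \<nu> T y vs)"
  using ext_op_lincomb[OF face_numbered_simplex[OF simplices_are_faces[OF assms(5)]] _ faces_nonempty[OF assms(2)] assms(1,3,4)]
    faces_subset_face_of[OF assms(2) simplices_are_faces[OF assms(5)]]
  by (simp add: local_ext_def)

text \<open>Resolves the definite description of \<open>global_ext\<close>, which is afterwards used
  only through \<open>glues\<close>.\<close>

lemma glues_global_ext:
  assumes "r \<ge> 1" "f \<in> faces \<T>" "\<mu> \<in> poly_forms r k f"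
  shows "glues k (local_ext k r f \<mu>) (global_ext xs k r \<T> \<Omega> f \<mu>)"
proof -
  have "\<exists>!u. glues k (local_ext k r f \<mu>) u"
    using glues_exists[OF local_ext_poly_forms[OF assms]] glues_unique by blast
  then have "glues k (local_ext k r f \<mu>) (THE u. glues k (local_ext k r f \<mu>) u)" by (rule theI')
  then show ?thesis by (simp add: global_ext_def glues_def local_ext_def)
qed

lemma global_ext_lincomb:
  assumes "r \<ge> 1" "f \<in> faces \<T>" "\<mu> \<in> poly_forms r k f" "\<nu> \<in> poly_forms r k f"
  shows "global_ext xs k r \<T> \<Omega> f (\<lambda>y vs. a * \<mu> y vs + b * \<nu> y vs)
    = a *\<^sub>R global_ext xs k r \<T> \<Omega> f \<mu> + b *\<^sub>R global_ext xs k r \<T> \<Omega> f \<nu>"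
proof (rule glues_unique)
  show "glues k (local_ext k r f (\<lambda>y vs. a * \<mu> y vs + b * \<nu> y vs))
      (global_ext xs k r \<T> \<Omega> f (\<lambda>y vs. a * \<mu> y vs + b * \<nu> y vs))"
    using assms by (intro glues_global_ext poly_forms_lincomb)
  show "glues k (local_ext k r f (\<lambda>y vs. a * \<mu> y vs + b * \<nu> y vs))
      (a *\<^sub>R global_ext xs k r \<T> \<Omega> f \<mu> + b *\<^sub>R global_ext xs k r \<T> \<Omega> f \<nu>)"
    by (rule glues_cong[OF glues_lincomb[OF glues_global_ext[OF assms(1-3)] glues_global_ext[OF assms(1,2,4)]]])
       (rule local_ext_lincomb[OF assms, symmetric])
qed

text \<open>The right-hand side does not mention T, which is the single-valuedness of traces. If f
  is contained in T, this is the trace formula for a single summand; otherwise f is not contained in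
  h either, and both sides are 0.\<close>

lemma local_ext_trace:
  assumes r: "r \<ge> 1" and f: "f \<in> faces \<T>" and \<mu>: "\<mu> \<in> poly_forms0 r k f"
    and h: "h \<in> faces \<T>" and T: "T \<in> \<T>" "h \<subseteq> T"
  shows "form_trace h (local_ext k r f \<mu> T) = (if f \<subseteq> h then ext_op xs k r f h \<mu> else (\<lambda>y vs. 0))"
proof -
  note TF = simplices_are_faces[OF T(1)]
  show ?thesis
  proof (cases "f \<subseteq> T")
    case True
    have "form_trace h (\<lambda>y vs. \<Sum>f\<in>{f}. ext_op xs k r f T \<mu> y vs)
        = (\<lambda>y vs. \<Sum>f\<in>{f' \<in> {f}. f' \<subseteq> h}. ext_op xs k r f h \<mu> y vs)"
      using f \<mu> True by (intro trace_sum_ext_op[OF r TF h T(2)]) auto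
    moreover have "{f' \<in> {f}. f' \<subseteq> h} = (if f \<subseteq> h then {f} else {})" by auto
    ultimately show ?thesis using True by (simp add: local_ext_def split: if_splits)
  next
    case False
    then show ?thesis using T(2) by (auto simp: local_ext_def form_trace_def)
  qed
qed

lemma global_ext_piecewise:
  assumes r: "r \<ge> 1" and f: "f \<in> faces \<T>" and \<mu>: "\<mu> \<in> poly_forms0 r k f"
  shows "global_ext xs k r \<T> \<Omega> f \<mu> \<in> piecewise_poly_forms r k \<T> \<Omega>"
  unfolding piecewise_poly_forms_iff
proof (intro exI conjI)
  show "glues k (local_ext k r f \<mu>) (global_ext xs k r \<T> \<Omega> f \<mu>)"
    by (rule glues_global_ext[OF r f poly_forms0_subset[OF \<mu>]])
  show "compatible r k (local_ext k r f \<mu>)"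
    by (rule compatibleI)
       (simp_all add: local_ext_poly_forms[OF r f poly_forms0_subset[OF \<mu>]] local_ext_trace[OF r f \<mu>])
qed

lemma subspace_global_ext:
  assumes r: "r \<ge> 1" and f: "f \<in> faces \<T>"
  shows "subspace (global_ext xs k r \<T> \<Omega> f ` poly_forms0 r k f)" (is "subspace (?G ` ?P)")
proof -
  have lin: "a *\<^sub>R u + b *\<^sub>R v \<in> ?G ` ?P" if uv: "u \<in> ?G ` ?P" "v \<in> ?G ` ?P" for a b u v
  proof -
    obtain \<mu> \<nu> where m: "\<mu> \<in> ?P" "u = ?G \<mu>" "\<nu> \<in> ?P" "v = ?G \<nu>" using uv by blast
    then have "a *\<^sub>R u + b *\<^sub>R v = ?G (\<lambda>y vs. a * \<mu> y vs + b * \<nu> y vs)"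
      using global_ext_lincomb[OF r f poly_forms0_subset poly_forms0_subset] by simp
    then show ?thesis using poly_forms0_lincomb[OF m(1,3)] by blast
  qed
  obtain u where u: "u \<in> ?G ` ?P" using poly_forms0_zero by blast
  have zero: "0 \<in> ?G ` ?P" using lin[OF u u, of 0 0] by simp
  show ?thesis using zero lin by (rule subspaceI_lincomb)
qed

text \<open>Matches the sum over faces of dimension at least k with the triangular sum over all
  faces of T: the missing faces carry the zero form, whose extension is 0, and faces not contained
  in T contribute 0 on T.\<close>

lemma sum_local_ext:
  assumes r: "r \<ge> 1" and I: "I = {f \<in> faces \<T>. int k \<le> aff_dim f}" and T: "T \<in> \<T>"
    and low: "\<And>f. f \<in> faces \<T> - I \<Longrightarrow> \<mu> f = (\<lambda>y vs. 0)"
  shows "(\<Sum>f\<in>I. local_ext k r f (\<mu> f) T y vs) = (\<Sum>f\<in>{f \<in> faces \<T>. f \<subseteq> T}. ext_op xs k r f T (\<mu> f) y vs)"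
proof -
  note TF = simplices_are_faces[OF T]
  have "local_ext k r f (\<mu> f) T y vs = 0" if f: "f \<in> faces \<T> - I" for f
    using low[OF f] ext_op_zero[OF face_numbered_simplex[OF TF] _ _ r, of f k] f
      faces_subset_face_of[OF _ TF, of f] faces_nonempty[of f] by (simp add: local_ext_def)
  then have "(\<Sum>f\<in>I. local_ext k r f (\<mu> f) T y vs) = (\<Sum>f\<in>faces \<T>. local_ext k r f (\<mu> f) T y vs)"
    using finite_faces I by (intro sum.mono_neutral_left) auto
  also have "\<dots> = (\<Sum>f\<in>{f \<in> faces \<T>. f \<subseteq> T}. local_ext k r f (\<mu> f) T y vs)"
    using finite_faces by (intro sum.mono_neutral_right) (auto simp: local_ext_def)
  also have "\<dots> = (\<Sum>f\<in>{f \<in> faces \<T>. f \<subseteq> T}. ext_op xs k r f T (\<mu> f) y vs)"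
    by (intro sum.cong) (auto simp: local_ext_def)
  finally show ?thesis .
qed

lemma decomposition_of_piecewise:
  assumes r: "r \<ge> 1" and I: "I = {f \<in> faces \<T>. int k \<le> aff_dim f}"
    and u: "u \<in> piecewise_poly_forms r k \<T> \<Omega>"
  shows "\<exists>\<mu>. (\<forall>f\<in>I. \<mu> f \<in> poly_forms0 r k f) \<and> u = (\<Sum>f\<in>I. global_ext xs k r \<T> \<Omega> f (\<mu> f))"
proof -
  obtain p where pc: "glues k p u" "compatible r k p"
    using u unfolding piecewise_poly_forms_iff by blast
  note p = pc(1) compatible_poly_forms[OF pc(2)] compatible_trace[OF pc(2)]
  \<comment> \<open>Any simplex containing h will do: compatibility makes the trace on h independent
    of the choice.\<close>
  define S where "S h = (SOME T. T \<in> \<T> \<and> h \<subseteq> T)" for h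
  have S: "S h \<in> \<T> \<and> h \<subseteq> S h" if "h \<in> faces \<T>" for h
  proof -
    have "\<exists>T. T \<in> \<T> \<and> h \<subseteq> T" using that face_of_imp_subset unfolding faces_def by blast
    then show ?thesis unfolding S_def by (rule someI_ex)
  qed
  define \<phi> where "\<phi> h = form_trace h (p (S h))" for h
  have "\<exists>\<mu>. (\<forall>f\<in>faces \<T>. \<mu> f \<in> poly_forms0 r k f) \<and>
    (\<forall>h\<in>faces \<T>. \<phi> h = (\<lambda>y vs. \<Sum>f\<in>{f \<in> faces \<T>. f \<subseteq> h}. ext_op xs k r f h (\<mu> f) y vs))"
  proof (rule decomposition_exists[OF r])
    show "\<phi> h \<in> poly_forms r k h" if "h \<in> faces \<T>" for h
      unfolding \<phi>_def using S[OF that] p(2) by (intro form_trace_poly_forms) auto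
    show "form_trace e (\<phi> h) = \<phi> e" if "e \<in> faces \<T>" "h \<in> faces \<T>" "e \<subseteq> h" for e h
    proof -
      have "form_trace e (\<phi> h) = form_trace e (p (S h))"
        using that(3) by (simp add: \<phi>_def form_trace_form_trace)
      also have "\<dots> = \<phi> e" unfolding \<phi>_def using S[OF that(1)] S[OF that(2)] that(3) by (intro p(3) that(1)) auto
      finally show ?thesis .
    qed
  qed
  then obtain \<mu> where \<mu>: "\<And>f. f \<in> faces \<T> \<Longrightarrow> \<mu> f \<in> poly_forms0 r k f"
    "\<And>h. h \<in> faces \<T> \<Longrightarrow> \<phi> h = (\<lambda>y vs. \<Sum>f\<in>{f \<in> faces \<T>. f \<subseteq> h}. ext_op xs k r f h (\<mu> f) y vs)"
    by blast
  \<comment> \<open>On these faces the degree k exceeds the dimension.\<close>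
  have low: "\<mu> f = (\<lambda>y vs. 0)" if "f \<in> faces \<T> - I" for f
    using that I by (intro poly_forms_low_dim[OF face_numbered_simplex _ poly_forms0_subset[OF \<mu>(1)]]) auto
  have "u = (\<Sum>f\<in>I. global_ext xs k r \<T> \<Omega> f (\<mu> f))"
  proof (rule glues_unique[OF p(1)])
    have "glues k (\<lambda>T y vs. \<Sum>f\<in>I. local_ext k r f (\<mu> f) T y vs) (\<Sum>f\<in>I. global_ext xs k r \<T> \<Omega> f (\<mu> f))"
      using I by (intro glues_sum glues_global_ext[OF r] poly_forms0_subset[OF \<mu>(1)]) auto
    then show "glues k p (\<Sum>f\<in>I. global_ext xs k r \<T> \<Omega> f (\<mu> f))"
    proof (rule glues_cong)
      fix T assume T: "T \<in> \<T>"
      note TF = simplices_are_faces[OF T]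
      have "(\<lambda>y vs. \<Sum>f\<in>I. local_ext k r f (\<mu> f) T y vs) = \<phi> T"
        unfolding \<mu>(2)[OF TF] by (intro ext sum_local_ext[OF r I T low])
      also have "\<dots> = form_trace T (p T)" unfolding \<phi>_def using S[OF TF] T by (intro p(3) TF) auto
      also have "\<dots> = p T" using p(2)[OF T] by (rule form_trace_self)
      finally show "(\<lambda>y vs. \<Sum>f\<in>I. local_ext k r f (\<mu> f) T y vs) = p T" .
    qed
  qed
  with \<mu>(1) I show ?thesis by (intro exI[of _ \<mu>]) auto
qed

text \<open>Equal classes have equal polynomial forms on every simplex, to which the triangular
  uniqueness applies. The conclusion concerns the forms and not just the summands, so it contains
  both the directness of the sum and the injectivity of each extension operator.\<close>

lemma global_ext_sum_inj:
  assumes r: "r \<ge> 1" and I: "I = {f \<in> faces \<T>. int k \<le> aff_dim f}"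
    and \<mu>: "\<And>f. f \<in> I \<Longrightarrow> \<mu> f \<in> poly_forms0 r k f" and \<nu>: "\<And>f. f \<in> I \<Longrightarrow> \<nu> f \<in> poly_forms0 r k f"
    and eq: "(\<Sum>f\<in>I. global_ext xs k r \<T> \<Omega> f (\<mu> f)) = (\<Sum>f\<in>I. global_ext xs k r \<T> \<Omega> f (\<nu> f))"
    and f: "f \<in> I"
  shows "\<mu> f = \<nu> f"
proof -
  have IF: "f \<in> faces \<T>" if "f \<in> I" for f using that I by simp
  \<comment> \<open>Difference of the two families, continued by 0 to the faces of dimension below
    k, since the triangular uniqueness ranges over all faces.\<close>
  define \<delta> where "\<delta> f = (if f \<in> I then (\<lambda>y vs. 1 * \<mu> f y vs + (-1) * \<nu> f y vs) else (\<lambda>y vs. 0))" for f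
  have \<delta>: "\<delta> f \<in> poly_forms0 r k f" for f
    using \<mu>[of f] \<nu>[of f] poly_forms0_lincomb[of "\<mu> f" r k f "\<nu> f" 1 "-1"] poly_forms0_zero[of r k f]
    by (cases "f \<in> I") (simp_all add: \<delta>_def)
  have glu: "glues k (\<lambda>T y vs. \<Sum>f\<in>I. local_ext k r f (\<mu> f) T y vs) (\<Sum>f\<in>I. global_ext xs k r \<T> \<Omega> f (\<mu> f))"
    using IF \<mu> by (intro glues_sum glues_global_ext[OF r] poly_forms0_subset)
  have "glues k (\<lambda>T y vs. \<Sum>f\<in>I. local_ext k r f (\<nu> f) T y vs) (\<Sum>f\<in>I. global_ext xs k r \<T> \<Omega> f (\<nu> f))"
    using IF \<nu> by (intro glues_sum glues_global_ext[OF r] poly_forms0_subset)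
  note glu = glu this[folded eq]
  have "\<delta> f = (\<lambda>y vs. 0)"
  proof (rule decomposition_unique[OF r \<delta> _ IF[OF f]])
    fix T assume T: "T \<in> \<T>"
    have pm: "(\<lambda>y vs. \<Sum>f\<in>I. local_ext k r f (\<mu> f) T y vs) \<in> poly_forms r k T"
      using poly_forms0_subset[OF \<mu>] by (intro poly_forms_sum local_ext_poly_forms[OF r IF _ T])
    have pn: "(\<lambda>y vs. \<Sum>f\<in>I. local_ext k r f (\<nu> f) T y vs) \<in> poly_forms r k T"
      using poly_forms0_subset[OF \<nu>] by (intro poly_forms_sum local_ext_poly_forms[OF r IF _ T])
    have same: "(\<lambda>y vs. \<Sum>f\<in>I. local_ext k r f (\<mu> f) T y vs) = (\<lambda>y vs. \<Sum>f\<in>I. local_ext k r f (\<nu> f) T y vs)"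
      using glues_inj[OF glu T pm pn] .
    show "(\<lambda>y vs. \<Sum>f\<in>{f \<in> faces \<T>. f \<subseteq> T}. ext_op xs k r f T (\<delta> f) y vs) = (\<lambda>y vs. 0)"
    proof (intro ext)
      fix y vs
      have "(\<Sum>f\<in>{f \<in> faces \<T>. f \<subseteq> T}. ext_op xs k r f T (\<delta> f) y vs) = (\<Sum>f\<in>I. local_ext k r f (\<delta> f) T y vs)"
        by (rule sum_local_ext[OF r I T, symmetric]) (simp add: \<delta>_def)
      also have "\<dots> = (\<Sum>f\<in>I. local_ext k r f (\<mu> f) T y vs - local_ext k r f (\<nu> f) T y vs)"
      proof (intro sum.cong refl)
        fix g assume g: "g \<in> I"
        have "\<delta> g = (\<lambda>y vs. 1 * \<mu> g y vs + (-1) * \<nu> g y vs)" using g by (simp add: \<delta>_def)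
        then show "local_ext k r g (\<delta> g) T y vs = local_ext k r g (\<mu> g) T y vs - local_ext k r g (\<nu> g) T y vs"
          using local_ext_lincomb[OF r IF[OF g] poly_forms0_subset[OF \<mu>[OF g]] poly_forms0_subset[OF \<nu>[OF g]] T, of 1 "-1"]
          by simp
      qed
      also have "\<dots> = 0" using fun_cong[OF fun_cong[OF same, of y], of vs] by (simp add: sum_subtractf)
      finally show "(\<Sum>f\<in>{f \<in> faces \<T>. f \<subseteq> T}. ext_op xs k r f T (\<delta> f) y vs) = 0" .
    qed
  qed
  then show ?thesis using f by (simp add: \<delta>_def fun_eq_iff)
qed

lemma direct_sum_decomposition:
  assumes r: "r \<ge> 1"
  shows "is_direct_sum (piecewise_poly_forms r k \<T> \<Omega>) {f \<in> faces \<T>. int k \<le> aff_dim f}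
    (\<lambda>f. global_ext xs k r \<T> \<Omega> f ` poly_forms0 r k f)"
proof -
  define I where "I = {f \<in> faces \<T>. int k \<le> aff_dim f}"
  let ?G = "global_ext xs k r \<T> \<Omega>"
  have IF: "f \<in> faces \<T>" if "f \<in> I" for f using that by (simp add: I_def)
  have "\<exists>!w. w \<in> Pi\<^sub>E I (\<lambda>f. ?G f ` poly_forms0 r k f) \<and> u = (\<Sum>i\<in>I. w i)"
    if u: "u \<in> piecewise_poly_forms r k \<T> \<Omega>" for u
  proof (rule ex_ex1I)
    obtain \<mu> where "\<forall>f\<in>I. \<mu> f \<in> poly_forms0 r k f" "u = (\<Sum>f\<in>I. ?G f (\<mu> f))"
      using decomposition_of_piecewise[OF r I_def u] by blast
    then show "\<exists>w. w \<in> Pi\<^sub>E I (\<lambda>f. ?G f ` poly_forms0 r k f) \<and> u = (\<Sum>i\<in>I. w i)"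
      by (intro exI[of _ "restrict (\<lambda>f. ?G f (\<mu> f)) I"]) auto
  next
    fix w w'
    assume w: "w \<in> Pi\<^sub>E I (\<lambda>f. ?G f ` poly_forms0 r k f) \<and> u = (\<Sum>i\<in>I. w i)"
      and w': "w' \<in> Pi\<^sub>E I (\<lambda>f. ?G f ` poly_forms0 r k f) \<and> u = (\<Sum>i\<in>I. w' i)"
    \<comment> \<open>The summands are compared through preimages: equal sums force equal forms on
      the faces, and these give equal summands.\<close>
    have "\<forall>f\<in>I. \<exists>m. m \<in> poly_forms0 r k f \<and> w f = ?G f m" using w by (blast dest: PiE_mem)
    then obtain \<mu> where \<mu>: "\<And>f. f \<in> I \<Longrightarrow> \<mu> f \<in> poly_forms0 r k f" "\<And>f. f \<in> I \<Longrightarrow> w f = ?G f (\<mu> f)" by metis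
    have "\<forall>f\<in>I. \<exists>m. m \<in> poly_forms0 r k f \<and> w' f = ?G f m" using w' by (blast dest: PiE_mem)
    then obtain \<nu> where \<nu>: "\<And>f. f \<in> I \<Longrightarrow> \<nu> f \<in> poly_forms0 r k f" "\<And>f. f \<in> I \<Longrightarrow> w' f = ?G f (\<nu> f)" by metis
    have "(\<Sum>f\<in>I. ?G f (\<mu> f)) = (\<Sum>f\<in>I. ?G f (\<nu> f))" using w w' \<mu>(2) \<nu>(2) by simp
    then have "\<mu> f = \<nu> f" if "f \<in> I" for f
      using global_ext_sum_inj[OF r I_def \<mu>(1) \<nu>(1) _ that] by blast
    then have "w f = w' f" if "f \<in> I" for f using that \<mu>(2) \<nu>(2) by simp
    then show "w = w'" by (rule PiE_ext[OF conjunct1[OF w] conjunct1[OF w']])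
  qed
  moreover have "finite I" using finite_faces by (simp add: I_def)
  ultimately show ?thesis
    unfolding is_direct_sum_def I_def[symmetric]
  proof (intro conjI ballI)
    show "subspace (piecewise_poly_forms r k \<T> \<Omega>)" by (rule subspace_piecewise_poly_forms)
    show "subspace (?G f ` poly_forms0 r k f)" if "f \<in> I" for f
      by (rule subspace_global_ext[OF r IF[OF that]])
    show "?G f ` poly_forms0 r k f \<subseteq> piecewise_poly_forms r k \<T> \<Omega>" if "f \<in> I" for f
      by (rule image_subsetI) (rule global_ext_piecewise[OF r IF[OF that]])
  qed
qed

end

theorem theorem8p3:
  fixes \<Omega> :: "'a::euclidean_space set" and \<T> :: "'a set set" and xs :: "'a list"
    and r k :: nat
  assumes "polyhedral_domain \<Omega>" and "bounded \<Omega>"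
    and "simplicial_triangulation \<T> \<Omega>"
    and "vertex_numbering \<T> xs"
    and "r \<ge> 1" and "k \<le> DIM('a)"
  shows "is_direct_sum (piecewise_poly_forms r k \<T> \<Omega>)
           {f \<in> faces \<T>. int k \<le> aff_dim f}
           (\<lambda>f. global_ext xs k r \<T> \<Omega> f ` poly_forms0 r k f)"
proof -
  have tri: "triangulation \<T>" "\<And>T. T \<in> \<T> \<Longrightarrow> int DIM('a) simplex T" "\<Union>\<T> = closure \<Omega>"
    using assms(3) by (simp_all add: simplicial_triangulation_def)
  interpret domain_triangulation \<T> xs \<Omega>
  proof
    show "T \<noteq> {}" if "T \<in> \<T>" for T
      using interior_full_simplex(1)[OF tri(2)[OF that]] interior_subset by blast
  qed (use assms tri in auto)
  show ?thesis using assms(5) by (rule direct_sum_decomposition)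
qed

end
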